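(* A (locally small) category $\mathcal C$ is $\Phi_{\mathrm{lext}}$-exact if and only if it is lextensive.
   Context: All categories are ordinary locally small categories ($\mathcal V=\mathbf{Set}$); lex means finite-limit-preserving between finitely complete categories. A class of lex-weights $\Phi$ is a collection of functors $\phi:\mathcal K^{op}\to\mathbf{Set}$ with each $\mathcal K$ small and finitely complete. A $\Phi$-lex-colimit is a weighted colimit $\phi\star D$ with $\phi:\mathcal K^{op}\to\mathbf{Set}$ in $\Phi$ and $D$ a lex functor with domain $\mathcal K$. $\mathcal P\mathcal C$ is the category of small presheaves on $\mathcal C$ (presheaves that are left Kan extensions of their restriction to some small full subcategory); it is finitely complete if $\mathcal C$ is. For finitely complete $\mathcal C$, $\Phi_l\mathcal C$ is the smallest full replete subcategory of $\mathcal P\mathcal C$ containing the representables and closed under finite limits and $\Phi$-lex-colimits, and $W:\mathcal C\to\Phi_l\mathcal C$ is the restricted Yoneda embedding. $\mathcal C$ is $\Phi$-exact if it is finitely complete and $W$ has a finite-limit-preserving left adjoint. The class $\Phi_{\mathrm{lext}}$ consists of two functors $\phi_0:\mathcal K_0^{op}\to\mathbf{Set}$ and $\phi_2:\mathcal K_2^{op}\to\mathbf{Set}$: $\mathcal K_0$ is the terminal category and $\phi_0$ the initial object of $[\mathcal K_0^{op},\mathbf{Set}]$; $\mathcal K_2$ is the free category with finite limits on a pair of objects $X,Y$, and $\phi_2=\mathcal K_2(-,X)+\mathcal K_2(-,Y)$. (A finitely complete category has all $\Phi_{\mathrm{lext}}$-lex-colimits just when it has finite coproducts.) A category is lextensive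 if it has finite limits and finite coproducts, and the finite coproducts are stable under pullback and disjoint. *)

theory Defs
  imports Complex_Main "HOL-Library.FuncSet" "HOL-Library.Equipollence"
begin

section \<open>The universe of sets\<close>

text \<open>
  The elements of a type \<open>'u\<close> of class \<open>set_universe\<close> play the role of the
  mathematical universe: a set is small if it is strictly smaller than \<open>'u\<close>, and the
  category of sets consists of the small subsets of \<open>'u\<close>. The class axioms say that the
  cardinality of \<open>'u\<close> is uncountable and regular. This includes every Grothendieck
  universe (an uncountable inaccessible cardinality), but the strong limit property is
  not required, so that such types provably exist in HOL (for example, of cardinality \<open>cardSuc natLeq\<close>).
\<close>

class set_universe =
  assumes universe_infinity: "(UNIV :: nat set) \<prec> (UNIV :: 'a set)"
    and universe_union:
      "\<And>(I :: 'a set) (A :: 'a \<Rightarrow> 'a set).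
         I \<prec> (UNIV :: 'a set) \<Longrightarrow> (\<And>i. i \<in> I \<Longrightarrow> A i \<prec> (UNIV :: 'a set)) \<Longrightarrow>
         (\<Union>i\<in>I. A i) \<prec> (UNIV :: 'a set)"

definition small :: "'u itself \<Rightarrow> 'b set \<Rightarrow> bool" where
  "small U X \<longleftrightarrow> X \<prec> (UNIV :: 'u set)"


section \<open>Categories, functors, natural transformations\<close>

text \<open>
  Hom-sets are indexed by source and target and need not be disjoint.
  \<open>Comp C X Y Z g f\<close> is the composite of \<open>f : X \<rightarrow> Y\<close> and \<open>g : Y \<rightarrow> Z\<close>.
\<close>

record ('o, 'm) cat =
  Obj :: "'o set"
  Hom :: "'o \<Rightarrow> 'o \<Rightarrow> 'm set"
  Id :: "'o \<Rightarrow> 'm"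
  Comp :: "'o \<Rightarrow> 'o \<Rightarrow> 'o \<Rightarrow> 'm \<Rightarrow> 'm \<Rightarrow> 'm"

definition category :: "('o, 'm) cat \<Rightarrow> bool" where
  "category C \<longleftrightarrow>
     (\<forall>X\<in>Obj C. Id C X \<in> Hom C X X) \<and>
     (\<forall>X\<in>Obj C. \<forall>Y\<in>Obj C. \<forall>Z\<in>Obj C. \<forall>f\<in>Hom C X Y. \<forall>g\<in>Hom C Y Z.
        Comp C X Y Z g f \<in> Hom C X Z) \<and>
     (\<forall>X\<in>Obj C. \<forall>Y\<in>Obj C. \<forall>f\<in>Hom C X Y.
        Comp C X X Y f (Id C X) = f \<and> Comp C X Y Y (Id C Y) f = f) \<and>
     (\<forall>W\<in>Obj C. \<forall>X\<in>Obj C. \<forall>Y\<in>Obj C. \<forall>Z\<in>Obj C.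
        \<forall>f\<in>Hom C W X. \<forall>g\<in>Hom C X Y. \<forall>h\<in>Hom C Y Z.
        Comp C W X Z (Comp C X Y Z h g) f = Comp C W Y Z h (Comp C W X Y g f))"

definition locally_small :: "('o, 'u) cat \<Rightarrow> bool" where
  "locally_small C \<longleftrightarrow> (\<forall>X\<in>Obj C. \<forall>Y\<in>Obj C. small TYPE('u) (Hom C X Y))"

definition small_category :: "('o, 'u) cat \<Rightarrow> bool" where
  "small_category C \<longleftrightarrow> category C \<and> small TYPE('u) (Obj C) \<and> locally_small C"

definition op_cat :: "('o, 'm) cat \<Rightarrow> ('o, 'm) cat" where
  "op_cat C = \<lparr>Obj = Obj C, Hom = (\<lambda>X Y. Hom C Y X), Id = Id C,
               Comp = (\<lambda>X Y Z g f. Comp C Z Y X f g)\<rparr>"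

definition full_subcat :: "('o, 'm) cat \<Rightarrow> 'o set \<Rightarrow> ('o, 'm) cat" where
  "full_subcat C S = C\<lparr>Obj := S\<rparr>"

definition is_iso :: "('o, 'm) cat \<Rightarrow> 'o \<Rightarrow> 'o \<Rightarrow> 'm \<Rightarrow> bool" where
  "is_iso C X Y f \<longleftrightarrow> f \<in> Hom C X Y \<and>
     (\<exists>g\<in>Hom C Y X. Comp C X Y X g f = Id C X \<and> Comp C Y X Y f g = Id C Y)"

definition isomorphic :: "('o, 'm) cat \<Rightarrow> 'o \<Rightarrow> 'o \<Rightarrow> bool" where
  "isomorphic C X Y \<longleftrightarrow> (\<exists>f. is_iso C X Y f)"

definition is_mono :: "('o, 'm) cat \<Rightarrow> 'o \<Rightarrow> 'o \<Rightarrow> 'm \<Rightarrow> bool" where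
  "is_mono C X Y f \<longleftrightarrow> f \<in> Hom C X Y \<and>
     (\<forall>Z\<in>Obj C. \<forall>g\<in>Hom C Z X. \<forall>h\<in>Hom C Z X.
        Comp C Z X Y f g = Comp C Z X Y f h \<longrightarrow> g = h)"

record ('o, 'm, 'p, 'n) functr =
  Fo :: "'o \<Rightarrow> 'p"
  Fm :: "'o \<Rightarrow> 'o \<Rightarrow> 'm \<Rightarrow> 'n"

definition is_functor ::
  "('o, 'm) cat \<Rightarrow> ('p, 'n) cat \<Rightarrow> ('o, 'm, 'p, 'n) functr \<Rightarrow> bool" where
  "is_functor C D F \<longleftrightarrow>
     (\<forall>X\<in>Obj C. Fo F X \<in> Obj D) \<and>
     (\<forall>X\<in>Obj C. \<forall>Y\<in>Obj C. \<forall>f\<in>Hom C X Y. Fm F X Y f \<in> Hom D (Fo F X) (Fo F Y)) \<and>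
     (\<forall>X\<in>Obj C. Fm F X X (Id C X) = Id D (Fo F X)) \<and>
     (\<forall>X\<in>Obj C. \<forall>Y\<in>Obj C. \<forall>Z\<in>Obj C. \<forall>f\<in>Hom C X Y. \<forall>g\<in>Hom C Y Z.
        Fm F X Z (Comp C X Y Z g f) =
        Comp D (Fo F X) (Fo F Y) (Fo F Z) (Fm F Y Z g) (Fm F X Y f))"

definition functor_comp ::
  "('p, 'n, 'q, 'r) functr \<Rightarrow> ('o, 'm, 'p, 'n) functr \<Rightarrow> ('o, 'm, 'q, 'r) functr" where
  "functor_comp G F = \<lparr>Fo = (\<lambda>X. Fo G (Fo F X)),
                       Fm = (\<lambda>X Y f. Fm G (Fo F X) (Fo F Y) (Fm F X Y f))\<rparr>"

definition nat_trans ::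
  "('o, 'm) cat \<Rightarrow> ('p, 'n) cat \<Rightarrow> ('o, 'm, 'p, 'n) functr \<Rightarrow> ('o, 'm, 'p, 'n) functr \<Rightarrow>
   ('o \<Rightarrow> 'n) set" where
  "nat_trans C D F G =
     {\<alpha>. \<alpha> \<in> extensional (Obj C) \<and>
         (\<forall>X\<in>Obj C. \<alpha> X \<in> Hom D (Fo F X) (Fo G X)) \<and>
         (\<forall>X\<in>Obj C. \<forall>Y\<in>Obj C. \<forall>f\<in>Hom C X Y.
            Comp D (Fo F X) (Fo F Y) (Fo G Y) (\<alpha> Y) (Fm F X Y f) =
            Comp D (Fo F X) (Fo G X) (Fo G Y) (Fm G X Y f) (\<alpha> X))}"

text \<open>
  Functors are not normalised outside the source category; two functors that agree on it
  are isomorphic in the functor category, by the identity transformation.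
\<close>

definition functor_cat ::
  "('o, 'm) cat \<Rightarrow> ('p, 'n) cat \<Rightarrow> (('o, 'm, 'p, 'n) functr, 'o \<Rightarrow> 'n) cat" where
  "functor_cat C D =
     \<lparr>Obj = {F. is_functor C D F},
      Hom = nat_trans C D,
      Id = (\<lambda>F. \<lambda>X\<in>Obj C. Id D (Fo F X)),
      Comp = (\<lambda>F G H \<beta> \<alpha>. \<lambda>X\<in>Obj C. Comp D (Fo F X) (Fo G X) (Fo H X) (\<beta> X) (\<alpha> X))\<rparr>"


section \<open>Finite limits and coproducts\<close>

definition is_cone ::
  "('j, 'k) cat \<Rightarrow> ('o, 'm) cat \<Rightarrow> ('j, 'k, 'o, 'm) functr \<Rightarrow> 'o \<Rightarrow> ('j \<Rightarrow> 'm) \<Rightarrow> bool" where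
  "is_cone J C T L \<pi> \<longleftrightarrow> L \<in> Obj C \<and>
     (\<forall>j\<in>Obj J. \<pi> j \<in> Hom C L (Fo T j)) \<and>
     (\<forall>i\<in>Obj J. \<forall>j\<in>Obj J. \<forall>k\<in>Hom J i j.
        Comp C L (Fo T i) (Fo T j) (Fm T i j k) (\<pi> i) = \<pi> j)"

definition is_limit ::
  "('j, 'k) cat \<Rightarrow> ('o, 'm) cat \<Rightarrow> ('j, 'k, 'o, 'm) functr \<Rightarrow> 'o \<Rightarrow> ('j \<Rightarrow> 'm) \<Rightarrow> bool" where
  "is_limit J C T L \<pi> \<longleftrightarrow> is_cone J C T L \<pi> \<and>
     (\<forall>M \<mu>. is_cone J C T M \<mu> \<longrightarrow>
        (\<exists>!h. h \<in> Hom C M L \<and> (\<forall>j\<in>Obj J. Comp C M L (Fo T j) (\<pi> j) h = \<mu> j)))"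

text \<open>Up to isomorphism, every finite category has objects and arrows of type \<^typ>\<open>nat\<close>.\<close>

definition finite_category :: "(nat, nat) cat \<Rightarrow> bool" where
  "finite_category J \<longleftrightarrow> category J \<and> finite (Obj J) \<and>
     (\<forall>i\<in>Obj J. \<forall>j\<in>Obj J. finite (Hom J i j))"

definition finitely_complete :: "('o, 'm) cat \<Rightarrow> bool" where
  "finitely_complete C \<longleftrightarrow>
     (\<forall>J T. finite_category J \<and> is_functor J C T \<longrightarrow> (\<exists>L \<pi>. is_limit J C T L \<pi>))"

text \<open>
  Finite completeness of source and target is stated separately where it is not automatic.
\<close>

definition lex_functor ::
  "('o, 'm) cat \<Rightarrow> ('p, 'n) cat \<Rightarrow> ('o, 'm, 'p, 'n) functr \<Rightarrow> bool" where
  "lex_functor C D F \<longleftrightarrow> is_functor C D F \<and>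
     (\<forall>J T L \<pi>. finite_category J \<and> is_functor J C T \<and> is_limit J C T L \<pi> \<longrightarrow>
        is_limit J D (functor_comp F T) (Fo F L) (\<lambda>j. Fm F L (Fo T j) (\<pi> j)))"

definition is_initial :: "('o, 'm) cat \<Rightarrow> 'o \<Rightarrow> bool" where
  "is_initial C Z \<longleftrightarrow> Z \<in> Obj C \<and> (\<forall>X\<in>Obj C. \<exists>!f. f \<in> Hom C Z X)"

definition is_coproduct ::
  "('o, 'm) cat \<Rightarrow> 'i set \<Rightarrow> ('i \<Rightarrow> 'o) \<Rightarrow> 'o \<Rightarrow> ('i \<Rightarrow> 'm) \<Rightarrow> bool" where
  "is_coproduct C I A S \<iota> \<longleftrightarrow> S \<in> Obj C \<and> (\<forall>i\<in>I. \<iota> i \<in> Hom C (A i) S) \<and>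
     (\<forall>Z\<in>Obj C. \<forall>\<mu>. (\<forall>i\<in>I. \<mu> i \<in> Hom C (A i) Z) \<longrightarrow>
        (\<exists>!h. h \<in> Hom C S Z \<and> (\<forall>i\<in>I. Comp C (A i) S Z h (\<iota> i) = \<mu> i)))"

definition has_finite_coproducts :: "('o, 'm) cat \<Rightarrow> bool" where
  "has_finite_coproducts C \<longleftrightarrow>
     (\<forall>(I :: nat set) A. finite I \<and> A \<in> I \<rightarrow> Obj C \<longrightarrow> (\<exists>S \<iota>. is_coproduct C I A S \<iota>))"

text \<open>\<open>P\<close>, with \<open>p : P \<rightarrow> X\<close> and \<open>q : P \<rightarrow> Y\<close>, is a pullback of
  \<open>f : X \<rightarrow> Z\<close> and \<open>g : Y \<rightarrow> Z\<close>.\<close>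

definition is_pullback ::
  "('o, 'm) cat \<Rightarrow> 'o \<Rightarrow> 'o \<Rightarrow> 'o \<Rightarrow> 'm \<Rightarrow> 'm \<Rightarrow> 'o \<Rightarrow> 'm \<Rightarrow> 'm \<Rightarrow> bool" where
  "is_pullback C X Y Z f g P p q \<longleftrightarrow>
     P \<in> Obj C \<and> p \<in> Hom C P X \<and> q \<in> Hom C P Y \<and>
     Comp C P X Z f p = Comp C P Y Z g q \<and>
     (\<forall>Q\<in>Obj C. \<forall>a\<in>Hom C Q X. \<forall>b\<in>Hom C Q Y.
        Comp C Q X Z f a = Comp C Q Y Z g b \<longrightarrow>
        (\<exists>!h. h \<in> Hom C Q P \<and> Comp C Q P X p h = a \<and> Comp C Q P Y q h = b))"

definition coproducts_stable :: "('o, 'm) cat \<Rightarrow> bool" where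
  "coproducts_stable C \<longleftrightarrow>
     (\<forall>(I :: nat set) A S \<iota> Z f P p q.
        finite I \<and> A \<in> I \<rightarrow> Obj C \<and> is_coproduct C I A S \<iota> \<and> Z \<in> Obj C \<and> f \<in> Hom C Z S \<and>
        (\<forall>i\<in>I. is_pullback C Z (A i) S f (\<iota> i) (P i) (p i) (q i)) \<longrightarrow>
        is_coproduct C I P Z p)"

definition coproducts_disjoint :: "('o, 'm) cat \<Rightarrow> bool" where
  "coproducts_disjoint C \<longleftrightarrow>
     (\<forall>(I :: nat set) A S \<iota>. finite I \<and> A \<in> I \<rightarrow> Obj C \<and> is_coproduct C I A S \<iota> \<longrightarrow>
        (\<forall>i\<in>I. is_mono C (A i) S (\<iota> i)) \<and>
        (\<forall>i\<in>I. \<forall>j\<in>I. \<forall>P p q.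
           i \<noteq> j \<and> is_pullback C (A i) (A j) S (\<iota> i) (\<iota> j) P p q \<longrightarrow> is_initial C P))"

definition lextensive :: "('o, 'm) cat \<Rightarrow> bool" where
  "lextensive C \<longleftrightarrow> finitely_complete C \<and> has_finite_coproducts C \<and>
     coproducts_stable C \<and> coproducts_disjoint C"


section \<open>Presheaves\<close>

definition set_cat :: "('u set, 'u \<Rightarrow> 'u) cat" where
  "set_cat = \<lparr>Obj = {X. small TYPE('u) X}, Hom = (\<lambda>X Y. X \<rightarrow>\<^sub>E Y), Id = (\<lambda>X. \<lambda>x\<in>X. x),
              Comp = (\<lambda>X Y Z g f. compose X g f)\<rparr>"

type_synonym ('o, 'u) psh = "('o, 'u, 'u set, 'u \<Rightarrow> 'u) functr"

definition psh_cat :: "('o, 'u) cat \<Rightarrow> (('o, 'u) psh, 'o \<Rightarrow> 'u \<Rightarrow> 'u) cat" where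
  "psh_cat C = functor_cat (op_cat C) set_cat"

definition representable :: "('o, 'u) cat \<Rightarrow> 'o \<Rightarrow> ('o, 'u) psh" where
  "representable C A = \<lparr>Fo = (\<lambda>X. Hom C X A),
                        Fm = (\<lambda>X Y f. \<lambda>g\<in>Hom C X A. Comp C Y X A g f)\<rparr>"

text \<open>
  \<open>F\<close> is the left Kan extension, along the inclusion, of its restriction to the full
  subcategory on \<open>S\<close>: transformations out of the restriction extend uniquely to \<open>F\<close>.
\<close>

definition lan_of_restriction :: "('o, 'u) cat \<Rightarrow> 'o set \<Rightarrow> ('o, 'u) psh \<Rightarrow> bool" where
  "lan_of_restriction C S F \<longleftrightarrow>
     (\<forall>G\<in>Obj (psh_cat C). \<forall>\<beta>\<in>Hom (psh_cat (full_subcat C S)) F G.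
        \<exists>!\<alpha>. \<alpha> \<in> Hom (psh_cat C) F G \<and> (\<forall>X\<in>S. \<alpha> X = \<beta> X))"

definition small_psh_cat :: "('o, 'u) cat \<Rightarrow> (('o, 'u) psh, 'o \<Rightarrow> 'u \<Rightarrow> 'u) cat" where
  "small_psh_cat C = full_subcat (psh_cat C)
     {F \<in> Obj (psh_cat C).
        \<exists>S. S \<subseteq> Obj C \<and> small TYPE('u) S \<and> lan_of_restriction C S F}"


section \<open>Lex-weights and lex-colimits\<close>

text \<open>The colimit of \<open>D : K \<rightarrow> E\<close> weighted by \<open>\<phi> : K\<^sup>o\<^sup>p \<rightarrow> Set\<close> is presented by its unit
  \<open>\<phi> \<rightarrow> E(D-, L)\<close>, a universal element for the functor \<open>[K\<^sup>o\<^sup>p, Set](\<phi>, E(D-, ?))\<close>.\<close>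

definition weighted_cocone ::
  "('k, 'u) cat \<Rightarrow> ('k, 'u) psh \<Rightarrow> ('o, 'm) cat \<Rightarrow> ('k, 'u, 'o, 'm) functr \<Rightarrow> 'o \<Rightarrow>
   ('k \<Rightarrow> 'u \<Rightarrow> 'm) \<Rightarrow> bool" where
  "weighted_cocone K \<phi> E D L \<eta> \<longleftrightarrow> L \<in> Obj E \<and>
     (\<forall>k\<in>Obj K. \<forall>x\<in>Fo \<phi> k. \<eta> k x \<in> Hom E (Fo D k) L) \<and>
     (\<forall>k\<in>Obj K. \<forall>l\<in>Obj K. \<forall>f\<in>Hom K k l. \<forall>x\<in>Fo \<phi> l.
        \<eta> k (Fm \<phi> l k f x) = Comp E (Fo D k) (Fo D l) L (\<eta> l x) (Fm D k l f))"

definition is_weighted_colimit ::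
  "('k, 'u) cat \<Rightarrow> ('k, 'u) psh \<Rightarrow> ('o, 'm) cat \<Rightarrow> ('k, 'u, 'o, 'm) functr \<Rightarrow> 'o \<Rightarrow>
   ('k \<Rightarrow> 'u \<Rightarrow> 'm) \<Rightarrow> bool" where
  "is_weighted_colimit K \<phi> E D L \<eta> \<longleftrightarrow> weighted_cocone K \<phi> E D L \<eta> \<and>
     (\<forall>M \<mu>. weighted_cocone K \<phi> E D M \<mu> \<longrightarrow>
        (\<exists>!h. h \<in> Hom E L M \<and>
           (\<forall>k\<in>Obj K. \<forall>x\<in>Fo \<phi> k. Comp E (Fo D k) L M h (\<eta> k x) = \<mu> k x)))"

text \<open>A small category has, up to isomorphism, objects and arrows of type \<open>'u\<close>.\<close>

type_synonym 'u weight = "('u, 'u) cat \<times> ('u, 'u) psh"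

definition lex_weight :: "'u weight \<Rightarrow> bool" where
  "lex_weight w \<longleftrightarrow> (case w of (K, \<phi>) \<Rightarrow>
     small_category K \<and> finitely_complete K \<and> \<phi> \<in> Obj (psh_cat K))"

definition lex_closed :: "'u weight set \<Rightarrow> ('o, 'u) cat \<Rightarrow> ('o, 'u) psh set \<Rightarrow> bool" where
  "lex_closed \<Phi> C S \<longleftrightarrow>
     S \<subseteq> Obj (small_psh_cat C) \<and>
     (\<forall>F\<in>S. \<forall>G\<in>Obj (small_psh_cat C). isomorphic (small_psh_cat C) F G \<longrightarrow> G \<in> S) \<and>
     (\<forall>A\<in>Obj C. representable C A \<in> S) \<and>
     (\<forall>J T L \<pi>. finite_category J \<and> is_functor J (small_psh_cat C) T \<and>
        (\<forall>j\<in>Obj J. Fo T j \<in> S) \<and> is_limit J (small_psh_cat C) T L \<pi> \<longrightarrow> L \<in> S) \<and>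
     (\<forall>(K, \<phi>)\<in>\<Phi>. \<forall>D L \<eta>. lex_functor K (small_psh_cat C) D \<and>
        (\<forall>k\<in>Obj K. Fo D k \<in> S) \<and> is_weighted_colimit K \<phi> (small_psh_cat C) D L \<eta> \<longrightarrow> L \<in> S)"

definition Phi_l :: "'u weight set \<Rightarrow> ('o, 'u) cat \<Rightarrow> (('o, 'u) psh, 'o \<Rightarrow> 'u \<Rightarrow> 'u) cat" where
  "Phi_l \<Phi> C = full_subcat (small_psh_cat C) (\<Inter>{S. lex_closed \<Phi> C S})"

definition yoneda :: "('o, 'u) cat \<Rightarrow> ('o, 'u, ('o, 'u) psh, 'o \<Rightarrow> 'u \<Rightarrow> 'u) functr" where
  "yoneda C = \<lparr>Fo = representable C,
               Fm = (\<lambda>A B f. \<lambda>X\<in>Obj C. \<lambda>g\<in>Hom C X A. Comp C X A B f g)\<rparr>"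

definition left_adjoint ::
  "('o, 'm) cat \<Rightarrow> ('p, 'n) cat \<Rightarrow> ('p, 'n, 'o, 'm) functr \<Rightarrow> ('o, 'm, 'p, 'n) functr \<Rightarrow> bool"
where
  "left_adjoint C E L W \<longleftrightarrow> is_functor E C L \<and> is_functor C E W \<and>
     (\<exists>\<theta>. (\<forall>P\<in>Obj E. \<forall>X\<in>Obj C. bij_betw (\<theta> P X) (Hom C (Fo L P) X) (Hom E P (Fo W X))) \<and>
        (\<forall>P\<in>Obj E. \<forall>X\<in>Obj C. \<forall>Y\<in>Obj C. \<forall>h\<in>Hom C (Fo L P) X. \<forall>k\<in>Hom C X Y.
           \<theta> P Y (Comp C (Fo L P) X Y k h) =
           Comp E P (Fo W X) (Fo W Y) (Fm W X Y k) (\<theta> P X h)) \<and>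
        (\<forall>P\<in>Obj E. \<forall>Q\<in>Obj E. \<forall>X\<in>Obj C. \<forall>h\<in>Hom C (Fo L P) X. \<forall>p\<in>Hom E Q P.
           \<theta> Q X (Comp C (Fo L Q) (Fo L P) X h (Fm L Q P p)) =
           Comp E Q P (Fo W X) (\<theta> P X h) p))"

definition Phi_exact :: "'u weight set \<Rightarrow> ('o, 'u) cat \<Rightarrow> bool" where
  "Phi_exact \<Phi> C \<longleftrightarrow> finitely_complete C \<and>
     (\<exists>L. lex_functor (Phi_l \<Phi> C) C L \<and> left_adjoint C (Phi_l \<Phi> C) L (yoneda C))"


section \<open>The lex-weights for finite coproducts\<close>

definition terminal_category :: "('o, 'm) cat \<Rightarrow> bool" where
  "terminal_category K \<longleftrightarrow> category K \<and> (\<exists>x. Obj K = {x} \<and> Hom K x x = {Id K x})"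

text \<open>
  \<open>K\<close> is free with finite limits on the objects \<open>X\<close>, \<open>Y\<close> in the usual (two-dimensional)
  sense: for every finitely complete \<open>E\<close>, evaluation at \<open>X\<close> and \<open>Y\<close> is an equivalence from
  lex functors \<open>K \<rightarrow> E\<close> to \<open>E \<times> E\<close>, that is, essentially surjective and fully faithful.
  Since \<open>K\<close> itself is among the categories \<open>E\<close>, this determines \<open>K\<close> up to equivalence.
\<close>

definition free_lex_on_pair :: "('u, 'u) cat \<Rightarrow> 'u \<Rightarrow> 'u \<Rightarrow> bool" where
  "free_lex_on_pair K X Y \<longleftrightarrow>
     category K \<and> locally_small K \<and> finitely_complete K \<and> X \<in> Obj K \<and> Y \<in> Obj K \<and>
     (\<forall>E :: ('u, 'u) cat. category E \<and> locally_small E \<and> finitely_complete E \<longrightarrow>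
        (\<forall>A\<in>Obj E. \<forall>B\<in>Obj E. \<exists>F. lex_functor K E F \<and>
           isomorphic E (Fo F X) A \<and> isomorphic E (Fo F Y) B) \<and>
        (\<forall>F G. lex_functor K E F \<and> lex_functor K E G \<longrightarrow>
           (\<forall>f\<in>Hom E (Fo F X) (Fo G X). \<forall>g\<in>Hom E (Fo F Y) (Fo G Y).
              \<exists>!\<alpha>. \<alpha> \<in> nat_trans K E F G \<and> \<alpha> X = f \<and> \<alpha> Y = g)))"

text \<open>
  The ingredients of the two weights are determined only up to equivalence and isomorphism;
  any choice of them is allowed.
\<close>

definition is_lext_class :: "'u weight set \<Rightarrow> bool" where
  "is_lext_class \<Phi> \<longleftrightarrow>
     (\<exists>K0 \<phi>0 K2 X Y \<phi>2 \<iota>.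
        \<Phi> = {(K0, \<phi>0), (K2, \<phi>2)} \<and> (\<forall>w\<in>\<Phi>. lex_weight w) \<and>
        terminal_category K0 \<and> is_initial (psh_cat K0) \<phi>0 \<and>
        free_lex_on_pair K2 X Y \<and>
        is_coproduct (psh_cat K2) (UNIV :: bool set)
          (\<lambda>b. if b then representable K2 X else representable K2 Y) \<phi>2 \<iota>)"

end

(*
  For finitely complete C, the finite coproducts of representables are closed in the presheaves
  under finite limits: a limit of such coproducts is the coproduct, over the compatible selections
  of summands, of limits computed in C. They are also reached from the representables by the two
  weights, because K_2 maps by a lex functor to the presheaves with prescribed values at X and Y;
  this functor factors through an explicit model of K_2, the opposite of the category of finite
  sets labelled by two colours. Hence the completion of C consists of the finite coproducts of
  representables, and a left adjoint of W sends the sum of the C(-, A i) to the coproduct of the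
  A i in C.

  If this left adjoint is lex, it transports stability and disjointness of coproducts from
  presheaves to C. Conversely, if C is lextensive, the unit F -> W L F is locally bijective for
  the topology of finite coproduct decompositions, and L preserves finite limits as
  sheafification does.
*)
theory Submission
  imports Defs
begin

text \<open>\<open>free_lex_on_pair\<close> tests K_2 only against categories with objects and
  arrows in \<open>'u\<close>. Presheaf categories have other types, so freeness does not yield the
  required diagram of presheaves directly: \<open>parity_cat\<close> is a test category of the right
  type, and lex functors out of it exist into every category with the relevant finite products.

  The closure conditions speak about whatever limits exist among small presheaves and do not assert
  existence. Closure of the finite sums must therefore cope with an arbitrary limit, while the
  products used to reach the sums must be constructed. Both reduce to the functor of compatible
  tuples, whose elements are functions and not elements of \<open>'u\<close>; coproducts of
  representables are described by universal elements because this makes sense for such functors too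
  and travels along pointwise bijections.

  Over an initial object W L F has one element but F has one for each summand, so the unit need not
  be injective there. The empty family covers such an object; hence the recurring alternative
  \<open>is_initial C N\<close>.\<close>

lemma Ex1_unique: "\<exists>!x. P x \<Longrightarrow> P a \<Longrightarrow> P b \<Longrightarrow> a = b"
  by blast


section \<open>Small sets\<close>

lemma small_lepoll: "X \<lesssim> Y \<Longrightarrow> small U Y \<Longrightarrow> small U X"
  unfolding small_def using lesspoll_trans1 by blast

lemma small_image: "small U X \<Longrightarrow> small U (f ` X)"
  by (rule small_lepoll[OF image_lepoll])

lemma small_countable:
  assumes "countable X"
  shows "small (U :: 'u::set_universe itself) X"
proof -
  have "X \<lesssim> (UNIV :: nat set)"
    using assms by (auto simp: countable_def lepoll_def)
  then show ?thesis
    unfolding small_def using universe_infinity lesspoll_trans1 by blast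
qed

lemma small_finite: "finite X \<Longrightarrow> small (U :: 'u::set_universe itself) X"
  by (rule small_countable[OF countable_finite])

definition nat_code :: "nat \<Rightarrow> 'u::set_universe" where
  "nat_code = (SOME f. inj f)"

lemma inj_nat_code: "inj (nat_code :: nat \<Rightarrow> 'u::set_universe)"
proof -
  have "(UNIV :: nat set) \<lesssim> (UNIV :: 'u set)"
    using universe_infinity by (rule lesspoll_imp_lepoll)
  then have "\<exists>f :: nat \<Rightarrow> 'u. inj f"
    by (auto simp: lepoll_def)
  then show ?thesis
    unfolding nat_code_def by (rule someI_ex)
qed

text \<open>An infinite set is in bijection with its square, and \<open>nat\<close> embeds in
  \<open>'u\<close>. The pairs serve to tag the arrows of a disjoint union by the index of their
  summand.\<close>

lemma ex_inj_nat_times: "\<exists>f :: nat \<times> 'u::set_universe \<Rightarrow> 'u. inj f"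
proof -
  have "infinite (UNIV :: 'u set)"
    using inj_nat_code[where 'u='u] by (auto simp: infinite_iff_countable_subset)
  then have "\<exists>f. bij_betw f ((UNIV :: 'u set) \<times> (UNIV :: 'u set)) (UNIV :: 'u set)"
    unfolding card_of_ordIso by (rule card_of_Times_same_infinite)
  then obtain f :: "'u \<times> 'u \<Rightarrow> 'u" where f: "inj f"
    unfolding UNIV_Times_UNIV by (blast dest: bij_betw_imp_inj_on)
  have "inj (map_prod (nat_code :: nat \<Rightarrow> 'u) (id :: 'u \<Rightarrow> 'u))"
    by (rule prod.inj_map[OF inj_nat_code inj_on_id])
  then have "inj (f \<circ> map_prod nat_code id)"
    by (rule inj_compose[OF f])
  then show ?thesis by blast
qed

definition pair_code :: "nat \<times> 'u::set_universe \<Rightarrow> 'u" where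
  "pair_code = (SOME f. inj f)"

lemma inj_pair_code: "inj pair_code"
  unfolding pair_code_def using ex_inj_nat_times by (rule someI_ex)

lemma pair_code_eq [simp]: "pair_code p = pair_code q \<longleftrightarrow> p = q"
  using inj_pair_code by (rule inj_eq)

text \<open>The regularity axiom \<open>universe_union\<close> indexes unions by elements of
  \<open>'u\<close>; natural indices are moved there along \<open>nat_code\<close>.\<close>

lemma small_UN_finite:
  assumes "finite (I :: nat set)" and "\<And>i. i \<in> I \<Longrightarrow> small (U :: 'u::set_universe itself) (A i)"
  shows "small U (\<Union>i\<in>I. A i :: 'u set)"
proof -
  let ?d = "inv (nat_code :: nat \<Rightarrow> 'u)"
  have d: "?d (nat_code i) = i" for i
    by (rule inv_f_f[OF inj_nat_code])
  have "(\<Union>j\<in>nat_code ` I. A (?d j)) \<prec> (UNIV :: 'u set)"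
  proof (rule universe_union)
    have "small TYPE('u) (nat_code ` I :: 'u set)"
      by (rule small_finite) (use assms(1) in blast)
    then show "(nat_code ` I :: 'u set) \<prec> (UNIV :: 'u set)"
      unfolding small_def .
    show "A (?d j) \<prec> (UNIV :: 'u set)" if "j \<in> nat_code ` I" for j
      using assms(2) that unfolding small_def by (metis d imageE)
  qed
  moreover have "(\<Union>j\<in>nat_code ` I. A (?d j)) = (\<Union>i\<in>I. A i)"
    unfolding image_image d ..
  ultimately show ?thesis unfolding small_def by argo
qed


section \<open>Categories\<close>

locale categ =
  fixes C :: "('o, 'm) cat"
  assumes category: "category C"
begin

lemma Id_in [simp, intro]: "X \<in> Obj C \<Longrightarrow> Id C X \<in> Hom C X X"
  using category by (auto simp: category_def)

lemma Comp_in [simp, intro]: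
  "f \<in> Hom C X Y \<Longrightarrow> g \<in> Hom C Y Z \<Longrightarrow> X \<in> Obj C \<Longrightarrow> Y \<in> Obj C \<Longrightarrow> Z \<in> Obj C \<Longrightarrow>
   Comp C X Y Z g f \<in> Hom C X Z"
  using category by (auto simp: category_def)

lemma Comp_Id_right [simp]: "f \<in> Hom C X Y \<Longrightarrow> X \<in> Obj C \<Longrightarrow> Y \<in> Obj C \<Longrightarrow> Comp C X X Y f (Id C X) = f"
  using category by (auto simp: category_def)

lemma Comp_Id_left [simp]: "f \<in> Hom C X Y \<Longrightarrow> X \<in> Obj C \<Longrightarrow> Y \<in> Obj C \<Longrightarrow> Comp C X Y Y (Id C Y) f = f"
  using category by (auto simp: category_def)

lemma Comp_assoc [simp]:
  "f \<in> Hom C W X \<Longrightarrow> g \<in> Hom C X Y \<Longrightarrow> h \<in> Hom C Y Z \<Longrightarrow>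
   W \<in> Obj C \<Longrightarrow> X \<in> Obj C \<Longrightarrow> Y \<in> Obj C \<Longrightarrow> Z \<in> Obj C \<Longrightarrow>
   Comp C W X Z (Comp C X Y Z h g) f = Comp C W Y Z h (Comp C W X Y g f)"
  using category unfolding category_def by meson

text \<open>Associativity as a rewrite rule nests composites to the right, which hides a commuting
  square once both sides are precomposed with \<open>h\<close>; this form restores it.\<close>

lemma Comp_extend:
  assumes "Comp C X Y Z g f = Comp C X Y' Z g' f'" "h \<in> Hom C W X"
    and "f \<in> Hom C X Y" "g \<in> Hom C Y Z" "f' \<in> Hom C X Y'" "g' \<in> Hom C Y' Z"
    and "W \<in> Obj C" "X \<in> Obj C" "Y \<in> Obj C" "Y' \<in> Obj C" "Z \<in> Obj C"
  shows "Comp C W Y Z g (Comp C W X Y f h) = Comp C W Y' Z g' (Comp C W X Y' f' h)"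
  using Comp_assoc[OF assms(2,3,4,7,8,9,11)] Comp_assoc[OF assms(2,5,6,7,8,10,11)] assms(1) by metis

section \<open>Coproducts and their comparison\<close>

lemma coproduct_Ex1:
  assumes "is_coproduct C I A S \<iota>" "Z \<in> Obj C" "\<And>i. i \<in> I \<Longrightarrow> \<mu> i \<in> Hom C (A i) Z"
  shows "\<exists>!h. h \<in> Hom C S Z \<and> (\<forall>i\<in>I. Comp C (A i) S Z h (\<iota> i) = \<mu> i)"
  using assms unfolding is_coproduct_def by simp

lemma coproduct_hom_eq:
  assumes "is_coproduct C I A S \<iota>" "Z \<in> Obj C" "h \<in> Hom C S Z" "h' \<in> Hom C S Z"
    and "\<And>i. i \<in> I \<Longrightarrow> A i \<in> Obj C"
    and "\<And>i. i \<in> I \<Longrightarrow> Comp C (A i) S Z h (\<iota> i) = Comp C (A i) S Z h' (\<iota> i)"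
  shows "h = h'"
proof -
  have S: "S \<in> Obj C" "\<And>i. i \<in> I \<Longrightarrow> \<iota> i \<in> Hom C (A i) S"
    using assms(1) by (auto simp: is_coproduct_def)
  have "\<exists>!k. k \<in> Hom C S Z \<and> (\<forall>i\<in>I. Comp C (A i) S Z k (\<iota> i) = Comp C (A i) S Z h (\<iota> i))"
    by (rule coproduct_Ex1[OF assms(1,2)]) (use S assms(2,3,5) in auto)
  then show ?thesis
    by (rule Ex1_unique) (use assms(3,4,6) in auto)
qed

lemma coproduct_desc:
  assumes "is_coproduct C I A S \<iota>" "Z \<in> Obj C" "\<And>i. i \<in> I \<Longrightarrow> \<mu> i \<in> Hom C (A i) Z"
  obtains h where "h \<in> Hom C S Z" "\<And>i. i \<in> I \<Longrightarrow> Comp C (A i) S Z h (\<iota> i) = \<mu> i"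
  using coproduct_Ex1[OF assms(1,2), of \<mu>] assms(3) by blast

text \<open>The new injections are a parameter, equal to the transported ones by hypothesis, so that
  in the stability proof they can be the given pullback projections.\<close>

lemma coproduct_transfer_iso:
  assumes S: "is_coproduct C I A S \<iota>" and Z: "Z \<in> Obj C"
    and A: "\<And>i. i \<in> I \<Longrightarrow> A i \<in> Obj C"
    and c: "c \<in> Hom C S Z" and d: "d \<in> Hom C Z S"
    and cd: "Comp C Z S Z c d = Id C Z"
    and dc: "Comp C S Z S d c = Id C S"
    and \<kappa>: "\<And>i. i \<in> I \<Longrightarrow> Comp C (A i) S Z c (\<iota> i) = \<kappa> i"
  shows "is_coproduct C I A Z \<kappa>"
  unfolding is_coproduct_def
proof (intro conjI ballI allI impI)
  have SO: "S \<in> Obj C" and \<iota>: "\<And>i. i \<in> I \<Longrightarrow> \<iota> i \<in> Hom C (A i) S"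
    using S by (auto simp: is_coproduct_def)
  show "Z \<in> Obj C" by fact
  show \<kappa>in: "\<kappa> i \<in> Hom C (A i) Z" if "i \<in> I" for i
    using \<kappa>[OF that, symmetric] \<iota>[OF that] A[OF that] c SO Z by auto
  fix X \<mu>
  assume X: "X \<in> Obj C" and \<mu>: "\<forall>i\<in>I. \<mu> i \<in> Hom C (A i) X"
  obtain h where h: "h \<in> Hom C S X" "\<And>i. i \<in> I \<Longrightarrow> Comp C (A i) S X h (\<iota> i) = \<mu> i"
    using coproduct_desc[OF S X] \<mu> by metis
  show "\<exists>!k. k \<in> Hom C Z X \<and> (\<forall>i\<in>I. Comp C (A i) Z X k (\<kappa> i) = \<mu> i)"
  proof (rule ex1I[of _ "Comp C Z S X h d"], intro conjI ballI)
    show "Comp C Z S X h d \<in> Hom C Z X" using h d SO X Z by auto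
    fix i assume i: "i \<in> I"
    have "Comp C (A i) Z S d (Comp C (A i) S Z c (\<iota> i)) = \<iota> i"
      using Comp_assoc[of "\<iota> i" "A i" S c Z d S] dc c d \<iota>[OF i] A[OF i] SO Z by simp
    then show "Comp C (A i) Z X (Comp C Z S X h d) (\<kappa> i) = \<mu> i"
      using h i \<kappa>[OF i] \<kappa>in[OF i] c d A[OF i] SO Z X by simp
  next
    fix k assume k: "k \<in> Hom C Z X \<and> (\<forall>i\<in>I. Comp C (A i) Z X k (\<kappa> i) = \<mu> i)"
    have "Comp C S Z X k c = h"
    proof (rule coproduct_hom_eq[OF S X])
      fix i assume i: "i \<in> I"
      show "Comp C (A i) S X (Comp C S Z X k c) (\<iota> i) = Comp C (A i) S X h (\<iota> i)"
        using k h i \<kappa>[OF i] \<iota>[OF i] c A[OF i] SO Z X by simp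
    qed (use k c SO Z X h A in auto)
    then have "Comp C Z S X h d = Comp C Z Z X k (Comp C Z S Z c d)"
      using k c d SO Z X Comp_assoc[of d Z S c Z k X] by simp
    then show "k = Comp C Z S X h d"
      using cd k Z X by simp
  qed
qed

lemma coproduct_compare:
  assumes S: "is_coproduct C I A S \<iota>" and T: "is_coproduct C I A T \<kappa>"
    and A: "\<And>i. i \<in> I \<Longrightarrow> A i \<in> Obj C"
  obtains c d where "c \<in> Hom C S T" "d \<in> Hom C T S"
    "Comp C T S T c d = Id C T" "Comp C S T S d c = Id C S"
    "\<And>i. i \<in> I \<Longrightarrow> Comp C (A i) S T c (\<iota> i) = \<kappa> i"
    "\<And>i. i \<in> I \<Longrightarrow> Comp C (A i) T S d (\<kappa> i) = \<iota> i"
proof -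
  have SO: "S \<in> Obj C" "\<And>i. i \<in> I \<Longrightarrow> \<iota> i \<in> Hom C (A i) S"
    and TO: "T \<in> Obj C" "\<And>i. i \<in> I \<Longrightarrow> \<kappa> i \<in> Hom C (A i) T"
    using S T by (auto simp: is_coproduct_def)
  obtain c where c: "c \<in> Hom C S T" "\<And>i. i \<in> I \<Longrightarrow> Comp C (A i) S T c (\<iota> i) = \<kappa> i"
    using coproduct_desc[OF S TO] by metis
  obtain d where d: "d \<in> Hom C T S" "\<And>i. i \<in> I \<Longrightarrow> Comp C (A i) T S d (\<kappa> i) = \<iota> i"
    using coproduct_desc[OF T SO] by metis
  have "Comp C S T S d c = Id C S"
    by (rule coproduct_hom_eq[OF S SO(1)]) (use c d SO TO A in auto)
  moreover have "Comp C T S T c d = Id C T"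
    by (rule coproduct_hom_eq[OF T TO(1)]) (use c d SO TO A in auto)
  ultimately show ?thesis using that c d by blast
qed

end


section \<open>Presheaves\<close>

lemma Obj_full_subcat [simp]: "Obj (full_subcat D S) = S"
  and Hom_full_subcat [simp]: "Hom (full_subcat D S) = Hom D"
  and Id_full_subcat [simp]: "Id (full_subcat D S) = Id D"
  and Comp_full_subcat [simp]: "Comp (full_subcat D S) = Comp D"
  and full_subcat_idem [simp]: "full_subcat (full_subcat D S) S' = full_subcat D S'"
  by (simp_all add: full_subcat_def)

lemma categ_full_subcat: "categ D \<Longrightarrow> S \<subseteq> Obj D \<Longrightarrow> categ (full_subcat D S)"
  unfolding categ_def category_def full_subcat_def by (simp add: subset_iff)

locale ls_categ = categ C for C :: "('o, 'u::set_universe) cat" +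
  assumes locally_small: "locally_small C"
begin

abbreviation psh :: "('o, 'u) psh \<Rightarrow> bool" where
  "psh F \<equiv> F \<in> Obj (psh_cat C)"

text \<open>The functor laws into \<open>set_cat\<close> equate extensional functions; here they are
  reduced to equations between elements.\<close>

lemma pshI:
  assumes "\<And>X. X \<in> Obj C \<Longrightarrow> small TYPE('u) (Fo F X)"
    and "\<And>X Y f. X \<in> Obj C \<Longrightarrow> Y \<in> Obj C \<Longrightarrow> f \<in> Hom C Y X \<Longrightarrow> Fm F X Y f \<in> Fo F X \<rightarrow>\<^sub>E Fo F Y"
    and "\<And>X x. X \<in> Obj C \<Longrightarrow> x \<in> Fo F X \<Longrightarrow> Fm F X X (Id C X) x = x"
    and "\<And>X Y Z f g x. X \<in> Obj C \<Longrightarrow> Y \<in> Obj C \<Longrightarrow> Z \<in> Obj C \<Longrightarrow> f \<in> Hom C Y X \<Longrightarrow> g \<in> Hom C Z Y \<Longrightarrow>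
       x \<in> Fo F X \<Longrightarrow> Fm F X Z (Comp C Z Y X f g) x = Fm F Y Z g (Fm F X Y f x)"
  shows "psh F"
  unfolding psh_cat_def functor_cat_def op_cat_def set_cat_def is_functor_def
proof (simp, intro conjI ballI)
  show "small TYPE('u) (Fo F X)" if "X \<in> Obj C" for X using assms(1) that .
  show "Fm F X Y f \<in> Fo F X \<rightarrow>\<^sub>E Fo F Y" if "X \<in> Obj C" "Y \<in> Obj C" "f \<in> Hom C Y X" for X Y f
    using assms(2) that .
  show "Fm F X X (Id C X) = (\<lambda>x\<in>Fo F X. x)" if "X \<in> Obj C" for X
  proof (rule PiE_ext)
    show "Fm F X X (Id C X) \<in> Fo F X \<rightarrow>\<^sub>E Fo F X" using assms(2) that by auto
  qed (use assms(3) that in auto)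
  fix X Y Z f g
  assume a: "X \<in> Obj C" "Y \<in> Obj C" "Z \<in> Obj C" "f \<in> Hom C Y X" "g \<in> Hom C Z Y"
  show "Fm F X Z (Comp C Z Y X f g) = compose (Fo F X) (Fm F Y Z g) (Fm F X Y f)"
  proof (rule PiE_ext)
    show "Fm F X Z (Comp C Z Y X f g) \<in> Fo F X \<rightarrow>\<^sub>E Fo F Z" using assms(2) a by auto
    show "compose (Fo F X) (Fm F Y Z g) (Fm F X Y f) \<in> Fo F X \<rightarrow>\<^sub>E Fo F Z"
      using assms(2)[OF a(1,2,4)] assms(2)[OF a(2,3,5)] by (auto simp: compose_def)
  qed (use assms(4) a in \<open>auto simp: compose_def\<close>)
qed

lemma psh_small: "psh F \<Longrightarrow> X \<in> Obj C \<Longrightarrow> small TYPE('u) (Fo F X)"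
  by (auto simp: psh_cat_def functor_cat_def op_cat_def set_cat_def is_functor_def)

lemma act_PiE: "psh F \<Longrightarrow> f \<in> Hom C Y X \<Longrightarrow> X \<in> Obj C \<Longrightarrow> Y \<in> Obj C \<Longrightarrow> Fm F X Y f \<in> Fo F X \<rightarrow>\<^sub>E Fo F Y"
  by (auto simp: psh_cat_def functor_cat_def op_cat_def set_cat_def is_functor_def)

lemma act_in [simp, intro]:
  "psh F \<Longrightarrow> x \<in> Fo F X \<Longrightarrow> f \<in> Hom C Y X \<Longrightarrow> X \<in> Obj C \<Longrightarrow> Y \<in> Obj C \<Longrightarrow> Fm F X Y f x \<in> Fo F Y"
  using act_PiE by (auto simp: PiE_iff)

lemma act_Id [simp]: "psh F \<Longrightarrow> x \<in> Fo F X \<Longrightarrow> X \<in> Obj C \<Longrightarrow> Fm F X X (Id C X) x = x"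
  by (auto simp: psh_cat_def functor_cat_def op_cat_def set_cat_def is_functor_def)

lemma act_Comp:
  "psh F \<Longrightarrow> x \<in> Fo F X \<Longrightarrow> f \<in> Hom C Y X \<Longrightarrow> g \<in> Hom C Z Y \<Longrightarrow> X \<in> Obj C \<Longrightarrow> Y \<in> Obj C \<Longrightarrow> Z \<in> Obj C \<Longrightarrow>
   Fm F X Z (Comp C Z Y X f g) x = Fm F Y Z g (Fm F X Y f x)"
  by (auto simp: psh_cat_def functor_cat_def op_cat_def set_cat_def is_functor_def compose_def)

lemma nat_iff:
  "\<alpha> \<in> Hom (psh_cat C) F G \<longleftrightarrow>
     \<alpha> \<in> extensional (Obj C) \<and> (\<forall>X\<in>Obj C. \<alpha> X \<in> Fo F X \<rightarrow>\<^sub>E Fo G X) \<and>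
     (\<forall>X\<in>Obj C. \<forall>Y\<in>Obj C. \<forall>f\<in>Hom C Y X. \<forall>x\<in>Fo F X. \<alpha> Y (Fm F X Y f x) = Fm G X Y f (\<alpha> X x))"
proof -
  have "compose (Fo F X) (\<alpha> Y) (Fm F X Y f) = compose (Fo F X) (Fm G X Y f) (\<alpha> X) \<longleftrightarrow>
      (\<forall>x\<in>Fo F X. \<alpha> Y (Fm F X Y f x) = Fm G X Y f (\<alpha> X x))" for X Y f
    by (auto simp: compose_def fun_eq_iff restrict_def)
  then show ?thesis
    by (simp add: psh_cat_def functor_cat_def op_cat_def set_cat_def nat_trans_def)
qed

lemma nat_in:
  "\<alpha> \<in> Hom (psh_cat C) F G \<Longrightarrow> x \<in> Fo F X \<Longrightarrow> X \<in> Obj C \<Longrightarrow> \<alpha> X x \<in> Fo G X"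
  unfolding nat_iff by (blast dest: PiE_mem)

lemma nat_act:
  "\<alpha> \<in> Hom (psh_cat C) F G \<Longrightarrow> psh F \<Longrightarrow> x \<in> Fo F X \<Longrightarrow> f \<in> Hom C Y X \<Longrightarrow> X \<in> Obj C \<Longrightarrow> Y \<in> Obj C \<Longrightarrow>
   \<alpha> Y (Fm F X Y f x) = Fm G X Y f (\<alpha> X x)"
  unfolding nat_iff by blast

lemma nat_eqI:
  assumes "\<alpha> \<in> Hom (psh_cat C) F G" "\<beta> \<in> Hom (psh_cat C) F G"
    and "\<And>X x. X \<in> Obj C \<Longrightarrow> x \<in> Fo F X \<Longrightarrow> \<alpha> X x = \<beta> X x"
  shows "\<alpha> = \<beta>"
proof (rule extensionalityI[of _ "Obj C"])
  show "\<alpha> X = \<beta> X" if "X \<in> Obj C" for X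
    by (rule PiE_ext[where k="Fo F X" and s="\<lambda>_. Fo G X"])
      (use assms that in \<open>auto simp: nat_iff\<close>)
qed (use assms in \<open>simp_all add: nat_iff\<close>)

text \<open>Restricted both to objects and to elements because the arrows of \<open>psh_cat\<close>
  are extensional in both arguments.\<close>

definition mk_nat :: "('o, 'u) psh \<Rightarrow> ('o \<Rightarrow> 'u \<Rightarrow> 'v) \<Rightarrow> 'o \<Rightarrow> 'u \<Rightarrow> 'v" where
  "mk_nat F a = (\<lambda>X\<in>Obj C. \<lambda>x\<in>Fo F X. a X x)"

lemma mk_nat_apply [simp]: "X \<in> Obj C \<Longrightarrow> x \<in> Fo F X \<Longrightarrow> mk_nat F a X x = a X x"
  by (simp add: mk_nat_def)

lemma mk_nat_in:
  assumes "psh F"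
    and "\<And>X x. X \<in> Obj C \<Longrightarrow> x \<in> Fo F X \<Longrightarrow> a X x \<in> Fo G X"
    and "\<And>X Y f x. X \<in> Obj C \<Longrightarrow> Y \<in> Obj C \<Longrightarrow> f \<in> Hom C Y X \<Longrightarrow> x \<in> Fo F X \<Longrightarrow>
           a Y (Fm F X Y f x) = Fm G X Y f (a X x)"
  shows "mk_nat F a \<in> Hom (psh_cat C) F G"
  unfolding nat_iff using assms by (auto simp: mk_nat_def)

lemma Comp_psh_apply [simp]:
  "X \<in> Obj C \<Longrightarrow> x \<in> Fo F X \<Longrightarrow> Comp (psh_cat C) F G H \<beta> \<alpha> X x = \<beta> X (\<alpha> X x)"
  by (simp add: psh_cat_def functor_cat_def set_cat_def op_cat_def compose_def)

lemma Id_psh_apply [simp]: "X \<in> Obj C \<Longrightarrow> x \<in> Fo F X \<Longrightarrow> Id (psh_cat C) F X x = x"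
  by (simp add: psh_cat_def functor_cat_def set_cat_def op_cat_def)

lemma Comp_psh_in [intro]:
  assumes "psh F" "psh G" "\<alpha> \<in> Hom (psh_cat C) F G" "\<beta> \<in> Hom (psh_cat C) G H"
  shows "Comp (psh_cat C) F G H \<beta> \<alpha> \<in> Hom (psh_cat C) F H"
proof -
  have "Comp (psh_cat C) F G H \<beta> \<alpha> = mk_nat F (\<lambda>X x. \<beta> X (\<alpha> X x))"
    by (auto simp: psh_cat_def functor_cat_def set_cat_def op_cat_def compose_def mk_nat_def)
  moreover have "mk_nat F (\<lambda>X x. \<beta> X (\<alpha> X x)) \<in> Hom (psh_cat C) F H"
    by (rule mk_nat_in) (use assms in \<open>auto simp: nat_act[OF assms(3)] nat_act[OF assms(4)] nat_in[OF assms(3)] nat_in[OF assms(4)]\<close>)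
  ultimately show ?thesis by simp
qed

lemma Id_psh_in [intro]:
  assumes "psh F" shows "Id (psh_cat C) F \<in> Hom (psh_cat C) F F"
proof -
  have "Id (psh_cat C) F = mk_nat F (\<lambda>X x. x)"
    by (auto simp: psh_cat_def functor_cat_def set_cat_def op_cat_def mk_nat_def)
  moreover have "mk_nat F (\<lambda>X x. x) \<in> Hom (psh_cat C) F F"
    by (rule mk_nat_in) (use assms in auto)
  ultimately show ?thesis by simp
qed

lemma category_psh: "category (psh_cat C)"
  unfolding category_def
proof (intro conjI ballI)
  fix F G H K \<alpha> \<beta> \<gamma>
  assume *: "psh F" "psh G" "psh H" "psh K"
    "\<alpha> \<in> Hom (psh_cat C) F G" "\<beta> \<in> Hom (psh_cat C) G H" "\<gamma> \<in> Hom (psh_cat C) H K"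
  show "Comp (psh_cat C) F G K (Comp (psh_cat C) G H K \<gamma> \<beta>) \<alpha> =
    Comp (psh_cat C) F H K \<gamma> (Comp (psh_cat C) F G H \<beta> \<alpha>)"
    by (rule nat_eqI[where F=F and G=K]) (use * in \<open>auto simp: nat_in[OF *(5)] nat_in[OF *(6)]\<close>)
next
  fix F G \<alpha> assume *: "psh F" "psh G" "\<alpha> \<in> Hom (psh_cat C) F G"
  show "Comp (psh_cat C) F F G \<alpha> (Id (psh_cat C) F) = \<alpha>"
    "Comp (psh_cat C) F G G (Id (psh_cat C) G) \<alpha> = \<alpha>"
    by (rule nat_eqI[where F=F and G=G]; use * in \<open>auto simp: nat_in[OF *(3)]\<close>)+
qed auto

lemma categ_psh_sub: "S \<subseteq> Obj (psh_cat C) \<Longrightarrow> categ (full_subcat (psh_cat C) S)"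
  using categ_full_subcat category_psh by (simp add: categ_def)

lemma psh_iso_bij:
  assumes "is_iso (full_subcat (psh_cat C) S) F G \<alpha>" "S \<subseteq> Obj (psh_cat C)" "F \<in> S" "G \<in> S" "X \<in> Obj C"
  shows "bij_betw (\<alpha> X) (Fo F X) (Fo G X)"
proof -
  have \<alpha>: "\<alpha> \<in> Hom (psh_cat C) F G"
    using assms(1) unfolding is_iso_def by simp
  obtain \<beta> where \<beta>: "\<beta> \<in> Hom (psh_cat C) G F"
    "Comp (psh_cat C) F G F \<beta> \<alpha> = Id (psh_cat C) F"
    "Comp (psh_cat C) G F G \<alpha> \<beta> = Id (psh_cat C) G"
    using assms(1) unfolding is_iso_def Hom_full_subcat Comp_full_subcat Id_full_subcat by blast
  have 1: "\<beta> X (\<alpha> X x) = x" if "x \<in> Fo F X" for x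
    using \<beta>(2) that assms(5) by (metis Comp_psh_apply Id_psh_apply)
  have 2: "\<alpha> X (\<beta> X x) = x" if "x \<in> Fo G X" for x
    using \<beta>(3) that assms(5) by (metis Comp_psh_apply Id_psh_apply)
  show ?thesis
    by (rule bij_betw_byWitness[where f'="\<beta> X"])
      (use 1 2 nat_in[OF \<alpha>] nat_in[OF \<beta>(1)] assms(5) in blast)+
qed


subsection \<open>Representable presheaves\<close>

lemma Fo_representable [simp]: "Fo (representable C A) X = Hom C X A"
  and Fm_representable [simp]: "g \<in> Hom C X A \<Longrightarrow> Fm (representable C A) X Y f g = Comp C Y X A g f"
  by (simp_all add: representable_def)

lemma psh_representable [simp, intro]: "A \<in> Obj C \<Longrightarrow> psh (representable C A)"
  by (rule pshI) (use locally_small in \<open>auto simp: locally_small_def representable_def\<close>)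

lemma yoneda_map_apply [simp]:
  "X \<in> Obj C \<Longrightarrow> g \<in> Hom C X A \<Longrightarrow> Fm (yoneda C) A B f X g = Comp C X A B f g"
  by (simp add: yoneda_def)

lemma Fo_yoneda [simp]: "Fo (yoneda C) A = representable C A"
  by (simp add: yoneda_def)

lemma yoneda_map_in [intro]:
  assumes "A \<in> Obj C" "B \<in> Obj C" "f \<in> Hom C A B"
  shows "Fm (yoneda C) A B f \<in> Hom (psh_cat C) (representable C A) (representable C B)"
proof -
  have "Fm (yoneda C) A B f = mk_nat (representable C A) (\<lambda>X g. Comp C X A B f g)"
    by (auto simp: yoneda_def mk_nat_def)
  moreover have "mk_nat (representable C A) (\<lambda>X g. Comp C X A B f g)
      \<in> Hom (psh_cat C) (representable C A) (representable C B)"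
    by (rule mk_nat_in) (use assms in auto)
  ultimately show ?thesis by simp
qed

definition yon :: "('o, 'u) psh \<Rightarrow> 'o \<Rightarrow> 'u \<Rightarrow> 'o \<Rightarrow> 'u \<Rightarrow> 'u" where
  "yon F A x = mk_nat (representable C A) (\<lambda>X g. Fm F A X g x)"

lemma yon_apply [simp]: "X \<in> Obj C \<Longrightarrow> g \<in> Hom C X A \<Longrightarrow> yon F A x X g = Fm F A X g x"
  by (simp add: yon_def)

lemma yon_in [simp, intro]:
  "psh F \<Longrightarrow> A \<in> Obj C \<Longrightarrow> x \<in> Fo F A \<Longrightarrow> yon F A x \<in> Hom (psh_cat C) (representable C A) F"
  unfolding yon_def by (rule mk_nat_in) (auto simp: act_Comp)

text \<open>The uniqueness half of the Yoneda lemma: naturality of \<open>\<alpha>\<close> along an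
  arrow into \<open>A\<close>, applied to the identity of \<open>A\<close>, computes
  \<open>\<alpha>\<close> at that arrow.\<close>

lemma yon_unique:
  assumes "\<alpha> \<in> Hom (psh_cat C) (representable C A) F" "psh F" "A \<in> Obj C"
  shows "\<alpha> = yon F A (\<alpha> A (Id C A))"
proof (rule nat_eqI[OF assms(1)])
  show "yon F A (\<alpha> A (Id C A)) \<in> Hom (psh_cat C) (representable C A) F"
    using assms nat_in[OF assms(1)] by auto
  fix X x assume *: "X \<in> Obj C" "x \<in> Fo (representable C A) X"
  show "\<alpha> X x = yon F A (\<alpha> A (Id C A)) X x"
    using nat_act[OF assms(1), of "Id C A" A x X] assms * by simp
qed

end


section \<open>Finite coproducts of representables\<close>

context ls_categ
begin

text \<open>
  \<open>F\<close> is the coproduct of the representables at \<open>A i\<close>, exhibited by universal elements \<open>e i\<close>.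
  The values of \<open>F\<close> need not be small, so that this applies to the functor of compatible
  tuples of a diagram as well.
\<close>

definition ufam :: "('o, 'u, 'v set, 'v \<Rightarrow> 'v) functr \<Rightarrow> 'i set \<Rightarrow> ('i \<Rightarrow> 'o) \<Rightarrow> ('i \<Rightarrow> 'v) \<Rightarrow> bool" where
  "ufam F I A e \<longleftrightarrow>
     (\<forall>i\<in>I. A i \<in> Obj C \<and> e i \<in> Fo F (A i)) \<and>
     (\<forall>X\<in>Obj C. \<forall>x\<in>Fo F X. \<exists>i\<in>I. \<exists>f\<in>Hom C X (A i). Fm F (A i) X f (e i) = x) \<and>
     (\<forall>X\<in>Obj C. \<forall>i\<in>I. \<forall>j\<in>I. \<forall>f\<in>Hom C X (A i). \<forall>g\<in>Hom C X (A j).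
        Fm F (A i) X f (e i) = Fm F (A j) X g (e j) \<longrightarrow> i = j \<and> f = g)"

lemma ufamD:
  assumes "ufam F I A e" "i \<in> I"
  shows "A i \<in> Obj C" "e i \<in> Fo F (A i)"
  using assms by (auto simp: ufam_def)

lemma ufam_cases:
  assumes "ufam F I A e" "X \<in> Obj C" "x \<in> Fo F X"
  obtains i f where "i \<in> I" "f \<in> Hom C X (A i)" "Fm F (A i) X f (e i) = x"
  using assms unfolding ufam_def by metis

lemma ufam_inj:
  assumes "ufam F I A e" "X \<in> Obj C" "Fm F (A i) X f (e i) = Fm F (A j) X g (e j)"
    and "i \<in> I" "j \<in> I" "f \<in> Hom C X (A i)" "g \<in> Hom C X (A j)"
  shows "i = j" "f = g"
  using assms unfolding ufam_def by metis+

text \<open>The summand and the arrow through which \<open>x\<close> arises from a universal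
  element. By \<open>ufam_inj\<close> there is only one such pair, which is why maps defined by
  coordinates are natural.\<close>

definition coords ::
  "('o, 'u, 'v set, 'v \<Rightarrow> 'v) functr \<Rightarrow> 'i set \<Rightarrow> ('i \<Rightarrow> 'o) \<Rightarrow> ('i \<Rightarrow> 'v) \<Rightarrow> 'o \<Rightarrow> 'v \<Rightarrow> 'i \<times> 'u" where
  "coords F I A e X x =
     (SOME p. fst p \<in> I \<and> snd p \<in> Hom C X (A (fst p)) \<and> Fm F (A (fst p)) X (snd p) (e (fst p)) = x)"

lemma coords:
  assumes "ufam F I A e" "X \<in> Obj C" "x \<in> Fo F X"
  shows "fst (coords F I A e X x) \<in> I"
    and "snd (coords F I A e X x) \<in> Hom C X (A (fst (coords F I A e X x)))"
    and "Fm F (A (fst (coords F I A e X x))) X (snd (coords F I A e X x)) (e (fst (coords F I A e X x))) = x"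
proof -
  obtain i f where "i \<in> I" "f \<in> Hom C X (A i)" "Fm F (A i) X f (e i) = x"
    by (rule ufam_cases[OF assms])
  then have "\<exists>p. fst p \<in> I \<and> snd p \<in> Hom C X (A (fst p)) \<and> Fm F (A (fst p)) X (snd p) (e (fst p)) = x"
    by (intro exI[of _ "(i, f)"]) simp
  from someI_ex[OF this]
  show "fst (coords F I A e X x) \<in> I"
    "snd (coords F I A e X x) \<in> Hom C X (A (fst (coords F I A e X x)))"
    "Fm F (A (fst (coords F I A e X x))) X (snd (coords F I A e X x)) (e (fst (coords F I A e X x))) = x"
    by (simp_all add: coords_def)
qed

lemma coords_eq:
  assumes "ufam F I A e" "X \<in> Obj C" "i \<in> I" "f \<in> Hom C X (A i)" "Fm F (A i) X f (e i) \<in> Fo F X"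
  shows "coords F I A e X (Fm F (A i) X f (e i)) = (i, f)"
  using ufam_inj[OF assms(1,2) coords(3)[OF assms(1,2,5)] coords(1)[OF assms(1,2,5)] assms(3)
      coords(2)[OF assms(1,2,5)] assms(4)]
  by (simp add: prod_eq_iff)

lemma ufam_nat_unique:
  assumes F: "psh F" "ufam F I A e"
    and \<alpha>: "\<alpha> \<in> Hom (psh_cat C) F G" and \<beta>: "\<beta> \<in> Hom (psh_cat C) F G"
    and eq: "\<And>i. i \<in> I \<Longrightarrow> \<alpha> (A i) (e i) = \<beta> (A i) (e i)"
  shows "\<alpha> = \<beta>"
proof (rule nat_eqI[OF \<alpha> \<beta>])
  fix X x assume X: "X \<in> Obj C" "x \<in> Fo F X"
  obtain i f where "i \<in> I" "f \<in> Hom C X (A i)" "Fm F (A i) X f (e i) = x"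
    by (rule ufam_cases[OF F(2) X])
  then show "\<alpha> X x = \<beta> X x"
    using nat_act[OF \<alpha> F(1)] nat_act[OF \<beta> F(1)] eq X ufamD[OF F(2)] by metis
qed

text \<open>By the Yoneda lemma a map out of a sum of representables amounts to one element of
  \<open>G\<close> over each \<open>A i\<close>. The last conclusion gives its value on every
  element in coordinates, the form needed to recognise limits and pullbacks.\<close>

lemma ufam_nat_ex:
  assumes F: "psh F" "ufam F I A e" and G: "psh G"
    and g: "\<And>i. i \<in> I \<Longrightarrow> g i \<in> Fo G (A i)"
  obtains \<alpha> where "\<alpha> \<in> Hom (psh_cat C) F G" "\<And>i. i \<in> I \<Longrightarrow> \<alpha> (A i) (e i) = g i"
    "\<And>X i f. X \<in> Obj C \<Longrightarrow> i \<in> I \<Longrightarrow> f \<in> Hom C X (A i) \<Longrightarrow>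
       \<alpha> X (Fm F (A i) X f (e i)) = Fm G (A i) X f (g i)"
proof -
  note D = ufamD[OF F(2)]
  define a where "a X x = (let i = fst (coords F I A e X x) in
    Fm G (A i) X (snd (coords F I A e X x)) (g i))" for X x
  have a: "a X (Fm F (A i) X f (e i)) = Fm G (A i) X f (g i)"
    if "X \<in> Obj C" "i \<in> I" "f \<in> Hom C X (A i)" for X i f
    using coords_eq[OF F(2) that] D[OF that(2)] that F(1) by (simp add: a_def)
  have \<alpha>: "mk_nat F a \<in> Hom (psh_cat C) F G"
  proof (rule mk_nat_in[OF F(1)])
    fix X x assume X: "X \<in> Obj C" "x \<in> Fo F X"
    obtain i f where if': "i \<in> I" "f \<in> Hom C X (A i)" "Fm F (A i) X f (e i) = x"
      by (rule ufam_cases[OF F(2) X])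
    then show "a X x \<in> Fo G X"
      using a[OF X(1) if'(1,2)] X D g G by auto
    fix Y h assume Y: "Y \<in> Obj C" "h \<in> Hom C Y X"
    show "a Y (Fm F X Y h x) = Fm G X Y h (a X x)"
      using a[OF X(1) if'(1,2)] a[OF Y(1) if'(1), of "Comp C Y X (A i) f h"] if' X Y D[OF if'(1)] g[OF if'(1)] F(1) G
      by (simp add: act_Comp[symmetric] Comp_in)
        (use act_Comp[OF F(1) D(2)[OF if'(1)] if'(2) Y(2)] act_Comp[OF G g[OF if'(1)] if'(2) Y(2)]
          in \<open>auto simp: Comp_in\<close>)
  qed
  show ?thesis
  proof (rule that[OF \<alpha>])
    show *: "mk_nat F a X (Fm F (A i) X f (e i)) = Fm G (A i) X f (g i)"
      if "X \<in> Obj C" "i \<in> I" "f \<in> Hom C X (A i)" for X i f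
      using a that D F(1) by simp
    show "mk_nat F a (A i) (e i) = g i" if "i \<in> I" for i
      using *[of "A i" i "Id C (A i)"] that D F(1) G g by simp
  qed
qed

text \<open>The elements of \<open>F\<close> need not belong to \<open>'u\<close>: the case of
  interest is the functor of compatible tuples, from which universal elements pass to an actual
  presheaf \<open>G\<close>.\<close>

lemma ufam_transfer:
  assumes F: "ufam F I A e" and G: "psh G"
    and c: "\<And>X. X \<in> Obj C \<Longrightarrow> bij_betw (c X) (Fo G X) (Fo F X)"
    and nat: "\<And>X Y f x. X \<in> Obj C \<Longrightarrow> Y \<in> Obj C \<Longrightarrow> f \<in> Hom C Y X \<Longrightarrow> x \<in> Fo G X \<Longrightarrow>
       c Y (Fm G X Y f x) = Fm F X Y f (c X x)"
  obtains e' where "ufam G I A e'" "\<And>i. i \<in> I \<Longrightarrow> c (A i) (e' i) = e i"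
proof -
  define e' where "e' i = inv_into (Fo G (A i)) (c (A i)) (e i)" for i
  note D = ufamD[OF F]
  have e': "e' i \<in> Fo G (A i)" "c (A i) (e' i) = e i" if "i \<in> I" for i
    using c[OF D(1)[OF that]] D(2)[OF that]
    by (auto simp: e'_def bij_betw_def inv_into_into f_inv_into_f)
  have ce: "c X (Fm G (A i) X f (e' i)) = Fm F (A i) X f (e i)"
    if "X \<in> Obj C" "i \<in> I" "f \<in> Hom C X (A i)" for X i f
    using nat that e' D by simp
  have "ufam G I A e'"
    unfolding ufam_def
  proof (intro conjI ballI impI)
    fix X x assume X: "X \<in> Obj C" "x \<in> Fo G X"
    have "c X x \<in> Fo F X" using c X by (auto simp: bij_betw_def)
    then obtain i f where if': "i \<in> I" "f \<in> Hom C X (A i)" "Fm F (A i) X f (e i) = c X x"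
      by (rule ufam_cases[OF F X(1)])
    have "Fm G (A i) X f (e' i) = x"
      using ce[OF X(1) if'(1,2)] if' X c[OF X(1)] e' D G
      by (auto simp: bij_betw_def inj_on_def)
    then show "\<exists>i\<in>I. \<exists>f\<in>Hom C X (A i). Fm G (A i) X f (e' i) = x"
      using if' by blast
  next
    fix X i j f g
    assume *: "X \<in> Obj C" "i \<in> I" "j \<in> I" "f \<in> Hom C X (A i)" "g \<in> Hom C X (A j)"
      "Fm G (A i) X f (e' i) = Fm G (A j) X g (e' j)"
    then have "Fm F (A i) X f (e i) = Fm F (A j) X g (e j)"
      using ce by metis
    then show "i = j" "f = g"
      using ufam_inj[OF F *(1)] * by blast+
  qed (use D e' in auto)
  then show ?thesis using that e' by blast
qed

lemma ufam_iso_transfer: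
  assumes "ufam F I A e" "psh F" "psh G" "S \<subseteq> Obj (psh_cat C)" "F \<in> S" "G \<in> S"
    and iso: "is_iso (full_subcat (psh_cat C) S) G F \<alpha>"
  obtains e' where "ufam G I A e'" "\<And>i. i \<in> I \<Longrightarrow> \<alpha> (A i) (e' i) = e i"
proof -
  have \<alpha>: "\<alpha> \<in> Hom (psh_cat C) G F" using iso by (simp add: is_iso_def)
  show ?thesis
    by (rule ufam_transfer[OF assms(1,3), of \<alpha>])
      (use psh_iso_bij[OF iso assms(4,6,5)] nat_act[OF \<alpha> assms(3)] that in auto)
qed

lemma ufam_reindex:
  assumes "bij_betw r J I" "ufam F I A e"
  shows "ufam F J (\<lambda>j. A (r j)) (\<lambda>j. e (r j))"
proof -
  have r: "\<And>j. j \<in> J \<Longrightarrow> r j \<in> I" "\<And>i. i \<in> I \<Longrightarrow> \<exists>j\<in>J. i = r j"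
    "\<And>i j. i \<in> J \<Longrightarrow> j \<in> J \<Longrightarrow> r i = r j \<Longrightarrow> i = j"
    using assms(1) by (auto simp: bij_betw_def inj_on_def)
  show ?thesis
    unfolding ufam_def
  proof (intro conjI ballI impI)
    fix X x assume X: "X \<in> Obj C" "x \<in> Fo F X"
    obtain i f where "i \<in> I" "f \<in> Hom C X (A i)" "Fm F (A i) X f (e i) = x"
      by (rule ufam_cases[OF assms(2) X])
    then show "\<exists>j\<in>J. \<exists>f\<in>Hom C X (A (r j)). Fm F (A (r j)) X f (e (r j)) = x"
      using r(2) by metis
  next
    fix X i j f g
    assume *: "X \<in> Obj C" "i \<in> J" "j \<in> J" "f \<in> Hom C X (A (r i))" "g \<in> Hom C X (A (r j))"
      "Fm F (A (r i)) X f (e (r i)) = Fm F (A (r j)) X g (e (r j))"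
    show "i = j" "f = g"
      using ufam_inj[OF assms(2) *(1,6) r(1)[OF *(2)] r(1)[OF *(3)] *(4,5)] r(3) * by auto
  qed (use ufamD[OF assms(2)] r in auto)
qed

lemma ufam_representable: "B \<in> Obj C \<Longrightarrow> ufam (representable C B) {i} (\<lambda>_. B) (\<lambda>_. Id C B)"
  by (auto simp: ufam_def)

text \<open>The disjoint union of the hom-sets has to lie in \<open>'u\<close>, so an arrow tagged
  by its summand is coded by \<open>pair_code\<close>.\<close>

definition fam_psh :: "nat set \<Rightarrow> (nat \<Rightarrow> 'o) \<Rightarrow> ('o, 'u) psh" where
  "fam_psh I A = \<lparr>Fo = (\<lambda>X. pair_code ` (SIGMA i:I. Hom C X (A i))),
     Fm = (\<lambda>X Y f. \<lambda>u\<in>pair_code ` (SIGMA i:I. Hom C X (A i)).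
       case inv pair_code u of (i, g) \<Rightarrow> pair_code (i, Comp C Y X (A i) g f))\<rparr>"

lemma Fo_fam_psh: "x \<in> Fo (fam_psh I A) X \<longleftrightarrow> (\<exists>i\<in>I. \<exists>g\<in>Hom C X (A i). x = pair_code (i, g))"
  by (auto simp: fam_psh_def)

lemma Fm_fam_psh [simp]:
  "i \<in> I \<Longrightarrow> g \<in> Hom C X (A i) \<Longrightarrow> Fm (fam_psh I A) X Y f (pair_code (i, g)) = pair_code (i, Comp C Y X (A i) g f)"
  by (auto simp: fam_psh_def inv_f_f[OF inj_pair_code])

lemma psh_fam_psh:
  assumes "finite I" and A: "\<And>i. i \<in> I \<Longrightarrow> A i \<in> Obj C"
  shows "psh (fam_psh I A)"
proof (rule pshI)
  fix X assume X: "X \<in> Obj C"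
  have "Fo (fam_psh I A) X = (\<Union>i\<in>I. (\<lambda>g. pair_code (i, g)) ` Hom C X (A i))"
    by (auto simp: fam_psh_def)
  also have "small TYPE('u) \<dots>"
    using locally_small X A by (intro small_UN_finite assms(1) small_image) (auto simp: locally_small_def)
  finally show "small TYPE('u) (Fo (fam_psh I A) X)" .
next
  fix X Y f assume "X \<in> Obj C" "Y \<in> Obj C" "f \<in> Hom C Y X"
  then show "Fm (fam_psh I A) X Y f \<in> Fo (fam_psh I A) X \<rightarrow>\<^sub>E Fo (fam_psh I A) Y"
    using A by (intro PiE_I) (auto simp: Fo_fam_psh, auto simp: fam_psh_def)
qed (use A in \<open>auto simp: Fo_fam_psh\<close>)

lemma ufam_fam_psh:
  assumes A: "\<And>i. i \<in> I \<Longrightarrow> A i \<in> Obj C"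
  shows "ufam (fam_psh I A) I A (\<lambda>i. pair_code (i, Id C (A i)))"
  unfolding ufam_def using A by (auto simp: Fo_fam_psh)

definition fams :: "('o, 'u) psh set" where
  "fams = {F. psh F \<and> (\<exists>(I :: nat set) A e. finite I \<and> ufam F I A e)}"

text \<open>\<open>fams\<close> fixes the type of the index sets to \<open>nat\<close>; an
  enumeration admits finite index sets of any type.\<close>

lemma famsI:
  assumes "psh F" "finite I" "ufam F I A e"
  shows "F \<in> fams"
proof -
  obtain r where "bij_betw r {0..<card I} I"
    using ex_bij_betw_nat_finite[OF assms(2)] by blast
  from ufam_reindex[OF this assms(3)] show ?thesis
    using assms(1) by (auto simp: fams_def)
qed

lemma famsE:
  assumes "F \<in> fams"
  obtains I :: "nat set" and A e where "psh F" "finite I" "ufam F I A e"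
  using assms by (auto simp: fams_def)

lemma representable_fams [simp]: "B \<in> Obj C \<Longrightarrow> representable C B \<in> fams"
  by (rule famsI[OF _ _ ufam_representable[of B "0 :: nat"]]) auto

lemma fams_iso:
  assumes "F \<in> fams" "isomorphic (full_subcat (psh_cat C) S) F G" "S \<subseteq> Obj (psh_cat C)" "F \<in> S" "G \<in> S"
  shows "G \<in> fams"
proof -
  obtain I :: "nat set" and A e where F: "psh F" "finite I" "ufam F I A e"
    using famsE[OF assms(1)] by blast
  obtain \<alpha> where "is_iso (full_subcat (psh_cat C) S) F G \<alpha>"
    using assms(2) by (auto simp: isomorphic_def)
  then obtain \<beta> where "is_iso (full_subcat (psh_cat C) S) G F \<beta>"
    unfolding is_iso_def by blast
  then obtain e' where "ufam G I A e'"
    using ufam_iso_transfer[OF F(3,1) _ assms(3,4,5)] assms(3,5) by blast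
  then show ?thesis using famsI[OF _ F(2)] assms(3,5) by blast
qed

section \<open>Finite sums of representables are small presheaves\<close>

lemma ls_categ_full_subcat: "S \<subseteq> Obj C \<Longrightarrow> ls_categ (full_subcat C S)"
  using categ_full_subcat[OF categ_axioms] locally_small
  by (auto simp: ls_categ_def ls_categ_axioms_def locally_small_def)

text \<open>The universal elements lie over the objects \<open>A i\<close>, so a transformation on
  the full subcategory of these objects already fixes their images, and images of universal elements
  extend uniquely to all of \<open>F\<close>.\<close>

lemma ufam_lan:
  assumes F: "psh F" "ufam F I A e"
  shows "lan_of_restriction C (A ` I) F"
  unfolding lan_of_restriction_def
proof (intro ballI)
  let ?S = "A ` I"
  note D = ufamD[OF F(2)]
  have S: "?S \<subseteq> Obj C" using D by auto
  interpret sub: ls_categ "full_subcat C ?S" by (rule ls_categ_full_subcat[OF S])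
  fix G \<beta> assume G: "psh G" and \<beta>: "\<beta> \<in> Hom (psh_cat (full_subcat C ?S)) F G"
  have Fsub: "sub.psh F"
  proof (rule sub.pshI)
    fix X assume "X \<in> Obj (full_subcat C ?S)"
    then have X: "X \<in> Obj C" using S by auto
    show "small TYPE('u) (Fo F X)" by (rule psh_small[OF F(1) X])
    show "Fm F X X (Id (full_subcat C ?S) X) x = x" if "x \<in> Fo F X" for x
      using act_Id[OF F(1) that X] by simp
    fix Y f assume "Y \<in> Obj (full_subcat C ?S)" and f: "f \<in> Hom (full_subcat C ?S) Y X"
    then have Y: "Y \<in> Obj C" using S by auto
    show "Fm F X Y f \<in> Fo F X \<rightarrow>\<^sub>E Fo F Y"
      using act_PiE[OF F(1) _ X Y] f by simp
    fix Z g x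
    assume "Z \<in> Obj (full_subcat C ?S)" and g: "g \<in> Hom (full_subcat C ?S) Z Y" and x: "x \<in> Fo F X"
    then have Z: "Z \<in> Obj C" using S by auto
    show "Fm F X Z (Comp (full_subcat C ?S) Z Y X f g) x = Fm F Y Z g (Fm F X Y f x)"
      using act_Comp[OF F(1) x _ _ X Y Z, of f g] f g by simp
  qed
  have \<beta>in: "\<beta> (A i) (e i) \<in> Fo G (A i)" if "i \<in> I" for i
    using sub.nat_in[OF \<beta> D(2)[OF that]] that by simp
  obtain \<alpha> where \<alpha>: "\<alpha> \<in> Hom (psh_cat C) F G"
    "\<And>X i f. X \<in> Obj C \<Longrightarrow> i \<in> I \<Longrightarrow> f \<in> Hom C X (A i) \<Longrightarrow>
       \<alpha> X (Fm F (A i) X f (e i)) = Fm G (A i) X f (\<beta> (A i) (e i))"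
    by (rule ufam_nat_ex[OF F G, of "\<lambda>i. \<beta> (A i) (e i)"]) (use \<beta>in in blast)+
  show "\<exists>!\<alpha>. \<alpha> \<in> Hom (psh_cat C) F G \<and> (\<forall>X\<in>?S. \<alpha> X = \<beta> X)"
  proof (rule ex1I[of _ \<alpha>], intro conjI ballI)
    fix X assume X: "X \<in> ?S"
    show "\<alpha> X = \<beta> X"
    proof (rule PiE_ext)
      show "\<alpha> X \<in> Fo F X \<rightarrow>\<^sub>E Fo G X"
        using \<alpha>(1) X S unfolding nat_iff by blast
      show "\<beta> X \<in> Fo F X \<rightarrow>\<^sub>E Fo G X"
        using \<beta> X unfolding sub.nat_iff Obj_full_subcat by blast
      fix x assume x: "x \<in> Fo F X"
      have XO: "X \<in> Obj C" using X S by blast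
      obtain i f where if': "i \<in> I" "f \<in> Hom C X (A i)" "Fm F (A i) X f (e i) = x"
        by (rule ufam_cases[OF F(2) XO x])
      have "\<beta> X (Fm F (A i) X f (e i)) = Fm G (A i) X f (\<beta> (A i) (e i))"
        by (rule sub.nat_act[OF \<beta> Fsub]) (use if' D X in auto)
      then show "\<alpha> X x = \<beta> X x"
        using \<alpha>(2)[OF XO if'(1,2)] if'(3) by simp
    qed
  next
    fix \<alpha>' assume *: "\<alpha>' \<in> Hom (psh_cat C) F G \<and> (\<forall>X\<in>?S. \<alpha>' X = \<beta> X)"
    show "\<alpha>' = \<alpha>"
    proof (rule ufam_nat_unique[OF F _ \<alpha>(1)])
      fix i assume i: "i \<in> I"
      show "\<alpha>' (A i) (e i) = \<alpha> (A i) (e i)"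
        using * i \<alpha>(2)[of "A i" i "Id C (A i)"] D[OF i] F(1) G \<beta>in[OF i] by auto
    qed (use * in auto)
  qed (use \<alpha> in auto)
qed

abbreviation small_pshs :: "('o, 'u) psh set" where
  "small_pshs \<equiv> Obj (small_psh_cat C)"

lemma small_psh_cat_eq: "small_psh_cat C = full_subcat (psh_cat C) small_pshs"
  and small_pshs_psh: "small_pshs \<subseteq> Obj (psh_cat C)"
  by (auto simp: small_psh_cat_def)

lemma fams_small: "fams \<subseteq> small_pshs"
proof
  fix F assume "F \<in> fams"
  then obtain I :: "nat set" and A e where F: "psh F" "finite I" "ufam F I A e"
    by (rule famsE)
  have "A ` I \<subseteq> Obj C" "small TYPE('u) (A ` I)"
    using ufamD[OF F(3)] F(2) by (auto intro: small_finite)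
  then show "F \<in> small_pshs"
    using ufam_lan[OF F(1,3)] F(1) by (auto simp: small_psh_cat_def)
qed

end


section \<open>Finite limits of finite coproducts of representables\<close>

lemma functorD:
  assumes "is_functor J D T"
  shows "j \<in> Obj J \<Longrightarrow> Fo T j \<in> Obj D"
    and "i \<in> Obj J \<Longrightarrow> j \<in> Obj J \<Longrightarrow> k \<in> Hom J i j \<Longrightarrow> Fm T i j k \<in> Hom D (Fo T i) (Fo T j)"
    and "j \<in> Obj J \<Longrightarrow> Fm T j j (Id J j) = Id D (Fo T j)"
    and "i \<in> Obj J \<Longrightarrow> j \<in> Obj J \<Longrightarrow> l \<in> Obj J \<Longrightarrow> k \<in> Hom J i j \<Longrightarrow> m \<in> Hom J j l \<Longrightarrow>
      Fm T i l (Comp J i j l m k) = Comp D (Fo T i) (Fo T j) (Fo T l) (Fm T j l m) (Fm T i j k)"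
  using assms by (simp_all add: is_functor_def)

lemma coneD:
  assumes "is_cone J D T L \<pi>"
  shows "L \<in> Obj D" and "j \<in> Obj J \<Longrightarrow> \<pi> j \<in> Hom D L (Fo T j)"
    and "i \<in> Obj J \<Longrightarrow> j \<in> Obj J \<Longrightarrow> k \<in> Hom J i j \<Longrightarrow> Comp D L (Fo T i) (Fo T j) (Fm T i j k) (\<pi> i) = \<pi> j"
  using assms by (simp_all add: is_cone_def)

lemma limit_cone: "is_limit J D T L \<pi> \<Longrightarrow> is_cone J D T L \<pi>"
  by (simp add: is_limit_def)

lemma limit_Ex1:
  "is_limit J D T L \<pi> \<Longrightarrow> is_cone J D T M \<mu> \<Longrightarrow>
   \<exists>!h. h \<in> Hom D M L \<and> (\<forall>j\<in>Obj J. Comp D M L (Fo T j) (\<pi> j) h = \<mu> j)"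
  by (simp add: is_limit_def)

lemma limit_factor:
  assumes "is_limit J D T L \<pi>" "is_cone J D T M \<mu>"
  obtains h where "h \<in> Hom D M L" "\<And>j. j \<in> Obj J \<Longrightarrow> Comp D M L (Fo T j) (\<pi> j) h = \<mu> j"
  using limit_Ex1[OF assms] by blast

lemma (in categ) limit_hom_eq:
  assumes T: "is_functor J C T" and L: "is_limit J C T L \<pi>" and M: "M \<in> Obj C"
    and h: "h \<in> Hom C M L" "h' \<in> Hom C M L"
    and eq: "\<And>j. j \<in> Obj J \<Longrightarrow> Comp C M L (Fo T j) (\<pi> j) h = Comp C M L (Fo T j) (\<pi> j) h'"
  shows "h = h'"
proof -
  note c = coneD[OF limit_cone[OF L]]
  have "is_cone J C T M (\<lambda>j. Comp C M L (Fo T j) (\<pi> j) h)"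
    unfolding is_cone_def
  proof (intro conjI ballI)
    fix i j k assume *: "i \<in> Obj J" "j \<in> Obj J" "k \<in> Hom J i j"
    show "Comp C M (Fo T i) (Fo T j) (Fm T i j k) (Comp C M L (Fo T i) (\<pi> i) h) = Comp C M L (Fo T j) (\<pi> j) h"
      using Comp_assoc[OF h(1) c(2)[OF *(1)] functorD(2)[OF T *] M c(1) functorD(1)[OF T *(1)] functorD(1)[OF T *(2)]]
        c(3)[OF *] by simp
  qed (use M h c functorD[OF T] in auto)
  from limit_Ex1[OF L this] show ?thesis
    by (rule Ex1_unique) (use h eq in auto)
qed

context ls_categ
begin

text \<open>The limit of \<open>T\<close> computed pointwise. Its elements are functions on
  \<open>Obj J\<close> and not elements of \<open>'u\<close>, so it is no object of
  \<open>psh_cat\<close> but serves as a yardstick for limits there.\<close>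

definition tup :: "('j, 'k) cat \<Rightarrow> ('j, 'k, ('o, 'u) psh, 'o \<Rightarrow> 'u \<Rightarrow> 'u) functr \<Rightarrow>
    ('o, 'u, ('j \<Rightarrow> 'u) set, ('j \<Rightarrow> 'u) \<Rightarrow> 'j \<Rightarrow> 'u) functr" where
  "tup J T = \<lparr>Fo = (\<lambda>X. {t \<in> (\<Pi>\<^sub>E j\<in>Obj J. Fo (Fo T j) X).
                  \<forall>i\<in>Obj J. \<forall>j\<in>Obj J. \<forall>k\<in>Hom J i j. Fm T i j k X (t i) = t j}),
              Fm = (\<lambda>X Y f t. \<lambda>j\<in>Obj J. Fm (Fo T j) X Y f (t j))\<rparr>"

lemma tupD:
  assumes "t \<in> Fo (tup J T) X"
  shows "t \<in> extensional (Obj J)" and "j \<in> Obj J \<Longrightarrow> t j \<in> Fo (Fo T j) X"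
    and "i \<in> Obj J \<Longrightarrow> j \<in> Obj J \<Longrightarrow> k \<in> Hom J i j \<Longrightarrow> Fm T i j k X (t i) = t j"
  using assms unfolding tup_def by (simp_all add: PiE_iff)

lemma tupI:
  assumes "t \<in> extensional (Obj J)" and "\<And>j. j \<in> Obj J \<Longrightarrow> t j \<in> Fo (Fo T j) X"
    and "\<And>i j k. i \<in> Obj J \<Longrightarrow> j \<in> Obj J \<Longrightarrow> k \<in> Hom J i j \<Longrightarrow> Fm T i j k X (t i) = t j"
  shows "t \<in> Fo (tup J T) X"
  using assms unfolding tup_def by (simp add: PiE_iff)

lemma Fm_tup [simp]: "j \<in> Obj J \<Longrightarrow> Fm (tup J T) X Y f t j = Fm (Fo T j) X Y f (t j)"
  by (simp add: tup_def)

lemma Fm_tup_extensional: "Fm (tup J T) X Y f t \<in> extensional (Obj J)"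
  by (simp add: tup_def)

lemma cone_comp:
  assumes "S \<subseteq> Obj (psh_cat C)" and T: "is_functor J (full_subcat (psh_cat C) S) T"
    and L: "is_cone J (full_subcat (psh_cat C) S) T L \<pi>"
    and "X \<in> Obj C" "x \<in> Fo L X" "i \<in> Obj J" "j \<in> Obj J" "k \<in> Hom J i j"
  shows "Fm T i j k X (\<pi> i X x) = \<pi> j X x"
proof -
  have "Comp (psh_cat C) L (Fo T i) (Fo T j) (Fm T i j k) (\<pi> i) = \<pi> j"
    using coneD(3)[OF L assms(6-8)] by simp
  then show ?thesis using assms(4,5) by (metis Comp_psh_apply)
qed

text \<open>By the Yoneda lemma, limits of presheaves are pointwise as soon as the representables are present.\<close>

lemma limit_pointwise:
  assumes S: "S \<subseteq> Obj (psh_cat C)" and rep: "\<And>A. A \<in> Obj C \<Longrightarrow> representable C A \<in> S"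
    and T: "is_functor J (full_subcat (psh_cat C) S) T"
    and L: "is_limit J (full_subcat (psh_cat C) S) T L \<pi>"
    and X: "X \<in> Obj C"
  shows "bij_betw (\<lambda>x. \<lambda>j\<in>Obj J. \<pi> j X x) (Fo L X) (Fo (tup J T) X)"
proof -
  let ?D = "full_subcat (psh_cat C) S"
  interpret D: categ ?D by (rule categ_psh_sub[OF S])
  note c = coneD[OF limit_cone[OF L], simplified]
  have LS: "psh L" using c(1) S by auto
  have TS: "psh (Fo T j)" if "j \<in> Obj J" for j using functorD(1)[OF T that] S by auto
  have Tm: "Fm T i j k \<in> Hom (psh_cat C) (Fo T i) (Fo T j)" if "i \<in> Obj J" "j \<in> Obj J" "k \<in> Hom J i j" for i j k
    using functorD(2)[OF T that] by simp
  show ?thesis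
    unfolding bij_betw_def inj_on_def
  proof (intro conjI ballI impI)
    fix x y assume x: "x \<in> Fo L X" and y: "y \<in> Fo L X"
      and eq: "(\<lambda>j\<in>Obj J. \<pi> j X x) = (\<lambda>j\<in>Obj J. \<pi> j X y)"
    have eqj: "\<pi> j X x = \<pi> j X y" if "j \<in> Obj J" for j
      using fun_cong[OF eq, of j] that by simp
    \<comment> \<open>Elements of \<open>L\<close> over \<open>X\<close> are maps out of the
      representable at \<open>X\<close>, so uniqueness of factorizations applies to them.\<close>
    have "yon L X x = yon L X y"
    proof (rule D.limit_hom_eq[OF T L, of "representable C X"])
      show "yon L X x \<in> Hom ?D (representable C X) L" "yon L X y \<in> Hom ?D (representable C X) L"
        using LS X x y by auto
      fix j assume j: "j \<in> Obj J"
      show "Comp ?D (representable C X) L (Fo T j) (\<pi> j) (yon L X x) = Comp ?D (representable C X) L (Fo T j) (\<pi> j) (yon L X y)"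
        unfolding Comp_full_subcat
      proof (rule nat_eqI)
        show "Comp (psh_cat C) (representable C X) L (Fo T j) (\<pi> j) (yon L X x) \<in> Hom (psh_cat C) (representable C X) (Fo T j)"
          "Comp (psh_cat C) (representable C X) L (Fo T j) (\<pi> j) (yon L X y) \<in> Hom (psh_cat C) (representable C X) (Fo T j)"
          using LS X x y c(2)[OF j] by auto
        fix Y g assume "Y \<in> Obj C" "g \<in> Fo (representable C X) Y"
        then show "Comp (psh_cat C) (representable C X) L (Fo T j) (\<pi> j) (yon L X x) Y g =
            Comp (psh_cat C) (representable C X) L (Fo T j) (\<pi> j) (yon L X y) Y g"
          using nat_act[OF c(2)[OF j] LS] X x y eqj[OF j] by simp
      qed
    qed (use rep X in auto)
    then have "yon L X x X (Id C X) = yon L X y X (Id C X)" by simp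
    then show "x = y" using LS X x y by simp
  next
    show "(\<lambda>x. \<lambda>j\<in>Obj J. \<pi> j X x) ` Fo L X = Fo (tup J T) X"
    proof (intro equalityI subsetI)
      fix t assume "t \<in> (\<lambda>x. \<lambda>j\<in>Obj J. \<pi> j X x) ` Fo L X"
      then obtain x where x: "x \<in> Fo L X" "t = (\<lambda>j\<in>Obj J. \<pi> j X x)" by blast
      show "t \<in> Fo (tup J T) X"
        by (rule tupI) (use x X nat_in[OF c(2)] cone_comp[OF S T limit_cone[OF L] X] in auto)
    next
      fix t assume t: "t \<in> Fo (tup J T) X"
      note tD = tupD[OF t]
      \<comment> \<open>A compatible tuple over \<open>X\<close> is a cone with apex the
        representable at \<open>X\<close>; its factorization, evaluated at the identity, is the
        wanted element.\<close>
      have "is_cone J ?D T (representable C X) (\<lambda>j. yon (Fo T j) X (t j))"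
        unfolding is_cone_def Obj_full_subcat Hom_full_subcat Comp_full_subcat
      proof (intro conjI ballI)
        fix i j k assume *: "i \<in> Obj J" "j \<in> Obj J" "k \<in> Hom J i j"
        show "Comp (psh_cat C) (representable C X) (Fo T i) (Fo T j) (Fm T i j k) (yon (Fo T i) X (t i)) = yon (Fo T j) X (t j)"
        proof (rule nat_eqI)
          show "Comp (psh_cat C) (representable C X) (Fo T i) (Fo T j) (Fm T i j k) (yon (Fo T i) X (t i)) \<in> Hom (psh_cat C) (representable C X) (Fo T j)"
            using TS X * tD Tm by auto
          show "yon (Fo T j) X (t j) \<in> Hom (psh_cat C) (representable C X) (Fo T j)"
            using TS X * tD by auto
          fix Y g assume "Y \<in> Obj C" "g \<in> Fo (representable C X) Y"
          then show "Comp (psh_cat C) (representable C X) (Fo T i) (Fo T j) (Fm T i j k) (yon (Fo T i) X (t i)) Y g = yon (Fo T j) X (t j) Y g"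
            using nat_act[OF Tm[OF *] TS[OF *(1)] tD(2)[OF *(1)]] X tD(3)[OF *] by simp
        qed
      qed (use rep X TS tD in auto)
      from limit_factor[OF L this] obtain h where h: "h \<in> Hom (psh_cat C) (representable C X) L"
        "\<And>j. j \<in> Obj J \<Longrightarrow> Comp (psh_cat C) (representable C X) L (Fo T j) (\<pi> j) h = yon (Fo T j) X (t j)"
        by auto
      have idX: "Id C X \<in> Fo (representable C X) X" using X by simp
      have "\<pi> j X (h X (Id C X)) = t j" if j: "j \<in> Obj J" for j
      proof -
        have "\<pi> j X (h X (Id C X)) = yon (Fo T j) X (t j) X (Id C X)"
          using h(2)[OF j] Comp_psh_apply[OF X idX] by metis
        also have "\<dots> = t j" using X TS[OF j] tD(2)[OF j] by simp
        finally show ?thesis .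
      qed
      then have "t = (\<lambda>j\<in>Obj J. \<pi> j X (h X (Id C X)))"
        using tD(1) by (intro extensionalityI[of _ "Obj J"]) auto
      moreover have "h X (Id C X) \<in> Fo L X" by (rule nat_in[OF h(1) idX X])
      ultimately show "t \<in> (\<lambda>x. \<lambda>j\<in>Obj J. \<pi> j X x) ` Fo L X" by blast
    qed
  qed
qed

text \<open>Mediating maps are chosen elementwise; injectivity of the comparison with tuples makes
  the choice unique and therefore natural.\<close>

lemma pointwise_limit:
  assumes S: "S \<subseteq> Obj (psh_cat C)"
    and T: "is_functor J (full_subcat (psh_cat C) S) T"
    and L: "is_cone J (full_subcat (psh_cat C) S) T L \<pi>"
    and bij: "\<And>X. X \<in> Obj C \<Longrightarrow> bij_betw (\<lambda>x. \<lambda>j\<in>Obj J. \<pi> j X x) (Fo L X) (Fo (tup J T) X)"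
  shows "is_limit J (full_subcat (psh_cat C) S) T L \<pi>"
  unfolding is_limit_def
proof (intro conjI allI impI)
  let ?D = "full_subcat (psh_cat C) S"
  note c = coneD[OF L, simplified]
  have LS: "psh L" using c(1) S by auto
  have TS: "psh (Fo T j)" if "j \<in> Obj J" for j using functorD(1)[OF T that] S by auto
  fix M \<mu> assume M: "is_cone J ?D T M \<mu>"
  note m = coneD[OF M, simplified]
  have MS: "psh M" using m(1) S by auto
  have inj: "x = y" if "X \<in> Obj C" "x \<in> Fo L X" "y \<in> Fo L X" "\<And>j. j \<in> Obj J \<Longrightarrow> \<pi> j X x = \<pi> j X y" for X x y
    by (rule inj_onD[OF bij_betw_imp_inj_on[OF bij[OF that(1)]] _ that(2,3)]) (use that(4) in \<open>auto intro: restrict_ext\<close>)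
  have ex: "\<exists>x\<in>Fo L X. \<forall>j\<in>Obj J. \<pi> j X x = \<mu> j X y" if X: "X \<in> Obj C" and y: "y \<in> Fo M X" for X y
  proof -
    have "(\<lambda>j\<in>Obj J. \<mu> j X y) \<in> Fo (tup J T) X"
      by (rule tupI) (use y X nat_in[OF m(2)] cone_comp[OF S T M X] in auto)
    then obtain x where x: "x \<in> Fo L X" "(\<lambda>j\<in>Obj J. \<mu> j X y) = (\<lambda>j\<in>Obj J. \<pi> j X x)"
      using bij[OF X] unfolding bij_betw_def by blast
    have "\<pi> j X x = \<mu> j X y" if "j \<in> Obj J" for j
      using fun_cong[OF x(2), of j] that by simp
    then show ?thesis using x(1) by blast
  qed
  define a where "a X y = (SOME x. x \<in> Fo L X \<and> (\<forall>j\<in>Obj J. \<pi> j X x = \<mu> j X y))" for X y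
  have a: "a X y \<in> Fo L X" "\<And>j. j \<in> Obj J \<Longrightarrow> \<pi> j X (a X y) = \<mu> j X y" if "X \<in> Obj C" "y \<in> Fo M X" for X y
    using someI_ex[of "\<lambda>x. x \<in> Fo L X \<and> (\<forall>j\<in>Obj J. \<pi> j X x = \<mu> j X y)"] ex[OF that]
    unfolding a_def by blast+
  let ?h = "mk_nat M a"
  have h: "?h \<in> Hom (psh_cat C) M L"
  proof (rule mk_nat_in[OF MS a(1)])
    fix X Y f x assume *: "X \<in> Obj C" "Y \<in> Obj C" "f \<in> Hom C Y X" "x \<in> Fo M X"
    have y: "Fm M X Y f x \<in> Fo M Y" using MS * by simp
    show "a Y (Fm M X Y f x) = Fm L X Y f (a X x)"
    proof (rule inj[OF *(2)])
      fix j assume j: "j \<in> Obj J"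
      show "\<pi> j Y (a Y (Fm M X Y f x)) = \<pi> j Y (Fm L X Y f (a X x))"
        using a(2)[OF *(2) y j] a(2)[OF *(1,4) j] nat_act[OF m(2)[OF j] MS *(4,3,1,2)]
          nat_act[OF c(2)[OF j] LS a(1)[OF *(1,4)] *(3,1,2)] by simp
    qed (use a * y LS in auto)
  qed
  show "\<exists>!h. h \<in> Hom ?D M L \<and> (\<forall>j\<in>Obj J. Comp ?D M L (Fo T j) (\<pi> j) h = \<mu> j)"
    unfolding Hom_full_subcat Comp_full_subcat
  proof (rule ex1I[of _ ?h], intro conjI ballI)
    fix j assume j: "j \<in> Obj J"
    show "Comp (psh_cat C) M L (Fo T j) (\<pi> j) ?h = \<mu> j"
      by (rule nat_eqI[OF Comp_psh_in[OF MS LS h c(2)[OF j]] m(2)[OF j]]) (use a j in simp)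
  next
    fix h' assume h': "h' \<in> Hom (psh_cat C) M L \<and> (\<forall>j\<in>Obj J. Comp (psh_cat C) M L (Fo T j) (\<pi> j) h' = \<mu> j)"
    then have h'in: "h' \<in> Hom (psh_cat C) M L" by simp
    show "h' = ?h"
    proof (rule nat_eqI[OF h'in h])
      fix X y assume X: "X \<in> Obj C" "y \<in> Fo M X"
      show "h' X y = ?h X y"
      proof (rule inj[OF X(1)])
        fix j assume j: "j \<in> Obj J"
        have "Comp (psh_cat C) M L (Fo T j) (\<pi> j) h' = \<mu> j"
          using h' j by blast
        then have "\<pi> j X (h' X y) = \<mu> j X y"
          using Comp_psh_apply[OF X, of L "Fo T j" "\<pi> j" h'] by (simp only:)
        then show "\<pi> j X (h' X y) = \<pi> j X (?h X y)" using a(2)[OF X j] X by simp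
      qed (rule nat_in[OF h'in X(2,1)] nat_in[OF h X(2,1)])+
    qed
  qed (rule h)
qed (rule L)

end


section \<open>Limits of diagrams of finite sums of representables\<close>

context ls_categ
begin

text \<open>
  A diagram of finite coproducts \<open>\<Sum>i. A j i\<close> of representables induces maps on the index sets.
  Its limit is the coproduct, over all compatible selections \<open>s\<close> of indices, of the
  representables at the limits of \<open>j \<mapsto> A j (s j)\<close>.
\<close>

lemma tup_ufam:
  fixes J :: "(nat, nat) cat"
  assumes S: "S \<subseteq> Obj (psh_cat C)"
    and fc: "finitely_complete C"
    and J: "finite_category J"
    and T: "is_functor J (full_subcat (psh_cat C) S) T"
    and fam: "\<And>j. j \<in> Obj J \<Longrightarrow> Fo T j \<in> fams"
  obtains K :: "(nat \<Rightarrow> nat) set" and P E where "finite K" "ufam (tup J T) K P E"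
proof -
  interpret J: categ J using J by (simp add: finite_category_def categ_def)
  have TS: "psh (Fo T j)" if "j \<in> Obj J" for j using functorD(1)[OF T that] S by auto
  have Tm: "Fm T i j k \<in> Hom (psh_cat C) (Fo T i) (Fo T j)" if "i \<in> Obj J" "j \<in> Obj J" "k \<in> Hom J i j" for i j k
    using functorD(2)[OF T that] by simp
  have "\<forall>j\<in>Obj J. \<exists>I A e. finite (I :: nat set) \<and> ufam (Fo T j) I A e"
    using fam by (auto simp: fams_def)
  then obtain I :: "nat \<Rightarrow> nat set" and A e where
    fin: "\<And>j. j \<in> Obj J \<Longrightarrow> finite (I j)" and u: "\<And>j. j \<in> Obj J \<Longrightarrow> ufam (Fo T j) (I j) (A j) (e j)"
    unfolding bchoice_iff by auto
  note D = ufamD[OF u]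
  \<comment> \<open>The transition map of \<open>k\<close> sends the universal element of summand
    \<open>a\<close> into the summand \<open>nx i j k a\<close> of the target, along the arrow
    \<open>hm i j k a\<close> of \<open>C\<close>.\<close>
  define co where "co i j k a = coords (Fo T j) (I j) (A j) (e j) (A i a) (Fm T i j k (A i a) (e i a))" for i j k a
  define nx where "nx i j k a = fst (co i j k a)" for i j k a
  define hm where "hm i j k a = snd (co i j k a)" for i j k a
  have nx: "nx i j k a \<in> I j" "hm i j k a \<in> Hom C (A i a) (A j (nx i j k a))"
    "Fm (Fo T j) (A j (nx i j k a)) (A i a) (hm i j k a) (e j (nx i j k a)) = Fm T i j k (A i a) (e i a)"
    if "i \<in> Obj J" "j \<in> Obj J" "k \<in> Hom J i j" "a \<in> I i" for i j k a
    using coords[OF u[OF that(2)] D(1)[OF that(1,4)] nat_in[OF Tm[OF that(1-3)] D(2)[OF that(1,4)] D(1)[OF that(1,4)]]]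
    by (simp_all add: nx_def hm_def co_def)
  have step: "Fm T i j k X (Fm (Fo T i) (A i a) X f (e i a)) =
      Fm (Fo T j) (A j (nx i j k a)) X (Comp C X (A i a) (A j (nx i j k a)) (hm i j k a) f) (e j (nx i j k a))"
    if *: "i \<in> Obj J" "j \<in> Obj J" "k \<in> Hom J i j" "a \<in> I i" "X \<in> Obj C" "f \<in> Hom C X (A i a)" for i j k a X f
    using nat_act[OF Tm[OF *(1-3)] TS[OF *(1)] D(2)[OF *(1,4)] *(6) D(1)[OF *(1,4)] *(5)]
      act_Comp[OF TS[OF *(2)] D(2)[OF *(2) nx(1)[OF *(1-4)]] nx(2)[OF *(1-4)] *(6) D(1)[OF *(2) nx(1)[OF *(1-4)]] D(1)[OF *(1,4)] *(5)]
      nx(3)[OF *(1-4)] by simp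
  have nxId: "nx j j (Id J j) a = a" "hm j j (Id J j) a = Id C (A j a)" if *: "j \<in> Obj J" "a \<in> I j" for j a
  proof -
    have "Fm T j j (Id J j) (A j a) (e j a) = e j a"
      using functorD(3)[OF T *(1)] D[OF *] by simp
    then have "Fm (Fo T j) (A j (nx j j (Id J j) a)) (A j a) (hm j j (Id J j) a) (e j (nx j j (Id J j) a)) =
        Fm (Fo T j) (A j a) (A j a) (Id C (A j a)) (e j a)"
      using nx(3)[OF *(1,1) J.Id_in *(2)] D[OF *] TS *(1) by simp
    from ufam_inj[OF u[OF *(1)] D(1)[OF *] this nx(1)[OF *(1,1) J.Id_in *(2)] *(2) nx(2)[OF *(1,1) J.Id_in *(2)]]
    show "nx j j (Id J j) a = a" "hm j j (Id J j) a = Id C (A j a)" using D[OF *] *(1) by auto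
  qed
  have nxComp: "nx i l (Comp J i j l m k) a = nx j l m (nx i j k a)"
    "hm i l (Comp J i j l m k) a = Comp C (A i a) (A j (nx i j k a)) (A l (nx j l m (nx i j k a))) (hm j l m (nx i j k a)) (hm i j k a)"
    if *: "i \<in> Obj J" "j \<in> Obj J" "l \<in> Obj J" "k \<in> Hom J i j" "m \<in> Hom J j l" "a \<in> I i" for i j l k m a
  proof -
    let ?a' = "nx i j k a" let ?a'' = "nx j l m ?a'"
    note n1 = nx[OF *(1,2,4,6)] note n2 = nx[OF *(2,3,5) n1(1)]
    note Aa = D[OF *(1,6)] note Aa' = D[OF *(2) n1(1)] note Aa'' = D[OF *(3) n2(1)]
    have mk: "Comp J i j l m k \<in> Hom J i l" using * by simp
    have "Fm T i l (Comp J i j l m k) (A i a) (e i a) = Fm T j l m (A i a) (Fm T i j k (A i a) (e i a))"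
      using functorD(4)[OF T *(1-5)] Aa by simp
    also have "\<dots> = Fm (Fo T l) (A l ?a'') (A i a) (Comp C (A i a) (A j ?a') (A l ?a'') (hm j l m ?a') (hm i j k a)) (e l ?a'')"
      using step[OF *(2,3,5) n1(1) Aa(1) n1(2)] n1(3) by simp
    finally have "Fm (Fo T l) (A l (nx i l (Comp J i j l m k) a)) (A i a) (hm i l (Comp J i j l m k) a) (e l (nx i l (Comp J i j l m k) a)) =
      Fm (Fo T l) (A l ?a'') (A i a) (Comp C (A i a) (A j ?a') (A l ?a'') (hm j l m ?a') (hm i j k a)) (e l ?a'')"
      using nx(3)[OF *(1,3) mk *(6)] by simp
    from ufam_inj[OF u[OF *(3)] Aa(1) this nx(1)[OF *(1,3) mk *(6)] n2(1) nx(2)[OF *(1,3) mk *(6)]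
        Comp_in[OF n1(2) n2(2) Aa(1) Aa'(1) Aa''(1)]]
    show "nx i l (Comp J i j l m k) a = ?a''"
      "hm i l (Comp J i j l m k) a = Comp C (A i a) (A j ?a') (A l ?a'') (hm j l m ?a') (hm i j k a)" .
  qed
  \<comment> \<open>Selections of one summand for each \<open>j\<close> that are respected by the
    index maps; finiteness of the diagram and of the sums leaves finitely many.\<close>
  define K where "K = {s \<in> (\<Pi>\<^sub>E j\<in>Obj J. I j). \<forall>i\<in>Obj J. \<forall>j\<in>Obj J. \<forall>k\<in>Hom J i j. nx i j k (s i) = s j}"
  have KD: "s j \<in> I j" if "s \<in> K" "j \<in> Obj J" for s j
    using that by (auto simp: K_def)
  have Knx: "nx i j k (s i) = s j" if "s \<in> K" "i \<in> Obj J" "j \<in> Obj J" "k \<in> Hom J i j" for s i j k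
    using that by (auto simp: K_def)
  have finK: "finite K"
  proof (rule finite_subset)
    show "K \<subseteq> (\<Pi>\<^sub>E j\<in>Obj J. I j)" by (auto simp: K_def)
    show "finite (\<Pi>\<^sub>E j\<in>Obj J. I j)"
      using J fin by (intro finite_PiE) (auto simp: finite_category_def)
  qed
  \<comment> \<open>Along a fixed selection the arrows \<open>hm\<close> form a diagram in
    \<open>C\<close> itself, whose limit exists because \<open>C\<close> is finitely
    complete.\<close>
  define Ts where "Ts s = \<lparr>Fo = (\<lambda>j. A j (s j)), Fm = (\<lambda>i j k. hm i j k (s i))\<rparr>" for s :: "nat \<Rightarrow> nat"
  have Ts: "is_functor J C (Ts s)" if s: "s \<in> K" for s
    unfolding is_functor_def Ts_def
    using KD[OF s] Knx[OF s] D nx nxId nxComp by (auto simp: J.Comp_in) (metis nx(2))+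
  have "\<forall>s\<in>K. \<exists>P \<pi>. is_limit J C (Ts s) P \<pi>"
    using fc J Ts unfolding finitely_complete_def by blast
  then obtain P \<pi> where lim: "\<And>s. s \<in> K \<Longrightarrow> is_limit J C (Ts s) (P s) (\<pi> s)"
    unfolding bchoice_iff by auto
  have P: "P s \<in> Obj C" if "s \<in> K" for s
    using coneD(1)[OF limit_cone[OF lim[OF that]]] .
  have \<pi>: "\<pi> s j \<in> Hom C (P s) (A j (s j))" if "s \<in> K" "j \<in> Obj J" for s j
    using coneD(2)[OF limit_cone[OF lim[OF that(1)]] that(2)] by (simp add: Ts_def)
  have \<pi>c: "Comp C (P s) (A i (s i)) (A j (s j)) (hm i j k (s i)) (\<pi> s i) = \<pi> s j"
    if "s \<in> K" "i \<in> Obj J" "j \<in> Obj J" "k \<in> Hom J i j" for s i j k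
    using coneD(3)[OF limit_cone[OF lim[OF that(1)]] that(2-4)] by (simp add: Ts_def)
  define E where "E s = (\<lambda>j\<in>Obj J. Fm (Fo T j) (A j (s j)) (P s) (\<pi> s j) (e j (s j)))" for s
  have Eact: "Fm (tup J T) (P s) X h (E s) j = Fm (Fo T j) (A j (s j)) X (Comp C X (P s) (A j (s j)) (\<pi> s j) h) (e j (s j))"
    if "s \<in> K" "X \<in> Obj C" "h \<in> Hom C X (P s)" "j \<in> Obj J" for s X h j
    using act_Comp[OF TS[OF that(4)] D(2)[OF that(4) KD[OF that(1,4)]] \<pi>[OF that(1,4)] that(3)
        D(1)[OF that(4) KD[OF that(1,4)]] P[OF that(1)] that(2)] that(4)
    by (simp add: E_def)
  have "ufam (tup J T) K P E"
    unfolding ufam_def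
  proof (intro conjI ballI impI)
    fix s assume s: "s \<in> K"
    show "P s \<in> Obj C" by (rule P[OF s])
    show "E s \<in> Fo (tup J T) (P s)"
    proof (rule tupI)
      show "E s \<in> extensional (Obj J)" by (simp add: E_def)
      show "E s j \<in> Fo (Fo T j) (P s)" if "j \<in> Obj J" for j
        using TS D KD[OF s] \<pi>[OF s] P[OF s] that by (simp add: E_def)
      show "Fm T i j k (P s) (E s i) = E s j" if *: "i \<in> Obj J" "j \<in> Obj J" "k \<in> Hom J i j" for i j k
        using step[OF * KD[OF s *(1)] P[OF s] \<pi>[OF s *(1)]] * Knx[OF s *] \<pi>c[OF s *] by (simp add: E_def)
    qed
  next
    fix X t assume X: "X \<in> Obj C" and t: "t \<in> Fo (tup J T) X"
    note tD = tupD[OF t]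
    \<comment> \<open>Each component of the tuple lies in one summand. Compatibility together with
      uniqueness of coordinates turns these summands into a selection and the arrows into a cone
      over its diagram.\<close>
    define s where "s = (\<lambda>j\<in>Obj J. fst (coords (Fo T j) (I j) (A j) (e j) X (t j)))"
    define f where "f j = snd (coords (Fo T j) (I j) (A j) (e j) X (t j))" for j
    have sf: "s j \<in> I j" "f j \<in> Hom C X (A j (s j))" "Fm (Fo T j) (A j (s j)) X (f j) (e j (s j)) = t j"
      if "j \<in> Obj J" for j
      using coords[OF u[OF that] X tD(2)[OF that]] that by (simp_all add: s_def f_def)
    have c: "nx i j k (s i) = s j" "Comp C X (A i (s i)) (A j (nx i j k (s i))) (hm i j k (s i)) (f i) = f j"
      if *: "i \<in> Obj J" "j \<in> Obj J" "k \<in> Hom J i j" for i j k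
    proof -
      note n = nx[OF * sf(1)[OF *(1)]]
      have "Fm (Fo T j) (A j (nx i j k (s i))) X (Comp C X (A i (s i)) (A j (nx i j k (s i))) (hm i j k (s i)) (f i)) (e j (nx i j k (s i)))
          = Fm (Fo T j) (A j (s j)) X (f j) (e j (s j))"
        using step[OF * sf(1)[OF *(1)] X sf(2)[OF *(1)]] sf(3)[OF *(1)] sf(3)[OF *(2)] tD(3)[OF *] by simp
      from ufam_inj[OF u[OF *(2)] X this n(1) sf(1)[OF *(2)] _ sf(2)[OF *(2)]]
      show "nx i j k (s i) = s j" "Comp C X (A i (s i)) (A j (nx i j k (s i))) (hm i j k (s i)) (f i) = f j"
        using Comp_in[OF sf(2)[OF *(1)] n(2) X] D * sf(1) n(1) by blast+
    qed
    have s: "s \<in> K" unfolding K_def using sf(1) c(1) by (auto simp: s_def)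
    have "is_cone J C (Ts s) X f"
      unfolding is_cone_def Ts_def using X sf(2) c by auto
    from limit_factor[OF lim[OF s] this] obtain h where h: "h \<in> Hom C X (P s)"
      "\<And>j. j \<in> Obj J \<Longrightarrow> Comp C X (P s) (A j (s j)) (\<pi> s j) h = f j"
      by (auto simp: Ts_def)
    have "Fm (tup J T) (P s) X h (E s) = t"
    proof (rule extensionalityI[OF Fm_tup_extensional tD(1)])
      fix j assume j: "j \<in> Obj J"
      show "Fm (tup J T) (P s) X h (E s) j = t j"
        unfolding Eact[OF s X h(1) j] h(2)[OF j] by (rule sf(3)[OF j])
    qed
    then show "\<exists>s\<in>K. \<exists>h\<in>Hom C X (P s). Fm (tup J T) (P s) X h (E s) = t"
      using s h by blast
  next
    fix X s s' f g
    assume X: "X \<in> Obj C" and s: "s \<in> K" and s': "s' \<in> K" and f: "f \<in> Hom C X (P s)" and g: "g \<in> Hom C X (P s')"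
      and eq: "Fm (tup J T) (P s) X f (E s) = Fm (tup J T) (P s') X g (E s')"
    have j: "s j = s' j" "Comp C X (P s) (A j (s j)) (\<pi> s j) f = Comp C X (P s') (A j (s' j)) (\<pi> s' j) g"
      if j: "j \<in> Obj J" for j
    proof -
      have "Fm (Fo T j) (A j (s j)) X (Comp C X (P s) (A j (s j)) (\<pi> s j) f) (e j (s j)) =
          Fm (Fo T j) (A j (s' j)) X (Comp C X (P s') (A j (s' j)) (\<pi> s' j) g) (e j (s' j))"
        using fun_cong[OF eq, of j] unfolding Eact[OF s X f j] Eact[OF s' X g j] .
      from ufam_inj[OF u[OF j] X this KD[OF s j] KD[OF s' j]]
      show "s j = s' j" "Comp C X (P s) (A j (s j)) (\<pi> s j) f = Comp C X (P s') (A j (s' j)) (\<pi> s' j) g"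
        using Comp_in[OF f \<pi>[OF s j] X P[OF s]] Comp_in[OF g \<pi>[OF s' j] X P[OF s']]
          D(1)[OF j KD[OF s j]] D(1)[OF j KD[OF s' j]] by blast+
    qed
    show ss: "s = s'"
      by (rule extensionalityI[of _ "Obj J"]) (use s s' j(1) in \<open>auto simp: K_def PiE_def\<close>)
    show "f = g"
      by (rule limit_hom_eq[OF Ts[OF s] lim[OF s] X f]) (use g j(2) ss in \<open>auto simp: Ts_def\<close>)
  qed
  with finK show ?thesis by (rule that)
qed

text \<open>Any limit is in pointwise bijection with the compatible tuples and so inherits their
  universal elements.\<close>

lemma fams_limit:
  fixes J :: "(nat, nat) cat"
  assumes S: "S \<subseteq> Obj (psh_cat C)" and rep: "\<And>A. A \<in> Obj C \<Longrightarrow> representable C A \<in> S"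
    and fc: "finitely_complete C" and J: "finite_category J"
    and T: "is_functor J (full_subcat (psh_cat C) S) T"
    and fam: "\<And>j. j \<in> Obj J \<Longrightarrow> Fo T j \<in> fams"
    and L: "is_limit J (full_subcat (psh_cat C) S) T L \<pi>"
  shows "L \<in> fams"
proof -
  obtain K :: "(nat \<Rightarrow> nat) set" and P E where K: "finite K" "ufam (tup J T) K P E"
    using tup_ufam[OF S fc J T fam] by blast
  note c = coneD[OF limit_cone[OF L], simplified]
  have LS: "psh L" using c(1) S by auto
  obtain E' where "ufam L K P E'"
  proof (rule ufam_transfer[OF K(2) LS, of "\<lambda>X x. \<lambda>j\<in>Obj J. \<pi> j X x"])
    fix X Y f x assume *: "X \<in> Obj C" "Y \<in> Obj C" "f \<in> Hom C Y X" "x \<in> Fo L X"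
    show "(\<lambda>j\<in>Obj J. \<pi> j Y (Fm L X Y f x)) = Fm (tup J T) X Y f (\<lambda>j\<in>Obj J. \<pi> j X x)"
      by (rule extensionalityI[OF _ Fm_tup_extensional])
        (use nat_act[OF c(2) LS *(4,3,1,2)] in auto)
  qed (use limit_pointwise[OF S rep T L] in auto)
  then show ?thesis by (rule famsI[OF LS K(1)])
qed

text \<open>Supplies the products from which lex diagrams are built. The tuples themselves are not
  elements of \<open>'u\<close>, so the limit is realised as a \<open>fam_psh\<close> on the objects
  of their universal elements.\<close>

lemma fams_limit_exists:
  fixes J :: "(nat, nat) cat"
  assumes S: "S \<subseteq> Obj (psh_cat C)" and fams: "fams \<subseteq> S"
    and fc: "finitely_complete C" and J: "finite_category J"
    and T: "is_functor J (full_subcat (psh_cat C) S) T"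
    and fam: "\<And>j. j \<in> Obj J \<Longrightarrow> Fo T j \<in> fams"
  obtains L \<pi> where "L \<in> fams" "is_limit J (full_subcat (psh_cat C) S) T L \<pi>"
proof -
  let ?D = "full_subcat (psh_cat C) S"
  obtain K0 :: "(nat \<Rightarrow> nat) set" and P0 E0 where K0: "finite K0" "ufam (tup J T) K0 P0 E0"
    using tup_ufam[OF S fc J T fam] by blast
  obtain r where "bij_betw r {0..<card K0} K0"
    using ex_bij_betw_nat_finite[OF K0(1)] by blast
  from ufam_reindex[OF this K0(2)] obtain K :: "nat set" and P E where
    K: "finite K" "ufam (tup J T) K P E" by blast
  note D = ufamD[OF K(2)]
  let ?L = "fam_psh K P" and ?e = "\<lambda>i. pair_code (i, Id C (P i))"
  have L: "psh ?L" by (rule psh_fam_psh[OF K(1) D(1)])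
  have uL: "ufam ?L K P ?e" by (rule ufam_fam_psh[OF D(1)])
  have LF: "?L \<in> fams" by (rule famsI[OF L K(1) uL])
  have TS: "psh (Fo T j)" if "j \<in> Obj J" for j using functorD(1)[OF T that] S by auto
  have Tm: "Fm T i j k \<in> Hom (psh_cat C) (Fo T i) (Fo T j)" if "i \<in> Obj J" "j \<in> Obj J" "k \<in> Hom J i j" for i j k
    using functorD(2)[OF T that] by simp
  have "\<exists>\<alpha>. \<alpha> \<in> Hom (psh_cat C) ?L (Fo T j) \<and> (\<forall>X\<in>Obj C. \<forall>i\<in>K. \<forall>f\<in>Hom C X (P i).
      \<alpha> X (Fm ?L (P i) X f (?e i)) = Fm (Fo T j) (P i) X f (E i j))" if j: "j \<in> Obj J" for j
  proof -
    have "E i j \<in> Fo (Fo T j) (P i)" if "i \<in> K" for i using tupD(2)[OF D(2)[OF that] j] .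
    then show ?thesis by (rule ufam_nat_ex[OF L uL TS[OF j]]) auto
  qed
  then obtain \<pi> where \<pi>: "\<And>j. j \<in> Obj J \<Longrightarrow> \<pi> j \<in> Hom (psh_cat C) ?L (Fo T j)"
    and \<pi>act: "\<And>j X i f. j \<in> Obj J \<Longrightarrow> X \<in> Obj C \<Longrightarrow> i \<in> K \<Longrightarrow> f \<in> Hom C X (P i) \<Longrightarrow>
      \<pi> j X (Fm ?L (P i) X f (?e i)) = Fm (Fo T j) (P i) X f (E i j)"
    by metis
  have \<pi>tup: "(\<lambda>j\<in>Obj J. \<pi> j X (Fm ?L (P i) X f (?e i))) = Fm (tup J T) (P i) X f (E i)"
    if "X \<in> Obj C" "i \<in> K" "f \<in> Hom C X (P i)" for X i f
    by (rule extensionalityI[OF _ Fm_tup_extensional]) (use \<pi>act[OF _ that] in auto)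
  have cone: "is_cone J ?D T ?L \<pi>"
    unfolding is_cone_def Obj_full_subcat Hom_full_subcat Comp_full_subcat
  proof (intro conjI ballI)
    show "?L \<in> S" using LF fams by blast
    fix i j k assume *: "i \<in> Obj J" "j \<in> Obj J" "k \<in> Hom J i j"
    show "Comp (psh_cat C) ?L (Fo T i) (Fo T j) (Fm T i j k) (\<pi> i) = \<pi> j"
    proof (rule ufam_nat_unique[OF L uL Comp_psh_in[OF L TS[OF *(1)] \<pi>[OF *(1)] Tm[OF *]] \<pi>[OF *(2)]])
      fix a assume a: "a \<in> K"
      have id: "Fm ?L (P a) (P a) (Id C (P a)) (?e a) = ?e a"
        using act_Id[OF L ufamD(2)[OF uL a] D(1)[OF a]] .
      have "\<pi> j (P a) (?e a) = E a j" if "j \<in> Obj J" for j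
        using \<pi>act[OF that D(1)[OF a] a Id_in[OF D(1)[OF a]]] act_Id[OF TS[OF that] tupD(2)[OF D(2)[OF a] that] D(1)[OF a]]
        unfolding id by simp
      then show "Comp (psh_cat C) ?L (Fo T i) (Fo T j) (Fm T i j k) (\<pi> i) (P a) (?e a) = \<pi> j (P a) (?e a)"
        using tupD(3)[OF D(2)[OF a] *] Comp_psh_apply[OF D(1)[OF a] ufamD(2)[OF uL a]] *(1,2) by simp
    qed
  qed (rule \<pi>)
  have "is_limit J ?D T ?L \<pi>"
  proof (rule pointwise_limit[OF S T cone])
    fix X assume X: "X \<in> Obj C"
    show "bij_betw (\<lambda>x. \<lambda>j\<in>Obj J. \<pi> j X x) (Fo ?L X) (Fo (tup J T) X)"
      unfolding bij_betw_def inj_on_def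
    proof (intro conjI ballI impI)
      fix x y assume x: "x \<in> Fo ?L X" and y: "y \<in> Fo ?L X"
        and eq: "(\<lambda>j\<in>Obj J. \<pi> j X x) = (\<lambda>j\<in>Obj J. \<pi> j X y)"
      obtain i f where i: "i \<in> K" "f \<in> Hom C X (P i)" "Fm ?L (P i) X f (?e i) = x" by (rule ufam_cases[OF uL X x])
      obtain i' f' where i': "i' \<in> K" "f' \<in> Hom C X (P i')" "Fm ?L (P i') X f' (?e i') = y" by (rule ufam_cases[OF uL X y])
      have "Fm (tup J T) (P i) X f (E i) = Fm (tup J T) (P i') X f' (E i')"
        using eq \<pi>tup[OF X i(1,2)] \<pi>tup[OF X i'(1,2)] unfolding i(3) i'(3) by simp
      from ufam_inj[OF K(2) X this i(1) i'(1) i(2) i'(2)] show "x = y" using i(3) i'(3) by simp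
    next
      show "(\<lambda>x. \<lambda>j\<in>Obj J. \<pi> j X x) ` Fo ?L X = Fo (tup J T) X"
      proof (intro equalityI subsetI)
        fix t assume "t \<in> (\<lambda>x. \<lambda>j\<in>Obj J. \<pi> j X x) ` Fo ?L X"
        then obtain x where x: "x \<in> Fo ?L X" "t = (\<lambda>j\<in>Obj J. \<pi> j X x)" by blast
        show "t \<in> Fo (tup J T) X"
          by (rule tupI) (use x X nat_in[OF \<pi>] cone_comp[OF S T cone X] in auto)
      next
        fix t assume t: "t \<in> Fo (tup J T) X"
        obtain i f where i: "i \<in> K" "f \<in> Hom C X (P i)" "Fm (tup J T) (P i) X f (E i) = t" by (rule ufam_cases[OF K(2) X t])
        have "t = (\<lambda>j\<in>Obj J. \<pi> j X (Fm ?L (P i) X f (?e i)))"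
          unfolding \<pi>tup[OF X i(1,2)] i(3) ..
        moreover have "Fm ?L (P i) X f (?e i) \<in> Fo ?L X"
          by (rule act_in[OF L ufamD(2)[OF uL i(1)] i(2) D(1)[OF i(1)] X])
        ultimately show "t \<in> (\<lambda>x. \<lambda>j\<in>Obj J. \<pi> j X x) ` Fo ?L X" by (rule image_eqI)
      qed
    qed
  qed
  with LF show ?thesis by (rule that)
qed

end


section \<open>Weighted colimits of finite coproducts of representables\<close>

lemma weighted_coconeD:
  assumes "weighted_cocone K \<phi> E D L \<eta>"
  shows "L \<in> Obj E" and "k \<in> Obj K \<Longrightarrow> x \<in> Fo \<phi> k \<Longrightarrow> \<eta> k x \<in> Hom E (Fo D k) L"
    and "k \<in> Obj K \<Longrightarrow> l \<in> Obj K \<Longrightarrow> f \<in> Hom K k l \<Longrightarrow> x \<in> Fo \<phi> l \<Longrightarrow>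
      \<eta> k (Fm \<phi> l k f x) = Comp E (Fo D k) (Fo D l) L (\<eta> l x) (Fm D k l f)"
  using assms by (simp_all add: weighted_cocone_def)

lemma weighted_colimit_Ex1:
  "is_weighted_colimit K \<phi> E D L \<eta> \<Longrightarrow> weighted_cocone K \<phi> E D M \<mu> \<Longrightarrow>
   \<exists>!h. h \<in> Hom E L M \<and> (\<forall>k\<in>Obj K. \<forall>x\<in>Fo \<phi> k. Comp E (Fo D k) L M h (\<eta> k x) = \<mu> k x)"
  by (simp add: is_weighted_colimit_def)

lemma (in categ) weighted_colimit_unique:
  assumes D: "\<And>k. k \<in> Obj K \<Longrightarrow> Fo D k \<in> Obj C"
    and L: "is_weighted_colimit K \<phi> C D L \<eta>" and M: "is_weighted_colimit K \<phi> C D M \<mu>"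
  shows "isomorphic C L M"
proof -
  have cL: "weighted_cocone K \<phi> C D L \<eta>" and cM: "weighted_cocone K \<phi> C D M \<mu>"
    using L M by (simp_all add: is_weighted_colimit_def)
  note l = weighted_coconeD[OF cL] and m = weighted_coconeD[OF cM]
  obtain h where h: "h \<in> Hom C L M" "\<And>k x. k \<in> Obj K \<Longrightarrow> x \<in> Fo \<phi> k \<Longrightarrow> Comp C (Fo D k) L M h (\<eta> k x) = \<mu> k x"
    using weighted_colimit_Ex1[OF L cM] by blast
  obtain g where g: "g \<in> Hom C M L" "\<And>k x. k \<in> Obj K \<Longrightarrow> x \<in> Fo \<phi> k \<Longrightarrow> Comp C (Fo D k) M L g (\<mu> k x) = \<eta> k x"
    using weighted_colimit_Ex1[OF M cL] by blast
  have "Comp C L M L g h = Id C L"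
    by (rule Ex1_unique[OF weighted_colimit_Ex1[OF L cL]]) (use D l m h g in auto)
  moreover have "Comp C M L M h g = Id C M"
    by (rule Ex1_unique[OF weighted_colimit_Ex1[OF M cM]]) (use D l m h g in auto)
  ultimately show ?thesis
    using h(1) g(1) by (auto simp: isomorphic_def is_iso_def)
qed

context ls_categ
begin

lemma ufam_cong:
  assumes "ufam F I A e" "\<And>i. i \<in> I \<Longrightarrow> A' i = A i" "\<And>i. i \<in> I \<Longrightarrow> e' i = e i"
  shows "ufam F I A' e'"
proof -
  have "ufam F I A' e' \<longleftrightarrow> ufam F I A e"
    unfolding ufam_def using assms(2,3) by (simp cong: ball_cong bex_cong)
  then show ?thesis using assms(1) by simp
qed

lemma ufam_exists:
  assumes "finite I" "\<And>i. i \<in> I \<Longrightarrow> A i \<in> Obj C"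
  obtains F e where "psh F" "F \<in> fams" "ufam F I A e"
proof -
  obtain r where r: "bij_betw r I {0..<card I}"
    using ex_bij_betw_finite_nat[OF assms(1)] by blast
  let ?A = "\<lambda>n. A (inv_into I r n)"
  have A: "?A n \<in> Obj C" if "n \<in> {0..<card I}" for n
    using assms(2) bij_betwE[OF bij_betw_inv_into[OF r]] that by blast
  have F: "psh (fam_psh {0..<card I} ?A)"
    by (rule psh_fam_psh[OF finite_atLeastLessThan A])
  have u: "ufam (fam_psh {0..<card I} ?A) {0..<card I} ?A (\<lambda>n. pair_code (n, Id C (?A n)))"
    by (rule ufam_fam_psh[OF A])
  have "ufam (fam_psh {0..<card I} ?A) I (\<lambda>i. ?A (r i)) (\<lambda>i. pair_code (r i, Id C (?A (r i))))"
    by (rule ufam_reindex[OF r u])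
  then have "ufam (fam_psh {0..<card I} ?A) I A (\<lambda>i. pair_code (r i, Id C (?A (r i))))"
    by (rule ufam_cong) (simp_all add: bij_betw_inv_into_left[OF r])
  then show ?thesis
    by (rule that[OF F famsI[OF F finite_atLeastLessThan u]])
qed

lemma ufam_coproduct:
  assumes F: "psh F" "ufam F I A e"
  shows "is_coproduct (psh_cat C) I (\<lambda>i. representable C (A i)) F (\<lambda>i. yon F (A i) (e i))"
  unfolding is_coproduct_def
proof (intro conjI ballI allI impI)
  note D = ufamD[OF F(2)]
  show "psh F" by fact
  show \<iota>: "yon F (A i) (e i) \<in> Hom (psh_cat C) (representable C (A i)) F" if "i \<in> I" for i
    using F(1) D[OF that] by blast
  fix G \<mu> assume G: "psh G" and \<mu>: "\<forall>i\<in>I. \<mu> i \<in> Hom (psh_cat C) (representable C (A i)) G"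
  have \<mu>in: "\<mu> i (A i) (Id C (A i)) \<in> Fo G (A i)" if "i \<in> I" for i
    using nat_in[of "\<mu> i" "representable C (A i)" G "Id C (A i)" "A i"] \<mu> D that by simp
  have \<mu>yon: "\<mu> i = yon G (A i) (\<mu> i (A i) (Id C (A i)))" if "i \<in> I" for i
    using yon_unique[OF _ G D(1)[OF that]] \<mu> that by blast
  \<comment> \<open>By the Yoneda lemma both transformations are determined by their values at the
    identity of \<open>A i\<close>.\<close>
  have iff: "Comp (psh_cat C) (representable C (A i)) F G h (yon F (A i) (e i)) = \<mu> i \<longleftrightarrow>
      h (A i) (e i) = \<mu> i (A i) (Id C (A i))"
    if h: "h \<in> Hom (psh_cat C) F G" and i: "i \<in> I" for h i
  proof -
    let ?c = "Comp (psh_cat C) (representable C (A i)) F G h (yon F (A i) (e i))"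
    have c: "?c \<in> Hom (psh_cat C) (representable C (A i)) G"
      using Comp_psh_in[OF _ F(1) \<iota>[OF i] h] D[OF i] by blast
    have "?c = yon G (A i) (?c (A i) (Id C (A i)))" by (rule yon_unique[OF c G D(1)[OF i]])
    moreover have ce: "?c (A i) (Id C (A i)) = h (A i) (e i)"
      using D[OF i] F(1) by simp
    ultimately show ?thesis using \<mu>yon[OF i] by metis
  qed
  obtain h where h: "h \<in> Hom (psh_cat C) F G" "\<And>i. i \<in> I \<Longrightarrow> h (A i) (e i) = \<mu> i (A i) (Id C (A i))"
    by (rule ufam_nat_ex[OF F G, of "\<lambda>i. \<mu> i (A i) (Id C (A i))"]) (use \<mu>in in blast)+
  show "\<exists>!h. h \<in> Hom (psh_cat C) F G \<and>
      (\<forall>i\<in>I. Comp (psh_cat C) (representable C (A i)) F G h (yon F (A i) (e i)) = \<mu> i)"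
  proof (rule ex1I[of _ h])
    fix h' assume h': "h' \<in> Hom (psh_cat C) F G \<and>
      (\<forall>i\<in>I. Comp (psh_cat C) (representable C (A i)) F G h' (yon F (A i) (e i)) = \<mu> i)"
    then show "h' = h"
      using iff h by (intro ufam_nat_unique[OF F _ h(1)]) auto
  qed (use iff h in auto)
qed

text \<open>The weights are specified by a universal property in the presheaf category; comparison
  with a coded sum supplies the universal elements.\<close>

lemma coproduct_ufam:
  assumes F: "is_coproduct (psh_cat C) I (\<lambda>i. representable C (A i)) F \<iota>"
    and I: "finite I" and A: "\<And>i. i \<in> I \<Longrightarrow> A i \<in> Obj C"
  obtains e where "ufam F I A e"
proof -
  interpret P: categ "psh_cat C" using category_psh by (simp add: categ_def)
  obtain G e where G: "psh G" "ufam G I A e"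
    by (rule ufam_exists[where A=A, OF I]) (use A in auto)
  have psh: "psh F" using F by (simp add: is_coproduct_def)
  obtain c d where "c \<in> Hom (psh_cat C) F G" "d \<in> Hom (psh_cat C) G F"
    "Comp (psh_cat C) G F G c d = Id (psh_cat C) G" "Comp (psh_cat C) F G F d c = Id (psh_cat C) F"
    by (rule P.coproduct_compare[OF F ufam_coproduct[OF G]]) (use A in blast)+
  then have "is_iso (full_subcat (psh_cat C) (Obj (psh_cat C))) F G c"
    by (auto simp: is_iso_def)
  from ufam_iso_transfer[OF G(2,1) psh _ G(1) psh this] show ?thesis
    using that by blast
qed

text \<open>
  If the weight \<open>\<phi>\<close> is the coproduct of the representables at \<open>W b\<close>, then the colimit of \<open>D\<close>
  weighted by \<open>\<phi>\<close> is the coproduct of the \<open>D (W b)\<close>.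
\<close>

lemma sum_weighted_colimit:
  fixes K :: "('u, 'u) cat"
  assumes K: "ls_categ K" and \<phi>: "\<phi> \<in> Obj (psh_cat K)" and u: "ls_categ.ufam K \<phi> B W u"
    and S: "S \<subseteq> Obj (psh_cat C)" and D: "is_functor K (full_subcat (psh_cat C) S) D"
    and DW: "\<And>b. b \<in> B \<Longrightarrow> ufam (Fo D (W b)) (I b) A (e' b)"
    and disj: "\<And>b c. b \<in> B \<Longrightarrow> c \<in> B \<Longrightarrow> b \<noteq> c \<Longrightarrow> I b \<inter> I c = {}"
    and F: "F \<in> S" and uF: "ufam F (\<Union>b\<in>B. I b) A e"
  obtains \<eta> where "is_weighted_colimit K \<phi> (full_subcat (psh_cat C) S) D F \<eta>"
proof -
  interpret K: ls_categ K by fact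
  let ?E = "full_subcat (psh_cat C) S"
  note wD = K.ufamD[OF u] and Fd = ufamD[OF uF]
  have FS: "psh F" using F S by blast
  have Dp: "psh (Fo D k)" if "k \<in> Obj K" for k using functorD(1)[OF D that] S by auto
  have Dm: "Fm D k l f \<in> Hom (psh_cat C) (Fo D k) (Fo D l)" if "k \<in> Obj K" "l \<in> Obj K" "f \<in> Hom K k l" for k l f
    using functorD(2)[OF D that] by simp
  interpret P: categ "psh_cat C" using category_psh by (simp add: categ_def)
  have "\<exists>\<alpha>. \<alpha> \<in> Hom (psh_cat C) (Fo D (W b)) F \<and> (\<forall>i\<in>I b. \<alpha> (A i) (e' b i) = e i)" if b: "b \<in> B" for b
    by (rule ufam_nat_ex[OF Dp[OF wD(1)[OF b]] DW[OF b] FS, of e]) (use Fd(2) b in blast)+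
  then obtain \<alpha> where \<alpha>: "\<And>b. b \<in> B \<Longrightarrow> \<alpha> b \<in> Hom (psh_cat C) (Fo D (W b)) F"
    "\<And>b i. b \<in> B \<Longrightarrow> i \<in> I b \<Longrightarrow> \<alpha> b (A i) (e' b i) = e i"
    by metis
  \<comment> \<open>Every element of the weight is the restriction of a universal element
    \<open>u b\<close> along some arrow of \<open>K\<close>; the cocone condition forces its
    component to be \<open>\<alpha> b\<close> after the image of that arrow under
    \<open>D\<close>.\<close>
  define \<eta> where "\<eta> k x = (let b = fst (K.coords \<phi> B W u k x) in
    Comp (psh_cat C) (Fo D k) (Fo D (W b)) F (\<alpha> b) (Fm D k (W b) (snd (K.coords \<phi> B W u k x))))" for k x
  have \<eta>: "\<eta> k (Fm \<phi> (W b) k f (u b)) = Comp (psh_cat C) (Fo D k) (Fo D (W b)) F (\<alpha> b) (Fm D k (W b) f)"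
    if "k \<in> Obj K" "b \<in> B" "f \<in> Hom K k (W b)" for k b f
    using K.coords_eq[OF u that K.act_in[OF \<phi> wD(2)[OF that(2)] that(3) wD(1)[OF that(2)] that(1)]]
    by (simp add: \<eta>_def)
  have \<eta>u: "\<eta> (W b) (u b) = \<alpha> b" if b: "b \<in> B" for b
    using \<eta>[OF wD(1)[OF b] b K.Id_in[OF wD(1)[OF b]]] K.act_Id[OF \<phi> wD(2)[OF b] wD(1)[OF b]]
      functorD(3)[OF D wD(1)[OF b]] P.Comp_Id_right[OF \<alpha>(1)[OF b] Dp[OF wD(1)[OF b]] FS] by simp
  have cocone: "weighted_cocone K \<phi> ?E D F \<eta>"
    unfolding weighted_cocone_def Obj_full_subcat Hom_full_subcat Comp_full_subcat
  proof (intro conjI ballI)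
    fix k x assume k: "k \<in> Obj K" and x: "x \<in> Fo \<phi> k"
    obtain b f where b: "b \<in> B" "f \<in> Hom K k (W b)" "Fm \<phi> (W b) k f (u b) = x" by (rule K.ufam_cases[OF u k x])
    show "\<eta> k x \<in> Hom (psh_cat C) (Fo D k) F"
      using \<eta>[OF k b(1,2)] Comp_psh_in[OF Dp[OF k] Dp[OF wD(1)[OF b(1)]] Dm[OF k wD(1)[OF b(1)] b(2)] \<alpha>(1)[OF b(1)]] b(3) by simp
  next
    fix k l g x assume k: "k \<in> Obj K" and l: "l \<in> Obj K" and g: "g \<in> Hom K k l" and x: "x \<in> Fo \<phi> l"
    obtain b f where b: "b \<in> B" "f \<in> Hom K l (W b)" "Fm \<phi> (W b) l f (u b) = x" by (rule K.ufam_cases[OF u l x])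
    note Wb = wD[OF b(1)]
    have "Fm \<phi> l k g x = Fm \<phi> (W b) k (Comp K k l (W b) f g) (u b)"
      using K.act_Comp[OF \<phi> Wb(2) b(2) g Wb(1) l k] b(3) by simp
    then have "\<eta> k (Fm \<phi> l k g x) = Comp (psh_cat C) (Fo D k) (Fo D (W b)) F (\<alpha> b) (Fm D k (W b) (Comp K k l (W b) f g))"
      using \<eta>[OF k b(1) K.Comp_in[OF g b(2) k l Wb(1)]] by simp
    also have "\<dots> = Comp (psh_cat C) (Fo D k) (Fo D l) F (Comp (psh_cat C) (Fo D l) (Fo D (W b)) F (\<alpha> b) (Fm D l (W b) f)) (Fm D k l g)"
      using P.Comp_assoc[OF Dm[OF k l g] Dm[OF l Wb(1) b(2)] \<alpha>(1)[OF b(1)] Dp[OF k] Dp[OF l] Dp[OF Wb(1)] FS]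
        functorD(4)[OF D k l Wb(1) g b(2)] by simp
    also have "\<dots> = Comp (psh_cat C) (Fo D k) (Fo D l) F (\<eta> l x) (Fm D k l g)"
      using \<eta>[OF l b(1,2)] b(3) by simp
    finally show "\<eta> k (Fm \<phi> l k g x) = Comp (psh_cat C) (Fo D k) (Fo D l) F (\<eta> l x) (Fm D k l g)" .
  qed (rule F)
  have "is_weighted_colimit K \<phi> ?E D F \<eta>"
    unfolding is_weighted_colimit_def
  proof (intro conjI allI impI)
    fix M \<mu> assume M: "weighted_cocone K \<phi> ?E D M \<mu>"
    note m = weighted_coconeD[OF M, unfolded Obj_full_subcat Hom_full_subcat Comp_full_subcat]
    have MS: "psh M" using m(1) S by blast
    have \<mu>: "\<mu> (W b) (u b) \<in> Hom (psh_cat C) (Fo D (W b)) M" if "b \<in> B" for b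
      by (rule m(2)[OF wD[OF that]])
    \<comment> \<open>Disjointness of the sets \<open>I b\<close> makes the description operator
      pick the one \<open>b\<close> to which \<open>i\<close> belongs.\<close>
    define g where "g i = (let b = (THE b. b \<in> B \<and> i \<in> I b) in \<mu> (W b) (u b) (A i) (e' b i))" for i
    have g: "g i = \<mu> (W b) (u b) (A i) (e' b i)" if "b \<in> B" "i \<in> I b" for b i
    proof -
      have "(THE b. b \<in> B \<and> i \<in> I b) = b" using that disj by (intro the_equality) blast+
      then show ?thesis by (simp add: g_def)
    qed
    have gin: "g i \<in> Fo M (A i)" if i: "i \<in> (\<Union>b\<in>B. I b)" for i
    proof -
      obtain b where b: "b \<in> B" "i \<in> I b" using i by blast
      show ?thesis unfolding g[OF b]
        by (rule nat_in[OF \<mu>[OF b(1)] ufamD(2)[OF DW[OF b(1)] b(2)] ufamD(1)[OF DW[OF b(1)] b(2)]])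
    qed
    obtain h where h: "h \<in> Hom (psh_cat C) F M" "\<And>i. i \<in> (\<Union>b\<in>B. I b) \<Longrightarrow> h (A i) (e i) = g i"
      by (rule ufam_nat_ex[OF FS uF MS, of g]) (use gin in blast)+
    have iff: "(\<forall>k\<in>Obj K. \<forall>x\<in>Fo \<phi> k. Comp (psh_cat C) (Fo D k) F M h' (\<eta> k x) = \<mu> k x) \<longleftrightarrow>
        (\<forall>i\<in>(\<Union>b\<in>B. I b). h' (A i) (e i) = g i)" (is "?l = ?r") if h': "h' \<in> Hom (psh_cat C) F M" for h'
    proof
      assume l: ?l
      show ?r
      proof
        fix i assume "i \<in> (\<Union>b\<in>B. I b)"
        then obtain b where b: "b \<in> B" "i \<in> I b" by blast
        have "Comp (psh_cat C) (Fo D (W b)) F M h' (\<alpha> b) = \<mu> (W b) (u b)"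
          using bspec[OF bspec[OF l wD(1)[OF b(1)]] wD(2)[OF b(1)]] \<eta>u[OF b(1)] by simp
        then have "h' (A i) (\<alpha> b (A i) (e' b i)) = \<mu> (W b) (u b) (A i) (e' b i)"
          using Comp_psh_apply[OF ufamD[OF DW[OF b(1)] b(2)], of F M h' "\<alpha> b"] by (simp only:)
        then show "h' (A i) (e i) = g i"
          using g[OF b] \<alpha>(2)[OF b] by simp
      qed
    next
      assume r: ?r
      have ab: "Comp (psh_cat C) (Fo D (W b)) F M h' (\<alpha> b) = \<mu> (W b) (u b)" if b: "b \<in> B" for b
      proof (rule ufam_nat_unique[OF Dp[OF wD(1)[OF b]] DW[OF b] _ \<mu>[OF b]])
        show "Comp (psh_cat C) (Fo D (W b)) F M h' (\<alpha> b) \<in> Hom (psh_cat C) (Fo D (W b)) M"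
          by (rule Comp_psh_in[OF Dp[OF wD(1)[OF b]] FS \<alpha>(1)[OF b] h'])
        fix i assume i: "i \<in> I b"
        show "Comp (psh_cat C) (Fo D (W b)) F M h' (\<alpha> b) (A i) (e' b i) = \<mu> (W b) (u b) (A i) (e' b i)"
          using Comp_psh_apply[OF ufamD[OF DW[OF b] i], of F M h' "\<alpha> b"] \<alpha>(2)[OF b i] g[OF b i] r b i by auto
      qed
      show ?l
      proof (intro ballI)
        fix k x assume k: "k \<in> Obj K" and x: "x \<in> Fo \<phi> k"
        obtain b f where b: "b \<in> B" "f \<in> Hom K k (W b)" "Fm \<phi> (W b) k f (u b) = x" by (rule K.ufam_cases[OF u k x])
        note Wb = wD[OF b(1)]
        have "Comp (psh_cat C) (Fo D k) F M h' (\<eta> k x) =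
            Comp (psh_cat C) (Fo D k) (Fo D (W b)) M (Comp (psh_cat C) (Fo D (W b)) F M h' (\<alpha> b)) (Fm D k (W b) f)"
          using P.Comp_assoc[OF Dm[OF k Wb(1) b(2)] \<alpha>(1)[OF b(1)] h' Dp[OF k] Dp[OF Wb(1)] FS MS] \<eta>[OF k b(1,2)] b(3) by simp
        also have "\<dots> = \<mu> k x"
          using ab[OF b(1)] m(3)[OF k Wb(1) b(2) Wb(2)] b(3) by simp
        finally show "Comp (psh_cat C) (Fo D k) F M h' (\<eta> k x) = \<mu> k x" .
      qed
    qed
    show "\<exists>!h. h \<in> Hom ?E F M \<and> (\<forall>k\<in>Obj K. \<forall>x\<in>Fo \<phi> k. Comp ?E (Fo D k) F M h (\<eta> k x) = \<mu> k x)"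
      unfolding Hom_full_subcat Comp_full_subcat
    proof (rule ex1I[of _ h])
      fix h' assume h': "h' \<in> Hom (psh_cat C) F M \<and> (\<forall>k\<in>Obj K. \<forall>x\<in>Fo \<phi> k. Comp (psh_cat C) (Fo D k) F M h' (\<eta> k x) = \<mu> k x)"
      then have h'in: "h' \<in> Hom (psh_cat C) F M" by simp
      show "h' = h"
        by (rule ufam_nat_unique[OF FS uF h'in h(1)]) (use iff[OF h'in] h' h(2) in auto)
    qed (use iff[OF h(1)] h in simp)
  qed (rule cocone)
  then show ?thesis by (rule that)
qed

text \<open>The given colimit is arbitrary, but it is isomorphic to the explicit sum of the previous
  lemma, and \<open>fams\<close> is closed under isomorphism.\<close>

lemma fams_weighted_colimit:
  fixes K :: "('u, 'u) cat"
  assumes K: "ls_categ K" and \<phi>: "\<phi> \<in> Obj (psh_cat K)" and u: "ls_categ.ufam K \<phi> B W u" and B: "finite B"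
    and S: "S \<subseteq> Obj (psh_cat C)" and fams: "fams \<subseteq> S"
    and D: "is_functor K (full_subcat (psh_cat C) S) D"
    and fam: "\<And>k. k \<in> Obj K \<Longrightarrow> Fo D k \<in> fams"
    and L: "is_weighted_colimit K \<phi> (full_subcat (psh_cat C) S) D L \<eta>"
  shows "L \<in> fams"
proof -
  interpret K: ls_categ K by fact
  interpret E: categ "full_subcat (psh_cat C) S" by (rule categ_psh_sub[OF S])
  have "\<forall>b\<in>B. \<exists>I A e. finite (I :: nat set) \<and> ufam (Fo D (W b)) I A e"
    using fam K.ufamD(1)[OF u] by (auto simp: fams_def)
  then obtain I :: "_ \<Rightarrow> nat set" and A e where
    fin: "\<And>b. b \<in> B \<Longrightarrow> finite (I b)" and uD: "\<And>b. b \<in> B \<Longrightarrow> ufam (Fo D (W b)) (I b) (A b) (e b)"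
    unfolding bchoice_iff by auto
  \<comment> \<open>Tagging by \<open>b\<close> makes the index sets disjoint, as
    \<open>sum_weighted_colimit\<close> demands.\<close>
  let ?I = "\<lambda>b. {b} \<times> I b" and ?A = "\<lambda>p. A (fst p) (snd p)" and ?e = "\<lambda>b p. e b (snd p)"
  have uD': "ufam (Fo D (W b)) (?I b) ?A (?e b)" if b: "b \<in> B" for b
  proof -
    have "bij_betw snd (?I b) (I b)" by (auto simp: bij_betw_def inj_on_def)
    from ufam_reindex[OF this uD[OF b]] show ?thesis by (rule ufam_cong) auto
  qed
  have "finite (\<Union>b\<in>B. ?I b)" using B fin by blast
  moreover have "?A p \<in> Obj C" if "p \<in> (\<Union>b\<in>B. ?I b)" for p
    using that ufamD(1)[OF uD] by auto
  ultimately obtain F e' where F: "psh F" "F \<in> fams" "ufam F (\<Union>b\<in>B. ?I b) ?A e'"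
    by (rule ufam_exists)
  have FS: "F \<in> S" using F(2) fams by blast
  obtain \<eta>' where "is_weighted_colimit K \<phi> (full_subcat (psh_cat C) S) D F \<eta>'"
    by (rule sum_weighted_colimit[OF K \<phi> u S D uD' _ FS F(3)]) auto
  then have "isomorphic (full_subcat (psh_cat C) S) F L"
    using E.weighted_colimit_unique[OF _ _ L] functorD(1)[OF D] by blast
  moreover have "L \<in> S"
    using L by (simp add: is_weighted_colimit_def weighted_cocone_def)
  ultimately show ?thesis
    using fams_iso[OF F(2)] S FS by blast
qed

end

text \<open>Both weights of the class are sums of at most two representables, so index sets inside
  \<open>bool\<close> suffice: the empty set for the initial weight, both truth values for the
  binary one.\<close>

definition sum_weight :: "'u::set_universe weight \<Rightarrow> bool" where
  "sum_weight w \<longleftrightarrow> ls_categ (fst w) \<and> snd w \<in> Obj (psh_cat (fst w)) \<and>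
     (\<exists>(B :: bool set) W u. ls_categ.ufam (fst w) (snd w) B W u)"

context ls_categ
begin

lemma lex_closed_fams:
  assumes fc: "finitely_complete C" and \<Phi>: "\<And>w. w \<in> \<Phi> \<Longrightarrow> sum_weight w"
  shows "lex_closed \<Phi> C fams"
  unfolding lex_closed_def
proof (intro conjI)
  have rep: "representable C A \<in> small_pshs" if "A \<in> Obj C" for A
    using representable_fams[OF that] fams_small by blast
  show "fams \<subseteq> small_pshs" by (rule fams_small)
  show "\<forall>F\<in>fams. \<forall>G\<in>small_pshs. isomorphic (small_psh_cat C) F G \<longrightarrow> G \<in> fams"
  proof (intro ballI impI)
    fix F G assume F: "F \<in> fams" and G: "G \<in> small_pshs" and iso: "isomorphic (small_psh_cat C) F G"
    have "isomorphic (full_subcat (psh_cat C) small_pshs) F G"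
      using iso unfolding small_psh_cat_eq[symmetric] .
    from fams_iso[OF F this small_pshs_psh subsetD[OF fams_small F] G] show "G \<in> fams" .
  qed
  show "\<forall>A\<in>Obj C. representable C A \<in> fams" by simp
  show "\<forall>J T L \<pi>. finite_category J \<and> is_functor J (small_psh_cat C) T \<and> (\<forall>j\<in>Obj J. Fo T j \<in> fams) \<and>
      is_limit J (small_psh_cat C) T L \<pi> \<longrightarrow> L \<in> fams"
  proof (intro allI impI, elim conjE)
    fix J T L \<pi>
    assume *: "finite_category J" "is_functor J (small_psh_cat C) T" "\<forall>j\<in>Obj J. Fo T j \<in> fams"
      "is_limit J (small_psh_cat C) T L \<pi>"
    show "L \<in> fams"
      by (rule fams_limit[OF small_pshs_psh rep fc *(1), folded small_psh_cat_eq, OF _ *(2) _ *(4)])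
        (use *(3) in blast)+
  qed
  show "\<forall>(K, \<phi>)\<in>\<Phi>. \<forall>D L \<eta>. lex_functor K (small_psh_cat C) D \<and> (\<forall>k\<in>Obj K. Fo D k \<in> fams) \<and>
      is_weighted_colimit K \<phi> (small_psh_cat C) D L \<eta> \<longrightarrow> L \<in> fams"
  proof (clarify)
    fix K \<phi> D L \<eta>
    assume w: "(K, \<phi>) \<in> \<Phi>" and D: "lex_functor K (small_psh_cat C) D" "\<forall>k\<in>Obj K. Fo D k \<in> fams"
      and L: "is_weighted_colimit K \<phi> (small_psh_cat C) D L \<eta>"
    obtain B :: "bool set" and W u where "ls_categ K" "\<phi> \<in> Obj (psh_cat K)" "ls_categ.ufam K \<phi> B W u"
      using \<Phi>[OF w] by (auto simp: sum_weight_def)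
    then show "L \<in> fams"
      using fams_weighted_colimit[OF _ _ _ _ small_pshs_psh fams_small, of K \<phi> B W u D L \<eta>] D L
      by (simp add: lex_functor_def small_psh_cat_eq[symmetric])
  qed
qed

end


section \<open>A category freely generated under finite limits by two objects\<close>

lemma is_functor_comp:
  assumes F: "is_functor J K F" and G: "is_functor K E G"
  shows "is_functor J E (functor_comp G F)"
  unfolding is_functor_def functor_comp_def
  using functorD[OF F] functorD[OF G] by simp

lemma lex_functor_comp:
  assumes F: "lex_functor J K F" and G: "lex_functor K E G"
  shows "lex_functor J E (functor_comp G F)"
  unfolding lex_functor_def
proof (intro conjI allI impI)
  show "is_functor J E (functor_comp G F)"
    using F G is_functor_comp unfolding lex_functor_def by blast
  fix I :: "(nat, nat) cat" and T L \<pi>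
  assume "finite_category I \<and> is_functor I J T \<and> is_limit I J T L \<pi>"
  then have *: "finite_category I" "is_functor I J T" "is_limit I J T L \<pi>" by blast+
  have 1: "is_limit I K (functor_comp F T) (Fo F L) (\<lambda>j. Fm F L (Fo T j) (\<pi> j))"
    using F * unfolding lex_functor_def by blast
  have 2: "is_functor I K (functor_comp F T)"
    using F *(2) is_functor_comp unfolding lex_functor_def by blast
  have "is_limit I E (functor_comp G (functor_comp F T)) (Fo G (Fo F L))
      (\<lambda>j. Fm G (Fo F L) (Fo (functor_comp F T) j) (Fm F L (Fo T j) (\<pi> j)))"
    using G *(1) 1 2 unfolding lex_functor_def by blast
  then show "is_limit I E (functor_comp (functor_comp G F) T) (Fo (functor_comp G F) L)
      (\<lambda>j. Fm (functor_comp G F) L (Fo T j) (\<pi> j))"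
    by (simp add: functor_comp_def)
qed

lemma functor_is_iso:
  assumes F: "is_functor K E F" and X: "X \<in> Obj K" "Y \<in> Obj K" and f: "is_iso K X Y f"
  shows "is_iso E (Fo F X) (Fo F Y) (Fm F X Y f)"
proof -
  obtain g where g: "f \<in> Hom K X Y" "g \<in> Hom K Y X" "Comp K X Y X g f = Id K X" "Comp K Y X Y f g = Id K Y"
    using f by (auto simp: is_iso_def)
  then show ?thesis
    unfolding is_iso_def
    using functorD(2,3)[OF F] functorD(4)[OF F X(1) X(2) X(1) g(1,2)] functorD(4)[OF F X(2) X(1) X(2) g(2,1)] X
    by auto
qed

text \<open>
  A finite set of natural numbers is labelled by parity. The opposite of the category of such
  sets and parity-preserving maps is freely generated under finite limits by the sets
  \<open>{0}\<close> and \<open>{1}\<close>: a lex functor into \<open>E\<close> sending them to \<open>A True\<close> and \<open>A False\<close> takes \<open>s\<close> to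
  the product of the \<open>A (even i)\<close> for \<open>i \<in> s\<close>. Objects and arrows are coded in \<open>'u\<close>.
\<close>

definition decode_set :: "'u::set_universe \<Rightarrow> nat set" where
  "decode_set a = set_decode (inv nat_code a)"

lemma finite_decode_set [simp]: "finite (decode_set a)"
  by (simp add: decode_set_def)

lemma decode_set_surj:
  assumes "finite s"
  obtains a :: "'u::set_universe" where "decode_set a = s"
proof
  show "decode_set (nat_code (set_encode s) :: 'u) = s"
    using assms by (simp add: decode_set_def inv_f_f[OF inj_nat_code] set_encode_inverse)
qed

text \<open>Maps that are extensional on a finite domain form a countable set, unlike all functions
  on the natural numbers; this is what allows them to be coded in \<open>'u\<close>.\<close>

definition fin_maps :: "(nat \<Rightarrow> nat) set" where
  "fin_maps = (\<Union>t\<in>{t. finite t}. \<Union>s\<in>{s. finite s}. t \<rightarrow>\<^sub>E s)"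

definition code_map :: "(nat \<Rightarrow> nat) \<Rightarrow> 'u::set_universe" where
  "code_map g = nat_code (to_nat_on fin_maps g)"

definition decode_map :: "'u::set_universe \<Rightarrow> nat \<Rightarrow> nat" where
  "decode_map = inv_into fin_maps code_map"

lemma decode_code_map:
  assumes "g \<in> t \<rightarrow>\<^sub>E s" "finite t" "finite s"
  shows "decode_map (code_map g :: 'u::set_universe) = g"
proof -
  have "countable fin_maps"
    unfolding fin_maps_def
    by (intro countable_UN countable_Collect_finite countable_finite finite_PiE) auto
  then have "inj_on (code_map :: _ \<Rightarrow> 'u::set_universe) fin_maps"
    by (intro inj_onI) (simp add: code_map_def inj_eq[OF inj_nat_code] inj_on_eq_iff[OF inj_on_to_nat_on])
  moreover have "g \<in> fin_maps" using assms by (auto simp: fin_maps_def)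
  ultimately show ?thesis unfolding decode_map_def by (rule inv_into_f_f)
qed

section \<open>The opposite of the category of finite two-coloured sets\<close>

definition pmaps :: "nat set \<Rightarrow> nat set \<Rightarrow> (nat \<Rightarrow> nat) set" where
  "pmaps t s = {g \<in> t \<rightarrow>\<^sub>E s. \<forall>i\<in>t. even (g i) = even i}"

text \<open>Every element of \<open>'u\<close> decodes to some finite set, so all of them may serve
  as objects; several codes of one set give isomorphic objects. An arrow from \<open>a\<close> to
  \<open>b\<close> is a map from the set of \<open>b\<close> to the set of \<open>a\<close>, as the
  category is an opposite one.\<close>

definition parity_cat :: "('u::set_universe, 'u) cat" where
  "parity_cat = \<lparr>Obj = UNIV, Hom = (\<lambda>a b. code_map ` pmaps (decode_set b) (decode_set a)),
     Id = (\<lambda>a. code_map (\<lambda>i\<in>decode_set a. i)),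
     Comp = (\<lambda>a b c g f. code_map (compose (decode_set c) (decode_map f) (decode_map g)))\<rparr>"

lemma Obj_parity [simp]: "a \<in> Obj parity_cat"
  by (simp add: parity_cat_def)

lemma decode_pmap:
  fixes a b :: "'u::set_universe"
  shows "g \<in> pmaps (decode_set b) (decode_set a) \<Longrightarrow> decode_map (code_map g :: 'u) = g"
  by (rule decode_code_map[of _ "decode_set b" "decode_set a"]) (auto simp: pmaps_def)

lemma parity_HomD:
  assumes "f \<in> Hom parity_cat a b"
  shows "decode_map f \<in> pmaps (decode_set b) (decode_set a)" and "code_map (decode_map f) = f"
  using assms decode_pmap[of _ b a] by (auto simp: parity_cat_def)

lemma parity_HomI: "g \<in> pmaps (decode_set b) (decode_set a) \<Longrightarrow> code_map g \<in> Hom parity_cat a b"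
  by (auto simp: parity_cat_def)

lemma parity_Hom_apply:
  assumes "f \<in> Hom parity_cat a b" "i \<in> decode_set b"
  shows "decode_map f i \<in> decode_set a" "even (decode_map f i) = even i"
  using parity_HomD(1)[OF assms(1)] assms(2) by (auto simp: pmaps_def PiE_iff)

lemma parity_eqI:
  assumes "f \<in> Hom parity_cat a b" "g \<in> Hom parity_cat a b"
    and "\<And>i. i \<in> decode_set b \<Longrightarrow> decode_map f i = decode_map g i"
  shows "f = g"
proof -
  have "decode_map f = decode_map g"
    by (rule extensionalityI[of _ "decode_set b"])
      (use assms(3) parity_HomD(1)[OF assms(1)] parity_HomD(1)[OF assms(2)] in \<open>auto simp: pmaps_def PiE_def\<close>)
  then show ?thesis using parity_HomD(2) assms(1,2) by metis
qed

lemma parity_Comp_in: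
  assumes "f \<in> Hom parity_cat a b" "g \<in> Hom parity_cat b c"
  shows "Comp parity_cat a b c g f \<in> Hom parity_cat a c"
proof -
  have "compose (decode_set c) (decode_map f) (decode_map g) \<in> pmaps (decode_set c) (decode_set a)"
    using parity_Hom_apply[OF assms(1)] parity_Hom_apply[OF assms(2)]
    by (auto simp: pmaps_def compose_def)
  then show ?thesis by (auto simp: parity_cat_def)
qed

lemma parity_Comp_apply:
  assumes "f \<in> Hom parity_cat a b" "g \<in> Hom parity_cat b c" "i \<in> decode_set c"
  shows "decode_map (Comp parity_cat a b c g f) i = decode_map f (decode_map g i)"
proof -
  have "compose (decode_set c) (decode_map f) (decode_map g) \<in> pmaps (decode_set c) (decode_set a)"
    using parity_Hom_apply[OF assms(1)] parity_Hom_apply[OF assms(2)]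
    by (auto simp: pmaps_def compose_def)
  from decode_pmap[OF this] show ?thesis
    using assms(3) by (simp add: parity_cat_def compose_def)
qed

lemma parity_Id_in: "Id parity_cat a \<in> Hom parity_cat a a"
  by (auto simp: parity_cat_def pmaps_def)

lemma parity_Id_apply: "i \<in> decode_set a \<Longrightarrow> decode_map (Id parity_cat a) i = i"
proof -
  have "(\<lambda>i\<in>decode_set a. i) \<in> pmaps (decode_set a) (decode_set a)" by (auto simp: pmaps_def)
  from decode_pmap[OF this] show "i \<in> decode_set a \<Longrightarrow> decode_map (Id parity_cat a) i = i"
    by (simp add: parity_cat_def)
qed

lemma category_parity: "category parity_cat"
  unfolding category_def
proof (intro conjI ballI)
  fix a b f assume f: "f \<in> Hom parity_cat a b"
  show "Comp parity_cat a a b f (Id parity_cat a) = f"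
    by (rule parity_eqI[OF parity_Comp_in[OF parity_Id_in f] f])
      (simp add: parity_Comp_apply[OF parity_Id_in f] parity_Id_apply parity_Hom_apply[OF f])
  show "Comp parity_cat a b b (Id parity_cat b) f = f"
    by (rule parity_eqI[OF parity_Comp_in[OF f parity_Id_in] f])
      (simp add: parity_Comp_apply[OF f parity_Id_in] parity_Id_apply)
next
  fix a b c d f g h
  assume f: "f \<in> Hom parity_cat a b" and g: "g \<in> Hom parity_cat b c" and h: "h \<in> Hom parity_cat c d"
  show "Comp parity_cat a b d (Comp parity_cat b c d h g) f = Comp parity_cat a c d h (Comp parity_cat a b c g f)"
    by (rule parity_eqI[OF parity_Comp_in[OF f parity_Comp_in[OF g h]] parity_Comp_in[OF parity_Comp_in[OF f g] h]])
      (simp add: parity_Comp_apply[OF f parity_Comp_in[OF g h]] parity_Comp_apply[OF g h]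
        parity_Comp_apply[OF parity_Comp_in[OF f g] h] parity_Comp_apply[OF f g] parity_Hom_apply[OF h])
qed (auto intro: parity_Id_in parity_Comp_in)

lemma locally_small_parity: "locally_small (parity_cat :: ('u::set_universe, 'u) cat)"
  unfolding locally_small_def
proof (intro ballI)
  fix a b :: 'u
  have "finite (pmaps (decode_set b) (decode_set a))"
    by (rule finite_subset[of _ "decode_set b \<rightarrow>\<^sub>E decode_set a"]) (auto simp: pmaps_def intro: finite_PiE)
  then show "small TYPE('u) (Hom parity_cat a b)"
    by (intro small_finite) (simp add: parity_cat_def)
qed

lemma parity_code_apply:
  fixes a b :: "'u::set_universe"
  assumes "\<And>i. i \<in> decode_set b \<Longrightarrow> g i \<in> decode_set a" "\<And>i. i \<in> decode_set b \<Longrightarrow> even (g i) = even i"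
  shows "code_map (\<lambda>i\<in>decode_set b. g i) \<in> Hom parity_cat a b"
    and "i \<in> decode_set b \<Longrightarrow> decode_map (code_map (\<lambda>i\<in>decode_set b. g i) :: 'u) i = g i"
proof -
  have *: "(\<lambda>i\<in>decode_set b. g i) \<in> pmaps (decode_set b) (decode_set a)"
    using assms by (auto simp: pmaps_def)
  show "code_map (\<lambda>i\<in>decode_set b. g i) \<in> Hom parity_cat a b" by (rule parity_HomI[OF *])
  show "i \<in> decode_set b \<Longrightarrow> decode_map (code_map (\<lambda>i\<in>decode_set b. g i) :: 'u) i = g i"
    using decode_pmap[OF *] by simp
qed

text \<open>
  A limit in the opposite category is a colimit of finite sets, that is, a quotient of the
  disjoint union. Two elements are identified if every cocone identifies them, which avoids
  generating an equivalence relation.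
\<close>

lemma finitely_complete_parity: "finitely_complete (parity_cat :: ('u::set_universe, 'u) cat)"
  unfolding finitely_complete_def
proof (intro allI impI, elim conjE)
  fix J :: "(nat, nat) cat" and T
  assume J: "finite_category J" and T: "is_functor J (parity_cat :: ('u, 'u) cat) T"
  let ?M = "parity_cat :: ('u, 'u) cat"
  define U where "U = (SIGMA j:Obj J. decode_set (Fo T j))"
  have finU: "finite U" using J by (auto simp: U_def finite_category_def)
  define rel where "rel u v \<longleftrightarrow> even (snd u) = even (snd v) \<and>
    (\<forall>N \<nu>. is_cone J ?M T N \<nu> \<longrightarrow> decode_map (\<nu> (fst u)) (snd u) = decode_map (\<nu> (fst v)) (snd v))" for u v
  have rel_trans: "rel u v" if "rel u w" "rel v w" for u v w
    using that by (simp add: rel_def)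
  \<comment> \<open>The chosen representative depends only on the class, so its code names the
    class; doubling and the last bit give the number the parity shared by the members.\<close>
  define r where "r u = 2 * prod_encode (SOME v. v \<in> U \<and> rel u v) + (if even (snd u) then 0 else 1)" for u
  have even_r: "even (r u) = even (snd u)" for u by (simp add: r_def)
  have rel_r: "r u = r v" if "rel u v" for u v
  proof -
    have "rel u w \<longleftrightarrow> rel v w" for w using that by (auto simp: rel_def)
    moreover have "even (snd u) = even (snd v)" using that by (simp add: rel_def)
    ultimately show ?thesis by (simp add: r_def)
  qed
  have r_rel: "rel u v" if "r u = r v" "u \<in> U" "v \<in> U" for u v
  proof -
    have par: "even (snd u) = even (snd v)" using that(1) even_r by metis
    then have "prod_encode (SOME w. w \<in> U \<and> rel u w) = prod_encode (SOME w. w \<in> U \<and> rel v w)"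
      using that(1) unfolding r_def par by simp
    then have eq: "(SOME w. w \<in> U \<and> rel u w) = (SOME w. w \<in> U \<and> rel v w)"
      unfolding prod_encode_eq .
    have refl: "rel w w" for w by (simp add: rel_def)
    have "rel w (SOME x. x \<in> U \<and> rel w x)" if "w \<in> U" for w
      by (rule conjunct2[OF someI[of "\<lambda>x. x \<in> U \<and> rel w x", OF conjI[OF that refl]]])
    from this[OF that(2)] this[OF that(3)] show ?thesis unfolding eq by (rule rel_trans)
  qed
  obtain L :: 'u where L: "decode_set L = r ` U"
    by (rule decode_set_surj[OF finite_imageI[OF finU]])
  define \<pi> :: "nat \<Rightarrow> 'u" where "\<pi> j = code_map (\<lambda>i\<in>decode_set (Fo T j). r (j, i))" for j
  have \<pi>: "\<pi> j \<in> Hom ?M L (Fo T j)" "\<And>i. i \<in> decode_set (Fo T j) \<Longrightarrow> decode_map (\<pi> j) i = r (j, i)"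
    if "j \<in> Obj J" for j
  proof -
    have *: "r (j, i) \<in> decode_set L" "even (r (j, i)) = even i" if "i \<in> decode_set (Fo T j)" for i
      using that \<open>j \<in> Obj J\<close> by (auto simp: L U_def even_r)
    show "\<pi> j \<in> Hom ?M L (Fo T j)" "\<And>i. i \<in> decode_set (Fo T j) \<Longrightarrow> decode_map (\<pi> j) i = r (j, i)"
      unfolding \<pi>_def by (rule parity_code_apply[where a=L]; use * in simp)+
  qed
  have "is_limit J ?M T L \<pi>"
    unfolding is_limit_def
  proof (intro conjI allI impI)
    show "is_cone J ?M T L \<pi>"
      unfolding is_cone_def
    proof (intro conjI ballI)
      fix i j k assume *: "i \<in> Obj J" "j \<in> Obj J" "k \<in> Hom J i j"
      note Tk = functorD(2)[OF T *]
      show "Comp ?M L (Fo T i) (Fo T j) (Fm T i j k) (\<pi> i) = \<pi> j"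
      proof (rule parity_eqI[OF parity_Comp_in[OF \<pi>(1)[OF *(1)] Tk] \<pi>(1)[OF *(2)]])
        fix x assume x: "x \<in> decode_set (Fo T j)"
        have "rel (i, decode_map (Fm T i j k) x) (j, x)"
          unfolding rel_def fst_conv snd_conv
        proof (intro conjI allI impI)
          show "even (decode_map (Fm T i j k) x) = even x" by (rule parity_Hom_apply(2)[OF Tk x])
          fix N \<nu> assume N: "is_cone J ?M T N \<nu>"
          show "decode_map (\<nu> i) (decode_map (Fm T i j k) x) = decode_map (\<nu> j) x"
            using parity_Comp_apply[OF coneD(2)[OF N *(1)] Tk x] coneD(3)[OF N *] by simp
        qed
        from rel_r[OF this]
        show "decode_map (Comp ?M L (Fo T i) (Fo T j) (Fm T i j k) (\<pi> i)) x = decode_map (\<pi> j) x"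
          using parity_Comp_apply[OF \<pi>(1)[OF *(1)] Tk x] \<pi>(2)[OF *(1)] \<pi>(2)[OF *(2) x] parity_Hom_apply(1)[OF Tk x] by simp
      qed
    qed (simp_all add: \<pi>)
    fix N \<nu> assume N: "is_cone J ?M T N \<nu>"
    \<comment> \<open>Equal values of \<open>r\<close> mean related elements, on which the cone
      \<open>\<nu>\<close> agrees; hence any preimage may be chosen.\<close>
    define g where "g l = (let u = (SOME u. u \<in> U \<and> r u = l) in decode_map (\<nu> (fst u)) (snd u))" for l
    have g: "g (r (j, i)) = decode_map (\<nu> j) i" if "j \<in> Obj J" "i \<in> decode_set (Fo T j)" for j i
    proof -
      let ?u = "SOME u. u \<in> U \<and> r u = r (j, i)"
      have ji: "(j, i) \<in> U" using that by (simp add: U_def)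
      have "?u \<in> U \<and> r ?u = r (j, i)" by (rule someI[of _ "(j, i)"]) (use ji in simp)
      then have "rel ?u (j, i)" using r_rel ji by blast
      then show ?thesis unfolding g_def Let_def rel_def using N by simp
    qed
    have g2: "g l \<in> decode_set N" "even (g l) = even l" if l: "l \<in> decode_set L" for l
    proof -
      obtain j i where ji: "j \<in> Obj J" "i \<in> decode_set (Fo T j)" "l = r (j, i)" using l by (auto simp: L U_def)
      show "g l \<in> decode_set N" "even (g l) = even l"
        using g[OF ji(1,2)] parity_Hom_apply[OF coneD(2)[OF N ji(1)] ji(2)] ji(3) even_r[of "(j, i)"] by simp_all
    qed
    let ?h = "code_map (\<lambda>l\<in>decode_set L. g l) :: 'u"
    have h: "?h \<in> Hom ?M N L" "\<And>l. l \<in> decode_set L \<Longrightarrow> decode_map ?h l = g l"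
      by (rule parity_code_apply[where a=N]; use g2 in simp)+
    have iff: "(\<forall>j\<in>Obj J. Comp ?M N L (Fo T j) (\<pi> j) k = \<nu> j) \<longleftrightarrow>
        (\<forall>j\<in>Obj J. \<forall>i\<in>decode_set (Fo T j). decode_map k (r (j, i)) = decode_map (\<nu> j) i)"
      if k: "k \<in> Hom ?M N L" for k
    proof -
      have "Comp ?M N L (Fo T j) (\<pi> j) k = \<nu> j \<longleftrightarrow>
        (\<forall>i\<in>decode_set (Fo T j). decode_map k (r (j, i)) = decode_map (\<nu> j) i)" if j: "j \<in> Obj J" for j
      proof -
        have "decode_map (Comp ?M N L (Fo T j) (\<pi> j) k) i = decode_map k (r (j, i))" if "i \<in> decode_set (Fo T j)" for i
          using parity_Comp_apply[OF k \<pi>(1)[OF j] that] \<pi>(2)[OF j that] by simp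
        then show ?thesis
          using parity_eqI[OF parity_Comp_in[OF k \<pi>(1)[OF j]] coneD(2)[OF N j]] by metis
      qed
      then show ?thesis by (auto cong: ball_cong)
    qed
    show "\<exists>!h. h \<in> Hom ?M N L \<and> (\<forall>j\<in>Obj J. Comp ?M N L (Fo T j) (\<pi> j) h = \<nu> j)"
    proof (rule ex1I[of _ ?h], intro conjI)
      show "?h \<in> Hom ?M N L" by (rule h(1))
      show "\<forall>j\<in>Obj J. Comp ?M N L (Fo T j) (\<pi> j) ?h = \<nu> j"
        unfolding iff[OF h(1)]
      proof (intro ballI)
        fix j i assume ji: "j \<in> Obj J" "i \<in> decode_set (Fo T j)"
        then have "r (j, i) \<in> decode_set L" by (auto simp: L U_def)
        from h(2)[OF this] show "decode_map ?h (r (j, i)) = decode_map (\<nu> j) i" using g[OF ji] by simp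
      qed
      fix k assume k: "k \<in> Hom ?M N L \<and> (\<forall>j\<in>Obj J. Comp ?M N L (Fo T j) (\<pi> j) k = \<nu> j)"
      then have kin: "k \<in> Hom ?M N L" by simp
      show "k = ?h"
      proof (rule parity_eqI[OF kin h(1)])
        fix l assume l: "l \<in> decode_set L"
        then obtain j i where ji: "j \<in> Obj J" "i \<in> decode_set (Fo T j)" "l = r (j, i)" by (auto simp: L U_def)
        show "decode_map k l = decode_map ?h l"
          using h(2)[OF l] g[OF ji(1,2)] ji k iff[OF kin] by simp
      qed
    qed
  qed
  then show "\<exists>L \<pi>. is_limit J ?M T L \<pi>" by blast
qed


text \<open>An element \<open>l\<close> outside all the images could be moved to a fresh element of
  the same parity without any projection noticing, against uniqueness of the factorization.\<close>

lemma parity_limit_surj: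
  assumes T: "is_functor J (parity_cat :: ('u::set_universe, 'u) cat) T"
    and L: "is_limit J parity_cat T L \<pi>" and l: "l \<in> decode_set L"
  obtains j i where "j \<in> Obj J" "i \<in> decode_set (Fo T j)" "decode_map (\<pi> j) i = l"
proof (rule ccontr)
  interpret M: categ "parity_cat :: ('u, 'u) cat"
    using category_parity by (simp add: categ_def)
  assume not: "\<not> thesis"
  note found = that
  have no: "decode_map (\<pi> j) i \<noteq> l" if "j \<in> Obj J" "i \<in> decode_set (Fo T j)" for j i
    using not found[OF that] by blast
  note c = coneD[OF limit_cone[OF L]]
  \<comment> \<open>Adding an even number larger than the maximum keeps the parity and leaves the
    set.\<close>
  define m where "m = l + 2 * Suc (Max (decode_set L))"
  have m: "m \<notin> decode_set L" "even m = even l"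
  proof
    assume "m \<in> decode_set L"
    from Max_ge[OF finite_decode_set this] show False by (simp add: m_def)
  qed (simp add: m_def)
  obtain N :: 'u where N: "decode_set N = insert m (decode_set L)"
    by (rule decode_set_surj[of "insert m (decode_set L)"]) simp_all
  define f :: 'u where "f = code_map (\<lambda>i\<in>decode_set L. i)"
  define g :: 'u where "g = code_map (\<lambda>i\<in>decode_set L. if i = l then m else i)"
  have f: "f \<in> Hom parity_cat N L" "\<And>i. i \<in> decode_set L \<Longrightarrow> decode_map f i = i"
    unfolding f_def by (rule parity_code_apply[where a=N]; simp add: N)+
  have g: "g \<in> Hom parity_cat N L" "\<And>i. i \<in> decode_set L \<Longrightarrow> decode_map g i = (if i = l then m else i)"
    unfolding g_def by (rule parity_code_apply[where a=N]; use m l in \<open>simp add: N\<close>)+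
  have "f = g"
  proof (rule M.limit_hom_eq[OF T L Obj_parity f(1) g(1)])
    fix j assume j: "j \<in> Obj J"
    show "Comp parity_cat N L (Fo T j) (\<pi> j) f = Comp parity_cat N L (Fo T j) (\<pi> j) g"
    proof (rule parity_eqI[OF parity_Comp_in[OF f(1) c(2)[OF j]] parity_Comp_in[OF g(1) c(2)[OF j]]])
      fix i assume i: "i \<in> decode_set (Fo T j)"
      show "decode_map (Comp parity_cat N L (Fo T j) (\<pi> j) f) i = decode_map (Comp parity_cat N L (Fo T j) (\<pi> j) g) i"
        using parity_Comp_apply[OF f(1) c(2)[OF j] i] parity_Comp_apply[OF g(1) c(2)[OF j] i]
          f(2) g(2) parity_Hom_apply(1)[OF c(2)[OF j] i] no[OF j i] by simp
    qed
  qed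
  then have "l = m" using f(2)[OF l] g(2)[OF l] by simp
  then show False using m l by simp
qed

text \<open>
  A limit in \<open>parity_cat\<close> is a colimit of sets with respect to arbitrary targets, because the
  image of a finite set is finite and can be coded by numbers of the right parity.
\<close>

lemma parity_limit_desc:
  fixes J :: "(nat, nat) cat"
  assumes J: "finite_category J" and T: "is_functor J (parity_cat :: ('u::set_universe, 'u) cat) T"
    and L: "is_limit J parity_cat T L \<pi>"
    and z: "\<And>i j k x. i \<in> Obj J \<Longrightarrow> j \<in> Obj J \<Longrightarrow> k \<in> Hom J i j \<Longrightarrow> x \<in> decode_set (Fo T j) \<Longrightarrow>
      z i (decode_map (Fm T i j k) x) = z j x"
  obtains w where "\<And>j x. j \<in> Obj J \<Longrightarrow> x \<in> decode_set (Fo T j) \<Longrightarrow> w (decode_map (\<pi> j) x) = z j x"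
proof -
  note c = coneD[OF limit_cone[OF L]]
  define U where "U = (SIGMA j:Obj J. decode_set (Fo T j))"
  have finU: "finite U" using J by (auto simp: U_def finite_category_def)
  then have "finite ((\<lambda>u. z (fst u) (snd u)) ` U)" by (rule finite_imageI)
  \<comment> \<open>A numbering of the finitely many values; doubled and combined with the parity
    bit it turns the family \<open>z\<close> into a cone inside \<open>parity_cat\<close>.\<close>
  then obtain n :: "_ \<Rightarrow> nat" where n: "inj_on n ((\<lambda>u. z (fst u) (snd u)) ` U)"
    by (elim exE conjE finite_imp_inj_to_nat_seg[THEN exE])
  define r where "r j x = 2 * n (z j x) + (if even x then 0 else (1::nat))" for j x
  have er: "even (r j x) = even x" for j x by (simp add: r_def)
  have rz: "z j x = z i y" if "r j x = r i y" "(j, x) \<in> U" "(i, y) \<in> U" for j x i y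
  proof -
    have "even x = even y" using that(1) er by metis
    then have "n (z j x) = n (z i y)" using that(1) by (auto simp: r_def split: if_splits)
    then show ?thesis
      using inj_onD[OF n, of "z j x" "z i y"] that(2,3) by force
  qed
  obtain N :: 'u where N: "decode_set N = (\<lambda>u. r (fst u) (snd u)) ` U"
    by (rule decode_set_surj[OF finite_imageI[OF finU]])
  have rN: "r j x \<in> decode_set N" if "j \<in> Obj J" "x \<in> decode_set (Fo T j)" for j x
    using that unfolding N U_def by force
  define \<nu> :: "nat \<Rightarrow> 'u" where "\<nu> j = code_map (\<lambda>x\<in>decode_set (Fo T j). r j x)" for j
  have \<nu>: "\<nu> j \<in> Hom parity_cat N (Fo T j)" "\<And>x. x \<in> decode_set (Fo T j) \<Longrightarrow> decode_map (\<nu> j) x = r j x"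
    if "j \<in> Obj J" for j
    unfolding \<nu>_def by (rule parity_code_apply[where a=N]; use that rN er in simp)+
  have "is_cone J parity_cat T N \<nu>"
    unfolding is_cone_def
  proof (intro conjI ballI)
    fix i j k assume *: "i \<in> Obj J" "j \<in> Obj J" "k \<in> Hom J i j"
    note Tk = functorD(2)[OF T *]
    show "Comp parity_cat N (Fo T i) (Fo T j) (Fm T i j k) (\<nu> i) = \<nu> j"
    proof (rule parity_eqI[OF parity_Comp_in[OF \<nu>(1)[OF *(1)] Tk] \<nu>(1)[OF *(2)]])
      fix x assume x: "x \<in> decode_set (Fo T j)"
      have "r i (decode_map (Fm T i j k) x) = r j x"
        using z[OF * x] parity_Hom_apply(2)[OF Tk x] by (simp add: r_def)
      then show "decode_map (Comp parity_cat N (Fo T i) (Fo T j) (Fm T i j k) (\<nu> i)) x = decode_map (\<nu> j) x"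
        using parity_Comp_apply[OF \<nu>(1)[OF *(1)] Tk x] \<nu>(2)[OF *(1) parity_Hom_apply(1)[OF Tk x]] \<nu>(2)[OF *(2) x] by simp
    qed
  qed (simp_all add: \<nu>)
  from limit_factor[OF L this] obtain h where h: "h \<in> Hom parity_cat N L"
    "\<And>j. j \<in> Obj J \<Longrightarrow> Comp parity_cat N L (Fo T j) (\<pi> j) h = \<nu> j" by blast
  have hr: "decode_map h (decode_map (\<pi> j) x) = r j x" if "j \<in> Obj J" "x \<in> decode_set (Fo T j)" for j x
    using parity_Comp_apply[OF h(1) c(2)[OF that(1)] that(2)] h(2)[OF that(1)] \<nu>(2)[OF that] by simp
  \<comment> \<open>Off the images of the \<open>\<pi> j\<close> the value is arbitrary; on them the
    factorization \<open>h\<close> shows that the choice of preimage is immaterial.\<close>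
  define w where "w l = (let u = (SOME u. u \<in> U \<and> decode_map (\<pi> (fst u)) (snd u) = l) in z (fst u) (snd u))" for l
  have "w (decode_map (\<pi> j) x) = z j x" if jx: "j \<in> Obj J" "x \<in> decode_set (Fo T j)" for j x
  proof -
    let ?P = "\<lambda>u. u \<in> U \<and> decode_map (\<pi> (fst u)) (snd u) = decode_map (\<pi> j) x"
    define u where "u = (SOME u. ?P u)"
    have jxU: "(j, x) \<in> U" using jx by (simp add: U_def)
    have "?P u"
      unfolding u_def by (rule someI[of ?P "(j, x)"]) (simp add: jxU)
    then have u: "u \<in> U" "decode_map (\<pi> (fst u)) (snd u) = decode_map (\<pi> j) x" by blast+
    have uO: "fst u \<in> Obj J" "snd u \<in> decode_set (Fo T (fst u))" using u(1) by (auto simp: U_def)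
    have "r (fst u) (snd u) = r j x" using hr[OF uO] hr[OF jx] u(2) by simp
    then have "z (fst u) (snd u) = z j x"
      by (rule rz) (simp_all add: jxU u(1))
    then show ?thesis unfolding w_def u_def[symmetric] Let_def .
  qed
  then show ?thesis by (rule that)
qed

text \<open>Only the products of copies of \<open>A True\<close> and \<open>A False\<close> are
  assumed to exist. Arrows into the product over a limit are families indexed by its elements, and
  by the two preceding lemmas these are the same as compatible families over the diagram.\<close>

lemma (in categ) parity_lex_functor:
  fixes A :: "bool \<Rightarrow> 'o"
  assumes A: "\<And>b. A b \<in> Obj C"
    and G: "\<And>s. finite s \<Longrightarrow> G s \<in> Obj C"
    and pr: "\<And>s i. finite s \<Longrightarrow> i \<in> s \<Longrightarrow> pr s i \<in> Hom C (G s) (A (even i))"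
    and prod: "\<And>s Z z. finite s \<Longrightarrow> Z \<in> Obj C \<Longrightarrow> (\<And>i. i \<in> s \<Longrightarrow> z i \<in> Hom C Z (A (even i))) \<Longrightarrow>
      \<exists>!h. h \<in> Hom C Z (G s) \<and> (\<forall>i\<in>s. Comp C Z (G s) (A (even i)) (pr s i) h = z i)"
  obtains D where "lex_functor (parity_cat :: ('u::set_universe, 'u) cat) C D" "\<And>a. Fo D a = G (decode_set a)"
proof -
  let ?M = "parity_cat :: ('u, 'u) cat"
  let ?G = "\<lambda>a :: 'u. G (decode_set a)" and ?pr = "\<lambda>a :: 'u. pr (decode_set a)"
  note G' [simp] = G[OF finite_decode_set]
  note pr' [simp] = pr[OF finite_decode_set] and prod' = prod[OF finite_decode_set]
  have eq: "h = h'"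
    if "Z \<in> Obj C" "h \<in> Hom C Z (?G a)" "h' \<in> Hom C Z (?G a)"
      "\<And>i. i \<in> decode_set a \<Longrightarrow> Comp C Z (?G a) (A (even i)) (?pr a i) h = Comp C Z (?G a) (A (even i)) (?pr a i) h'"
    for Z h h' and a :: 'u
    by (rule Ex1_unique[OF prod'[OF that(1), of a "\<lambda>i. Comp C Z (?G a) (A (even i)) (?pr a i) h"]])
      (use that A in auto)
  define m where "m a b v = (THE h. h \<in> Hom C (?G a) (?G b) \<and>
      (\<forall>i\<in>decode_set b. Comp C (?G a) (?G b) (A (even i)) (?pr b i) h = ?pr a (decode_map v i)))" for a b v :: 'u
  have m: "m a b v \<in> Hom C (?G a) (?G b)"
    "\<And>i. i \<in> decode_set b \<Longrightarrow> Comp C (?G a) (?G b) (A (even i)) (?pr b i) (m a b v) = ?pr a (decode_map v i)"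
    if v: "v \<in> Hom ?M a b" for a b v
  proof -
    have pv: "?pr a (decode_map v i) \<in> Hom C (?G a) (A (even i))" if "i \<in> decode_set b" for i
      using pr'[of "decode_map v i" a] parity_Hom_apply[OF v that] by simp
    have "\<exists>!h. h \<in> Hom C (?G a) (?G b) \<and>
      (\<forall>i\<in>decode_set b. Comp C (?G a) (?G b) (A (even i)) (?pr b i) h = ?pr a (decode_map v i))"
      by (rule prod'[OF G']) (rule pv)
    from theI'[OF this]
    show "m a b v \<in> Hom C (?G a) (?G b)"
      "\<And>i. i \<in> decode_set b \<Longrightarrow> Comp C (?G a) (?G b) (A (even i)) (?pr b i) (m a b v) = ?pr a (decode_map v i)"
      by (simp_all add: m_def)
  qed
  define D where "D = \<lparr>Fo = ?G, Fm = m\<rparr>"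
  have D: "is_functor ?M C D"
    unfolding is_functor_def
  proof (intro conjI ballI)
    fix a b v assume v: "v \<in> Hom ?M a b"
    show "Fm D a b v \<in> Hom C (Fo D a) (Fo D b)" using m(1)[OF v] by (simp add: D_def)
  next
    fix a :: 'u
    have "m a a (Id ?M a) = Id C (?G a)"
      by (rule eq[OF G' m(1)[OF parity_Id_in] Id_in[OF G']])
        (simp add: m(2)[OF parity_Id_in] parity_Id_apply A)
    then show "Fm D a a (Id ?M a) = Id C (Fo D a)" by (simp add: D_def)
  next
    fix a b c f g assume f: "f \<in> Hom ?M a b" and g: "g \<in> Hom ?M b c"
    have "m a c (Comp ?M a b c g f) = Comp C (?G a) (?G b) (?G c) (m b c g) (m a b f)"
    proof (rule eq[OF G' m(1)[OF parity_Comp_in[OF f g]]])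
      show "Comp C (?G a) (?G b) (?G c) (m b c g) (m a b f) \<in> Hom C (?G a) (?G c)"
        using m(1)[OF f] m(1)[OF g] by simp
      fix i assume i: "i \<in> decode_set c"
      have gi: "decode_map g i \<in> decode_set b" "even (decode_map g i) = even i"
        using parity_Hom_apply[OF g i] by auto
      have "Comp C (?G a) (?G c) (A (even i)) (?pr c i) (Comp C (?G a) (?G b) (?G c) (m b c g) (m a b f)) =
          Comp C (?G a) (?G b) (A (even i)) (?pr b (decode_map g i)) (m a b f)"
        using Comp_assoc[OF m(1)[OF f] m(1)[OF g] pr'[OF i] G' G' G' A] m(2)[OF g i] by simp
      also have "\<dots> = ?pr a (decode_map f (decode_map g i))"
        using m(2)[OF f gi(1)] gi(2) by simp
      finally show "Comp C (?G a) (?G c) (A (even i)) (?pr c i) (m a c (Comp ?M a b c g f)) =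
        Comp C (?G a) (?G c) (A (even i)) (?pr c i) (Comp C (?G a) (?G b) (?G c) (m b c g) (m a b f))"
        using m(2)[OF parity_Comp_in[OF f g] i] parity_Comp_apply[OF f g i] by simp
    qed
    then show "Fm D a c (Comp ?M a b c g f) = Comp C (Fo D a) (Fo D b) (Fo D c) (Fm D b c g) (Fm D a b f)"
      by (simp add: D_def)
  qed (simp add: D_def)
  have "lex_functor ?M C D"
    unfolding lex_functor_def
  proof (intro conjI allI impI)
    fix J :: "(nat, nat) cat" and T L \<pi>
    assume "finite_category J \<and> is_functor J ?M T \<and> is_limit J ?M T L \<pi>"
    then have J: "finite_category J" and T: "is_functor J ?M T" and L: "is_limit J ?M T L \<pi>" by blast+
    note c = coneD[OF limit_cone[OF L]]
    let ?T = "functor_comp D T" and ?\<pi> = "\<lambda>j. Fm D L (Fo T j) (\<pi> j)"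
    have FoT: "Fo ?T j = ?G (Fo T j)" "Fo D L = ?G L" for j by (simp_all add: functor_comp_def D_def)
    have \<pi>m: "?\<pi> j = m L (Fo T j) (\<pi> j)" for j by (simp add: D_def)
    show "is_limit J C ?T (Fo D L) ?\<pi>"
      unfolding is_limit_def FoT
    proof (intro conjI allI impI)
      show "is_cone J C ?T (?G L) ?\<pi>"
        unfolding is_cone_def FoT
      proof (intro conjI ballI)
        fix i j k assume *: "i \<in> Obj J" "j \<in> Obj J" "k \<in> Hom J i j"
        have "Fm D L (Fo T j) (\<pi> j) = Comp C (Fo D L) (Fo D (Fo T i)) (Fo D (Fo T j)) (Fm D (Fo T i) (Fo T j) (Fm T i j k)) (Fm D L (Fo T i) (\<pi> i))"
          using functorD(4)[OF D Obj_parity Obj_parity Obj_parity c(2)[OF *(1)] functorD(2)[OF T *]] c(3)[OF *] by simp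
        then show "Comp C (?G L) (?G (Fo T i)) (?G (Fo T j)) (Fm ?T i j k) (?\<pi> i) = ?\<pi> j"
          by (simp add: functor_comp_def D_def)
      qed (use m(1)[OF c(2)] in \<open>simp_all add: \<pi>m\<close>)
      fix Z \<zeta> assume Z: "is_cone J C ?T Z \<zeta>"
      have \<zeta>: "\<zeta> j \<in> Hom C Z (?G (Fo T j))" if "j \<in> Obj J" for j
        using coneD(2)[OF Z that] by (simp add: FoT)
      note ZO = coneD(1)[OF Z]
      define z where "z j x = Comp C Z (?G (Fo T j)) (A (even x)) (?pr (Fo T j) x) (\<zeta> j)" for j x
      have zin: "z j x \<in> Hom C Z (A (even x))" if "j \<in> Obj J" "x \<in> decode_set (Fo T j)" for j x
        unfolding z_def using \<zeta> ZO A that by simp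
      have zc: "z i (decode_map (Fm T i j k) x) = z j x"
        if *: "i \<in> Obj J" "j \<in> Obj J" "k \<in> Hom J i j" and x: "x \<in> decode_set (Fo T j)" for i j k x
      proof -
        note Tk = functorD(2)[OF T *]
        have "Comp C Z (?G (Fo T i)) (?G (Fo T j)) (m (Fo T i) (Fo T j) (Fm T i j k)) (\<zeta> i) = \<zeta> j"
          using coneD(3)[OF Z *] by (simp add: functor_comp_def D_def)
        then have "z j x = Comp C Z (?G (Fo T j)) (A (even x)) (?pr (Fo T j) x) (Comp C Z (?G (Fo T i)) (?G (Fo T j)) (m (Fo T i) (Fo T j) (Fm T i j k)) (\<zeta> i))"
          by (simp add: z_def)
        also have "\<dots> = Comp C Z (?G (Fo T i)) (A (even x)) (?pr (Fo T i) (decode_map (Fm T i j k) x)) (\<zeta> i)"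
          using Comp_assoc[OF \<zeta>[OF *(1)] m(1)[OF Tk] pr'[OF x] ZO G' G' A] m(2)[OF Tk x] by simp
        finally show ?thesis using parity_Hom_apply(2)[OF Tk x] by (simp add: z_def)
      qed
      \<comment> \<open>The components of \<open>\<zeta>\<close> agree along the diagram, so they
        descend to a single family on the elements of the limit.\<close>
      obtain w where w: "\<And>j x. j \<in> Obj J \<Longrightarrow> x \<in> decode_set (Fo T j) \<Longrightarrow> w (decode_map (\<pi> j) x) = z j x"
        using parity_limit_desc[of J T L \<pi> z, OF J T L zc] by blast
      have win: "w l \<in> Hom C Z (A (even l))" if l: "l \<in> decode_set L" for l
      proof -
        obtain j x where jx: "j \<in> Obj J" "x \<in> decode_set (Fo T j)" "decode_map (\<pi> j) x = l"
          by (rule parity_limit_surj[OF T L l])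
        show ?thesis using w[OF jx(1,2)] zin[OF jx(1,2)] parity_Hom_apply(2)[OF c(2)[OF jx(1)] jx(2)] jx(3) by simp
      qed
      have iff: "(\<forall>j\<in>Obj J. Comp C Z (?G L) (?G (Fo T j)) (?\<pi> j) h = \<zeta> j) \<longleftrightarrow>
          (\<forall>l\<in>decode_set L. Comp C Z (?G L) (A (even l)) (?pr L l) h = w l)" (is "?l \<longleftrightarrow> ?r")
        if h: "h \<in> Hom C Z (?G L)" for h
      proof -
        have key: "Comp C Z (?G (Fo T j)) (A (even x)) (?pr (Fo T j) x) (Comp C Z (?G L) (?G (Fo T j)) (?\<pi> j) h)
            = Comp C Z (?G L) (A (even x)) (?pr L (decode_map (\<pi> j) x)) h"
          if "j \<in> Obj J" "x \<in> decode_set (Fo T j)" for j x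
          using Comp_assoc[OF h m(1)[OF c(2)[OF that(1)]] pr'[OF that(2)] ZO G' G' A] m(2)[OF c(2)[OF that(1)] that(2)]
          by (simp add: \<pi>m)
        show ?thesis
        proof
          assume l: ?l
          show ?r
          proof
            fix l assume "l \<in> decode_set L"
            then obtain j x where jx: "j \<in> Obj J" "x \<in> decode_set (Fo T j)" "decode_map (\<pi> j) x = l"
              by (rule parity_limit_surj[OF T L])
            have "even l = even x" using parity_Hom_apply(2)[OF c(2)[OF jx(1)] jx(2)] jx(3) by simp
            then show "Comp C Z (?G L) (A (even l)) (?pr L l) h = w l"
              using key[OF jx(1,2)] l jx(1) w[OF jx(1,2)] jx(3) by (simp add: z_def)
          qed
        next
          assume r: ?r
          show ?l
          proof
            fix j assume j: "j \<in> Obj J"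
            show "Comp C Z (?G L) (?G (Fo T j)) (?\<pi> j) h = \<zeta> j"
            proof (rule eq[OF ZO _ \<zeta>[OF j]])
              show "Comp C Z (?G L) (?G (Fo T j)) (?\<pi> j) h \<in> Hom C Z (?G (Fo T j))"
                unfolding \<pi>m by (rule Comp_in[OF h m(1)[OF c(2)[OF j]] ZO G' G'])
              fix x assume x: "x \<in> decode_set (Fo T j)"
              have px: "decode_map (\<pi> j) x \<in> decode_set L" "even (decode_map (\<pi> j) x) = even x"
                using parity_Hom_apply[OF c(2)[OF j] x] by auto
              show "Comp C Z (?G (Fo T j)) (A (even x)) (?pr (Fo T j) x) (Comp C Z (?G L) (?G (Fo T j)) (?\<pi> j) h) =
                  Comp C Z (?G (Fo T j)) (A (even x)) (?pr (Fo T j) x) (\<zeta> j)"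
                unfolding key[OF j x] using bspec[OF r px(1)] px(2) w[OF j x] by (simp add: z_def)
            qed
          qed
        qed
      qed
      have "\<exists>!h. h \<in> Hom C Z (?G L) \<and> (\<forall>l\<in>decode_set L. Comp C Z (?G L) (A (even l)) (?pr L l) h = w l)"
        by (rule prod'[OF ZO]) (rule win)
      then show "\<exists>!h. h \<in> Hom C Z (?G L) \<and> (\<forall>j\<in>Obj J. Comp C Z (?G L) (?G (Fo T j)) (?\<pi> j) h = \<zeta> j)"
        using iff by (simp cong: conj_cong)
    qed
  qed (rule D)
  then show ?thesis by (rule that) (simp add: D_def)
qed


section \<open>The lex-colimit completion consists of the finite coproducts of representables\<close>

definition discrete_cat :: "nat set \<Rightarrow> (nat, nat) cat" where
  "discrete_cat s = \<lparr>Obj = s, Hom = (\<lambda>i j. if i = j then {0} else {}), Id = (\<lambda>_. 0), Comp = (\<lambda>_ _ _ _ _. 0)\<rparr>"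

lemma finite_category_discrete: "finite s \<Longrightarrow> finite_category (discrete_cat s)"
  by (simp add: finite_category_def category_def discrete_cat_def)

lemma (in categ) is_functor_discrete:
  assumes "\<And>i. i \<in> s \<Longrightarrow> B i \<in> Obj C"
  shows "is_functor (discrete_cat s) C \<lparr>Fo = B, Fm = (\<lambda>i j k. Id C (B i))\<rparr>"
  using assms by (simp add: is_functor_def discrete_cat_def)

lemma (in categ) discrete_limit_product:
  assumes B: "\<And>i. i \<in> s \<Longrightarrow> B i \<in> Obj C"
    and L: "is_limit (discrete_cat s) C \<lparr>Fo = B, Fm = (\<lambda>i j k. Id C (B i))\<rparr> L \<pi>"
    and Z: "Z \<in> Obj C" "\<And>i. i \<in> s \<Longrightarrow> z i \<in> Hom C Z (B i)"
  shows "\<exists>!h. h \<in> Hom C Z L \<and> (\<forall>i\<in>s. Comp C Z L (B i) (\<pi> i) h = z i)"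
proof -
  have "is_cone (discrete_cat s) C \<lparr>Fo = B, Fm = (\<lambda>i j k. Id C (B i))\<rparr> Z z"
    using B Z by (simp add: is_cone_def discrete_cat_def)
  from limit_Ex1[OF L this] show ?thesis by (simp add: discrete_cat_def)
qed

lemma (in categ) finitely_complete_terminal:
  assumes "finitely_complete C"
  obtains t where "t \<in> Obj C" "\<And>X. X \<in> Obj C \<Longrightarrow> \<exists>!f. f \<in> Hom C X t"
proof -
  let ?T = "\<lparr>Fo = undefined, Fm = (\<lambda>i j k. Id C (undefined i))\<rparr>"
  have T: "is_functor (discrete_cat {}) C ?T" by (rule is_functor_discrete) simp
  then obtain t \<pi> where L: "is_limit (discrete_cat {}) C ?T t \<pi>"
    using assms finite_category_discrete[of "{}"] unfolding finitely_complete_def by blast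
  have "\<exists>!f. f \<in> Hom C X t" if "X \<in> Obj C" for X
    using discrete_limit_product[OF _ L that, of undefined] by simp
  with coneD(1)[OF limit_cone[OF L]] show ?thesis by (rule that)
qed

lemma (in categ) product_singleton_iso:
  assumes L: "L \<in> Obj C" "p \<in> Hom C L B" and B: "B \<in> Obj C"
    and prod: "\<And>Z z. Z \<in> Obj C \<Longrightarrow> z \<in> Hom C Z B \<Longrightarrow> \<exists>!h. h \<in> Hom C Z L \<and> Comp C Z L B p h = z"
  shows "is_iso C L B p"
proof -
  obtain q where q: "q \<in> Hom C B L" "Comp C B L B p q = Id C B"
    using prod[OF B Id_in[OF B]] by blast
  have "Comp C L B L q p = Id C L"
    by (rule Ex1_unique[OF prod[OF L]]) (use L B q Comp_assoc[OF L(2) q(1) L(2)] in auto)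
  then show ?thesis using q L by (auto simp: is_iso_def)
qed

lemma (in categ) is_iso_comp:
  assumes f: "is_iso C X Y f" and g: "is_iso C Y Z g" and O: "X \<in> Obj C" "Y \<in> Obj C" "Z \<in> Obj C"
  shows "is_iso C X Z (Comp C X Y Z g f)"
proof -
  obtain f' where f': "f \<in> Hom C X Y" "f' \<in> Hom C Y X" "Comp C X Y X f' f = Id C X" "Comp C Y X Y f f' = Id C Y"
    using f unfolding is_iso_def by blast
  obtain g' where g': "g \<in> Hom C Y Z" "g' \<in> Hom C Z Y" "Comp C Y Z Y g' g = Id C Y" "Comp C Z Y Z g g' = Id C Z"
    using g unfolding is_iso_def by blast
  have "Comp C X Z X (Comp C Z Y X f' g') (Comp C X Y Z g f) = Id C X"
    using Comp_assoc[OF f'(1) g'(1) g'(2) O O(2)] f' g' O by simp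
  moreover have "Comp C Z X Z (Comp C X Y Z g f) (Comp C Z Y X f' g') = Id C Z"
    using Comp_assoc[OF g'(2) f'(2) f'(1) O(3,2,1,2)] f' g' O by simp
  ultimately show ?thesis
    using f' g' O unfolding is_iso_def by blast
qed

text \<open>Puts the weights into the form of universal elements, in which they are used from here
  on. The initial presheaf is the sum over the empty index set.\<close>

lemma lext_classE:
  assumes "is_lext_class \<Phi>"
  obtains K0 \<phi>0 u0 K2 X Y \<phi>2 u2 where "\<Phi> = {(K0, \<phi>0), (K2, \<phi>2)}"
    "ls_categ K0" "ls_categ K2" "\<phi>0 \<in> Obj (psh_cat K0)" "\<phi>2 \<in> Obj (psh_cat K2)"
    "free_lex_on_pair K2 X Y"
    "ls_categ.ufam K0 \<phi>0 ({} :: bool set) (\<lambda>_. undefined) u0"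
    "ls_categ.ufam K2 \<phi>2 (UNIV :: bool set) (\<lambda>b. if b then X else Y) u2"
proof -
  obtain K0 \<phi>0 K2 X Y \<phi>2 \<iota> where \<Phi>: "\<Phi> = {(K0, \<phi>0), (K2, \<phi>2)}" and lw: "\<forall>w\<in>\<Phi>. lex_weight w"
    and \<phi>0: "is_initial (psh_cat K0) \<phi>0" and free: "free_lex_on_pair K2 X Y"
    and \<phi>2: "is_coproduct (psh_cat K2) (UNIV :: bool set)
      (\<lambda>b. if b then representable K2 X else representable K2 Y) \<phi>2 \<iota>"
    using assms unfolding is_lext_class_def by blast
  have "lex_weight (K0, \<phi>0)" "lex_weight (K2, \<phi>2)" using lw \<Phi> by auto
  then have K: "ls_categ K0" "ls_categ K2" "\<phi>0 \<in> Obj (psh_cat K0)" "\<phi>2 \<in> Obj (psh_cat K2)"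
    by (auto simp: lex_weight_def small_category_def ls_categ_def ls_categ_axioms_def categ_def)
  interpret K0: ls_categ K0 by fact
  interpret K2: ls_categ K2 by fact
  have "is_coproduct (psh_cat K0) ({} :: bool set) (\<lambda>b. representable K0 undefined) \<phi>0 undefined"
    using \<phi>0 by (simp add: is_coproduct_def is_initial_def)
  then obtain u0 where u0: "K0.ufam \<phi>0 ({} :: bool set) (\<lambda>_. undefined) u0"
    by (rule K0.coproduct_ufam) auto
  have "(\<lambda>b. if b then representable K2 X else representable K2 Y) = (\<lambda>b. representable K2 (if b then X else Y))"
    by auto
  then have "is_coproduct (psh_cat K2) (UNIV :: bool set) (\<lambda>b. representable K2 (if b then X else Y)) \<phi>2 \<iota>"
    using \<phi>2 by simp
  then obtain u2 where u2: "K2.ufam \<phi>2 (UNIV :: bool set) (\<lambda>b. if b then X else Y) u2"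
    by (rule K2.coproduct_ufam) (use free in \<open>auto simp: free_lex_on_pair_def\<close>)
  show ?thesis
    by (rule that[OF \<Phi> K free u0 u2])
qed

lemma lext_sum_weight:
  assumes "is_lext_class \<Phi>" "w \<in> \<Phi>"
  shows "sum_weight w"
proof -
  obtain K0 \<phi>0 u0 K2 X Y \<phi>2 u2 where *: "\<Phi> = {(K0, \<phi>0), (K2, \<phi>2)}"
    "ls_categ K0" "ls_categ K2" "\<phi>0 \<in> Obj (psh_cat K0)" "\<phi>2 \<in> Obj (psh_cat K2)"
    "free_lex_on_pair K2 X Y"
    "ls_categ.ufam K0 \<phi>0 ({} :: bool set) (\<lambda>_. undefined) u0"
    "ls_categ.ufam K2 \<phi>2 (UNIV :: bool set) (\<lambda>b. if b then X else Y) u2"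
    by (rule lext_classE[OF assms(1)])
  have s0: "sum_weight (K0, \<phi>0)"
    unfolding sum_weight_def fst_conv snd_conv by (intro conjI exI) (rule * )+
  have s2: "sum_weight (K2, \<phi>2)"
    unfolding sum_weight_def fst_conv snd_conv by (intro conjI exI) (rule * )+
  have "w \<in> {(K0, \<phi>0), (K2, \<phi>2)}"
    using assms(2) unfolding *(1) .
  then show ?thesis
    by (elim insertE emptyE) (simp_all only: s0 s2)
qed

section \<open>Every closed class contains the finite sums of representables\<close>

lemma lex_closed_limit:
  assumes "lex_closed \<Phi> C S" "finite_category J" "is_functor J (small_psh_cat C) T"
    and "\<And>j. j \<in> Obj J \<Longrightarrow> Fo T j \<in> S" "is_limit J (small_psh_cat C) T L \<pi>"
  shows "L \<in> S"
  using assms unfolding lex_closed_def by blast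

lemma lex_closed_colimit:
  assumes "lex_closed \<Phi> C S" "(K, \<phi>) \<in> \<Phi>" "lex_functor K (small_psh_cat C) D"
    and "\<And>k. k \<in> Obj K \<Longrightarrow> Fo D k \<in> S" "is_weighted_colimit K \<phi> (small_psh_cat C) D L \<eta>"
  shows "L \<in> S"
  using assms unfolding lex_closed_def by blast

context ls_categ
begin

lemma Hom_small_psh_cat [simp]: "Hom (small_psh_cat C) = Hom (psh_cat C)"
  and Id_small_psh_cat [simp]: "Id (small_psh_cat C) = Id (psh_cat C)"
  and Comp_small_psh_cat [simp]: "Comp (small_psh_cat C) = Comp (psh_cat C)"
  by (simp_all add: small_psh_cat_def)

text \<open>Freeness of \<open>K\<close> gives a lex functor to \<open>parity_cat\<close> that meets
  codes of \<open>{0}\<close> and \<open>{1}\<close> up to isomorphism; the diagram is its composite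
  with the product functor. All values are finite products of the \<open>A b\<close>, hence lie in
  \<open>S\<close>, which is closed under finite limits.\<close>

lemma fams_lex_diagram:
  fixes K :: "('u, 'u) cat"
  assumes fc: "finitely_complete C" and free: "free_lex_on_pair K X Y"
    and S: "lex_closed \<Phi> C S" and A: "\<And>b. A b \<in> fams" "\<And>b. A b \<in> S"
  obtains D \<alpha> \<beta> where "lex_functor K (small_psh_cat C) D" "\<And>k. k \<in> Obj K \<Longrightarrow> Fo D k \<in> S"
    "is_iso (small_psh_cat C) (Fo D X) (A True) \<alpha>" "is_iso (small_psh_cat C) (Fo D Y) (A False) \<beta>"
proof -
  let ?E = "small_psh_cat C"
  let ?M = "parity_cat :: ('u, 'u) cat"
  interpret E: categ ?E
    by (rule categ_psh_sub[OF small_pshs_psh, folded small_psh_cat_eq])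
  have AE: "A b \<in> Obj ?E" for b using A(1) fams_small by blast
  let ?T = "\<lparr>Fo = (\<lambda>i :: nat. A (even i)), Fm = (\<lambda>i j k. Id ?E (A (even i)))\<rparr>"
  have T: "is_functor (discrete_cat s) ?E ?T" for s
    by (rule E.is_functor_discrete) (rule AE)
  have "\<exists>L \<pi>. is_limit (discrete_cat s) ?E ?T L \<pi>" if s: "finite s" for s
  proof -
    obtain L \<pi> where "is_limit (discrete_cat s) ?E ?T L \<pi>"
      by (rule fams_limit_exists[OF small_pshs_psh fams_small fc, folded small_psh_cat_eq,
            OF finite_category_discrete[OF s] T])
        (use A in auto)
    then show ?thesis by blast
  qed
  then obtain G pr where G: "\<And>s. finite s \<Longrightarrow> is_limit (discrete_cat s) ?E ?T (G s) (pr s)"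
    by metis
  have GS: "G s \<in> S" if "finite s" for s
    by (rule lex_closed_limit[OF S finite_category_discrete[OF that] T _ G[OF that]]) (simp add: A(2))
  have GE: "G s \<in> Obj ?E" if "finite s" for s
    using coneD(1)[OF limit_cone[OF G[OF that]]] .
  have pr: "pr s i \<in> Hom ?E (G s) (A (even i))" if "finite s" "i \<in> s" for s i
    using coneD(2)[OF limit_cone[OF G[OF that(1)]], of i] that(2) by (simp add: discrete_cat_def)
  have prod: "\<exists>!h. h \<in> Hom ?E Z (G s) \<and> (\<forall>i\<in>s. Comp ?E Z (G s) (A (even i)) (pr s i) h = z i)"
    if "finite s" "Z \<in> Obj ?E" "\<And>i. i \<in> s \<Longrightarrow> z i \<in> Hom ?E Z (A (even i))" for s Z z
    by (rule E.discrete_limit_product[OF _ G[OF that(1)] that(2,3)]) (rule AE)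
  obtain D where D: "lex_functor ?M ?E D" "\<And>a. Fo D a = G (decode_set a)"
    by (rule E.parity_lex_functor[where A=A and G=G and pr=pr, OF AE GE pr prod]) blast+
  have Df: "is_functor ?M ?E D" using D(1) by (simp add: lex_functor_def)
  have single: "is_iso ?E (G {n}) (A (even n)) (pr {n} n)" for n
  proof (rule E.product_singleton_iso[OF GE pr AE])
    fix Z z assume "Z \<in> Obj ?E" "z \<in> Hom ?E Z (A (even n))"
    then show "\<exists>!h. h \<in> Hom ?E Z (G {n}) \<and> Comp ?E Z (G {n}) (A (even n)) (pr {n} n) h = z"
      using prod[of "{n}" Z "\<lambda>_. z"] by simp
  qed simp_all
  obtain x y :: 'u where xy: "decode_set x = {0}" "decode_set y = {1}"
    using decode_set_surj[of "{0}"] decode_set_surj[of "{1}"] by (metis finite.emptyI finite.insertI)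
  have "\<exists>F. lex_functor K ?M F \<and> isomorphic ?M (Fo F X) x \<and> isomorphic ?M (Fo F Y) y"
    using free category_parity locally_small_parity finitely_complete_parity Obj_parity
    unfolding free_lex_on_pair_def by blast
  then obtain F f g where F: "lex_functor K ?M F" "is_iso ?M (Fo F X) x f" "is_iso ?M (Fo F Y) y g"
    unfolding isomorphic_def by blast
  have f: "is_iso ?E (G (decode_set (Fo F X))) (G {0}) (Fm D (Fo F X) x f)"
    using functor_is_iso[OF Df Obj_parity Obj_parity F(2)] by (simp add: D(2) xy)
  have g: "is_iso ?E (G (decode_set (Fo F Y))) (G {1}) (Fm D (Fo F Y) y g)"
    using functor_is_iso[OF Df Obj_parity Obj_parity F(3)] by (simp add: D(2) xy)
  show ?thesis
  proof
    show "lex_functor K ?E (functor_comp D F)" by (rule lex_functor_comp[OF F(1) D(1)])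
    show "Fo (functor_comp D F) k \<in> S" for k
      by (simp add: functor_comp_def D(2) GS)
    show "is_iso ?E (Fo (functor_comp D F) X) (A True)
      (Comp ?E (G (decode_set (Fo F X))) (G {0}) (A True) (pr {0} 0) (Fm D (Fo F X) x f))"
      using E.is_iso_comp[OF f, of "A True" "pr {0} 0"] single[of 0] GE AE by (simp add: functor_comp_def D(2))
    show "is_iso ?E (Fo (functor_comp D F) Y) (A False)
      (Comp ?E (G (decode_set (Fo F Y))) (G {1}) (A False) (pr {1} 1) (Fm D (Fo F Y) y g))"
      using E.is_iso_comp[OF g, of "A False" "pr {1} 1"] single[of 1] GE AE by (simp add: functor_comp_def D(2))
  qed
qed

text \<open>Induction on the index set: the initial weight produces the empty sum, and the binary
  weight adds one representable to a sum already reached.\<close>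

lemma fams_subset_lex_closed:
  assumes fc: "finitely_complete C" and \<Phi>: "is_lext_class \<Phi>" and S: "lex_closed \<Phi> C S"
  shows "fams \<subseteq> S"
proof -
  let ?E = "small_psh_cat C"
  interpret P: categ "psh_cat C" using category_psh by (simp add: categ_def)
  obtain K0 \<phi>0 u0 K2 X Y \<phi>2 u2 where \<Phi>eq: "\<Phi> = {(K0, \<phi>0), (K2, \<phi>2)}"
    and K: "ls_categ K0" "ls_categ K2" "\<phi>0 \<in> Obj (psh_cat K0)" "\<phi>2 \<in> Obj (psh_cat K2)"
    and free: "free_lex_on_pair K2 X Y"
    and u0: "ls_categ.ufam K0 \<phi>0 ({} :: bool set) (\<lambda>_. undefined) u0"
    and u2: "ls_categ.ufam K2 \<phi>2 (UNIV :: bool set) (\<lambda>b. if b then X else Y) u2"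
    by (rule lext_classE[OF \<Phi>])
  note colim = lex_closed_colimit[OF S]
  have rep: "representable C B \<in> S" if "B \<in> Obj C" for B
    using S that unfolding lex_closed_def by blast
  have "F \<in> S" if "finite I" "psh F" "ufam F I A e" for I :: "nat set" and F A e
    using that
  proof (induction I arbitrary: F e rule: finite_induct)
    case empty
    have FE: "F \<in> small_pshs" using famsI[OF empty(1) _ empty(2)] fams_small by blast
    obtain t where t: "t \<in> Obj C" "\<And>X. X \<in> Obj C \<Longrightarrow> \<exists>!f. f \<in> Hom C X t"
      using finitely_complete_terminal[OF fc] by blast
    let ?t = "representable C t"
    have tE: "?t \<in> small_pshs" using representable_fams[OF t(1)] fams_small by blast
    have ex_to_t: "\<exists>h. h \<in> Hom (psh_cat C) M ?t" if "psh M" for M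
    proof (rule exI, rule mk_nat_in[OF that, of "\<lambda>X x. THE f. f \<in> Hom C X t"])
      show th: "(THE f. f \<in> Hom C X t) \<in> Fo ?t X" if "X \<in> Obj C" for X
        using theI'[OF t(2)[OF that]] by simp
      show "(THE f. f \<in> Hom C Y t) = Fm ?t X Y f (THE f. f \<in> Hom C X t)"
        if "X \<in> Obj C" "Y \<in> Obj C" "f \<in> Hom C Y X" for X Y f
        by (rule Ex1_unique[OF t(2)[OF that(2)]])
          (use th[OF that(1)] th[OF that(2)] act_in[OF psh_representable[OF t(1)] th[OF that(1)] that(3,1,2)] in simp_all)
    qed
    have to_t_eq: "h = h'" if M: "h \<in> Hom (psh_cat C) M ?t" "h' \<in> Hom (psh_cat C) M ?t" for M h h'
    proof (rule nat_eqI[OF M])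
      fix X x assume "X \<in> Obj C" "x \<in> Fo M X"
      then show "h X x = h' X x"
        using Ex1_unique[OF t(2), of X "h X x" "h' X x"] nat_in[OF M(1)] nat_in[OF M(2)] by simp
    qed
    \<comment> \<open>The initial weight still needs a lex diagram with values in \<open>S\<close>.
      The constant one at the representable of a terminal object qualifies, since any cone
      consisting of identities of a terminal presheaf is a limit.\<close>
    let ?D = "\<lparr>Fo = (\<lambda>_. ?t), Fm = (\<lambda>_ _ _. Id (psh_cat C) ?t)\<rparr>"
    have tt: "Comp (psh_cat C) ?t ?t ?t (Id (psh_cat C) ?t) (Id (psh_cat C) ?t) = Id (psh_cat C) ?t"
      using P.Comp_Id_right[OF P.Id_in] t(1) by blast
    have Df: "is_functor K0 ?E ?D"
      unfolding is_functor_def using tE tt Id_psh_in[OF psh_representable[OF t(1)]] by simp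
    have "lex_functor K0 ?E ?D"
      unfolding lex_functor_def
    proof (intro conjI allI impI)
      fix J :: "(nat, nat) cat" and T L \<pi>
      show "is_limit J ?E (functor_comp ?D T) (Fo ?D L) (\<lambda>j. Fm ?D L (Fo T j) (\<pi> j))"
        unfolding is_limit_def
      proof (intro conjI allI impI)
        show "is_cone J ?E (functor_comp ?D T) (Fo ?D L) (\<lambda>j. Fm ?D L (Fo T j) (\<pi> j))"
          unfolding is_cone_def using tE tt Id_psh_in[OF psh_representable[OF t(1)]]
          by (simp add: functor_comp_def)
        fix M \<mu> assume M: "is_cone J ?E (functor_comp ?D T) M \<mu>"
        have MP: "psh M" using coneD(1)[OF M] small_pshs_psh by blast
        have \<mu>: "\<mu> j \<in> Hom (psh_cat C) M ?t" if "j \<in> Obj J" for j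
          using coneD(2)[OF M that] by (simp add: functor_comp_def)
        obtain h where h: "h \<in> Hom (psh_cat C) M ?t" using ex_to_t[OF MP] by blast
        have "Comp (psh_cat C) M ?t ?t (Id (psh_cat C) ?t) h = \<mu> j" if "j \<in> Obj J" for j
          using P.Comp_Id_left[OF h MP psh_representable[OF t(1)]] to_t_eq[OF h \<mu>[OF that]] by simp
        then show "\<exists>!h. h \<in> Hom ?E M (Fo ?D L) \<and>
            (\<forall>j\<in>Obj J. Comp ?E M (Fo ?D L) (Fo (functor_comp ?D T) j) (Fm ?D L (Fo T j) (\<pi> j)) h = \<mu> j)"
          using h to_t_eq by (auto simp: functor_comp_def)
      qed
    qed (rule Df)
    obtain \<eta> where "is_weighted_colimit K0 \<phi>0 ?E ?D F \<eta>"
      by (rule sum_weighted_colimit[OF K(1,3) u0 small_pshs_psh, folded small_psh_cat_eq, OF Df _ _ FE])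
        (use empty(2) in auto)
    then show ?case
      by (rule colim[OF _ \<open>lex_functor K0 ?E ?D\<close>, rotated 2]) (simp_all add: \<Phi>eq rep[OF t(1)])
  next
    case (insert i I)
    note uF = insert.prems(2)
    have Ai: "A i \<in> Obj C" "\<And>j. j \<in> I \<Longrightarrow> A j \<in> Obj C" using ufamD(1)[OF uF] by auto
    have FE: "F \<in> small_pshs" using famsI[OF insert.prems(1) _ uF] insert.hyps(1) fams_small by blast
    obtain F1 e1 where F1: "psh F1" "F1 \<in> fams" "ufam F1 I A e1"
      by (rule ufam_exists[of I A]) (use insert.hyps(1) Ai in auto)
    define B where "B b = (if b then F1 else representable C (A i))" for b
    have B: "B b \<in> fams" "B b \<in> S" for b
      using F1 insert.IH[OF F1(1,3)] Ai(1) rep by (auto simp: B_def)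
    obtain D \<alpha> \<beta> where D: "lex_functor K2 ?E D" "\<And>k. k \<in> Obj K2 \<Longrightarrow> Fo D k \<in> S"
      "is_iso ?E (Fo D X) (B True) \<alpha>" "is_iso ?E (Fo D Y) (B False) \<beta>"
      by (rule fams_lex_diagram[where A=B, OF fc free S B]) blast+
    have Df: "is_functor K2 ?E D" using D(1) by (simp add: lex_functor_def)
    have XY: "X \<in> Obj K2" "Y \<in> Obj K2" using free by (auto simp: free_lex_on_pair_def)
    have DE: "Fo D X \<in> small_pshs" "Fo D Y \<in> small_pshs" using functorD(1)[OF Df] XY by auto
    have BE: "B b \<in> small_pshs" for b using B(1) fams_small by blast
    have uB: "ufam (B True) I A e1" "ufam (B False) {i} A (\<lambda>_. Id C (A i))"
      using F1(3) ufam_cong[OF ufam_representable[OF Ai(1), of i], of A] by (auto simp: B_def)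
    \<comment> \<open>Freeness prescribes the values at \<open>X\<close> and \<open>Y\<close> only
      up to isomorphism, so the universal elements have to be carried over to the actual values of
      \<open>D\<close>.\<close>
    obtain eX where eX: "ufam (Fo D X) I A eX"
      by (rule ufam_iso_transfer[OF uB(1) _ _ small_pshs_psh, folded small_psh_cat_eq, OF _ _ BE DE(1) D(3)])
        (use BE DE small_pshs_psh in blast)+
    obtain eY where eY: "ufam (Fo D Y) {i} A eY"
      by (rule ufam_iso_transfer[OF uB(2) _ _ small_pshs_psh, folded small_psh_cat_eq, OF _ _ BE DE(2) D(4)])
        (use BE DE small_pshs_psh in blast)+
    let ?I = "\<lambda>b. if b then I else {i}"
    have uD: "ufam (Fo D (if b then X else Y)) (?I b) A (if b then eX else eY)" for b
      using eX eY by simp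
    have uF': "ufam F (\<Union>b\<in>(UNIV :: bool set). ?I b) A e"
      using uF by (simp add: UNIV_bool)
    have disj: "?I b \<inter> ?I c = {}" if "b \<noteq> c" for b c
      using that insert.hyps(2) by auto
    obtain \<eta> where "is_weighted_colimit K2 \<phi>2 ?E D F \<eta>"
      by (rule sum_weighted_colimit[OF K(2,4) u2 small_pshs_psh, folded small_psh_cat_eq, OF Df uD disj FE uF'])
    then show ?case
      by (rule colim[OF _ D(1,2), rotated 2]) (simp_all add: \<Phi>eq)
  qed
  then show ?thesis by (auto simp: fams_def)
qed

lemma Phi_l_eq_fams:
  assumes "finitely_complete C" "is_lext_class \<Phi>"
  shows "Phi_l \<Phi> C = full_subcat (psh_cat C) fams"
proof -
  have "\<Inter>{S. lex_closed \<Phi> C S} = fams"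
    using lex_closed_fams[OF assms(1) lext_sum_weight[OF assms(2)]] fams_subset_lex_closed[OF assms] by blast
  then show ?thesis by (simp add: Phi_l_def small_psh_cat_def)
qed

end


section \<open>Pullbacks as limits\<close>

text \<open>Object 2 is the corner that receives arrows from 0 and 1. Each hom-set has at most one
  arrow, always coded by 0, so the category laws are trivial.\<close>

definition cospan_cat :: "(nat, nat) cat" where
  "cospan_cat = \<lparr>Obj = {0, 1, 2}, Hom = (\<lambda>i j. if i = j \<or> j = 2 then {0} else {}), Id = (\<lambda>_. 0),
     Comp = (\<lambda>_ _ _ _ _. 0)\<rparr>"

definition cospan :: "('o, 'm) cat \<Rightarrow> 'o \<Rightarrow> 'o \<Rightarrow> 'o \<Rightarrow> 'm \<Rightarrow> 'm \<Rightarrow> (nat, nat, 'o, 'm) functr" where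
  "cospan C X Y Z f g = \<lparr>Fo = (\<lambda>i. if i = 0 then X else if i = 1 then Y else Z),
     Fm = (\<lambda>i j k. if i = 0 then if j = 0 then Id C X else f
                   else if i = 1 then if j = 1 then Id C Y else g else Id C Z)\<rparr>"

lemma finite_category_cospan: "finite_category cospan_cat"
  by (auto simp: finite_category_def category_def cospan_cat_def)

lemma is_pullbackD:
  assumes "is_pullback C X Y Z f g P p q"
  shows "P \<in> Obj C" "p \<in> Hom C P X" "q \<in> Hom C P Y" "Comp C P X Z f p = Comp C P Y Z g q"
  using assms by (simp_all add: is_pullback_def)

lemma pullback_Ex1:
  assumes "is_pullback C X Y Z f g P p q" "Q \<in> Obj C" "a \<in> Hom C Q X" "b \<in> Hom C Q Y"
    and "Comp C Q X Z f a = Comp C Q Y Z g b"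
  shows "\<exists>!h. h \<in> Hom C Q P \<and> Comp C Q P X p h = a \<and> Comp C Q P Y q h = b"
  using assms by (simp add: is_pullback_def)

context categ
begin

lemma is_functor_cospan:
  assumes "X \<in> Obj C" "Y \<in> Obj C" "Z \<in> Obj C" "f \<in> Hom C X Z" "g \<in> Hom C Y Z"
  shows "is_functor cospan_cat C (cospan C X Y Z f g)"
  using assms by (auto simp: is_functor_def cospan_cat_def cospan_def)

lemma pullback_limit:
  assumes O: "X \<in> Obj C" "Y \<in> Obj C" "Z \<in> Obj C" and fg: "f \<in> Hom C X Z" "g \<in> Hom C Y Z"
    and P: "is_pullback C X Y Z f g P p q"
  shows "is_limit cospan_cat C (cospan C X Y Z f g) P
    (\<lambda>i. if i = 0 then p else if i = 1 then q else Comp C P X Z f p)"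
  unfolding is_limit_def
proof (intro conjI allI impI)
  note p = is_pullbackD[OF P]
  show "is_cone cospan_cat C (cospan C X Y Z f g) P
    (\<lambda>i. if i = 0 then p else if i = 1 then q else Comp C P X Z f p)"
    using O fg p by (auto simp: is_cone_def cospan_cat_def cospan_def)
  fix M \<mu> assume M: "is_cone cospan_cat C (cospan C X Y Z f g) M \<mu>"
  have m: "M \<in> Obj C" "\<mu> 0 \<in> Hom C M X" "\<mu> 1 \<in> Hom C M Y"
    "Comp C M X Z f (\<mu> 0) = \<mu> 2" "Comp C M Y Z g (\<mu> 1) = \<mu> 2"
    using coneD[OF M] coneD(2)[OF M, of 0] coneD(2)[OF M, of 1] coneD(3)[OF M, of 0 2 0] coneD(3)[OF M, of 1 2 0]
    by (auto simp: cospan_cat_def cospan_def)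
  have "\<exists>!h. h \<in> Hom C M P \<and> Comp C M P X p h = \<mu> 0 \<and> Comp C M P Y q h = \<mu> 1"
    using pullback_Ex1[OF P m(1-3)] m(4,5) by simp
  moreover have "(\<forall>j\<in>Obj cospan_cat. Comp C M P (Fo (cospan C X Y Z f g) j)
        (if j = 0 then p else if j = 1 then q else Comp C P X Z f p) h = \<mu> j) \<longleftrightarrow>
      Comp C M P X p h = \<mu> 0 \<and> Comp C M P Y q h = \<mu> 1" if h: "h \<in> Hom C M P" for h
    using Comp_assoc[OF h p(2) fg(1) m(1) p(1) O(1,3)] m(4) by (auto simp: cospan_cat_def cospan_def)
  ultimately show "\<exists>!h. h \<in> Hom C M P \<and> (\<forall>j\<in>Obj cospan_cat. Comp C M P (Fo (cospan C X Y Z f g) j)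
        (if j = 0 then p else if j = 1 then q else Comp C P X Z f p) h = \<mu> j)"
    by (simp cong: conj_cong)
qed

lemma limit_pullback:
  assumes T: "is_functor cospan_cat C T" and L: "is_limit cospan_cat C T P \<pi>"
  shows "is_pullback C (Fo T 0) (Fo T 1) (Fo T 2) (Fm T 0 2 0) (Fm T 1 2 0) P (\<pi> 0) (\<pi> 1)"
proof -
  have J: "(0::nat) \<in> Obj cospan_cat" "(1::nat) \<in> Obj cospan_cat" "(2::nat) \<in> Obj cospan_cat"
    "(0::nat) \<in> Hom cospan_cat 0 2" "(0::nat) \<in> Hom cospan_cat 1 2"
    by (auto simp: cospan_cat_def)
  note c = coneD[OF limit_cone[OF L]]
  note TO = functorD(1)[OF T J(1)] functorD(1)[OF T J(2)] functorD(1)[OF T J(3)]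
    and Tm = functorD(2)[OF T J(1,3,4)] functorD(2)[OF T J(2,3,5)]
  show ?thesis
    unfolding is_pullback_def
  proof (intro conjI ballI impI)
    show "P \<in> Obj C" "\<pi> 0 \<in> Hom C P (Fo T 0)" "\<pi> 1 \<in> Hom C P (Fo T 1)"
      using c(1) c(2)[OF J(1)] c(2)[OF J(2)] .
    show "Comp C P (Fo T 0) (Fo T 2) (Fm T 0 2 0) (\<pi> 0) = Comp C P (Fo T 1) (Fo T 2) (Fm T 1 2 0) (\<pi> 1)"
      using c(3)[OF J(1,3,4)] c(3)[OF J(2,3,5)] by simp
    fix Q a b assume Q: "Q \<in> Obj C" "a \<in> Hom C Q (Fo T 0)" "b \<in> Hom C Q (Fo T 1)"
      "Comp C Q (Fo T 0) (Fo T 2) (Fm T 0 2 0) a = Comp C Q (Fo T 1) (Fo T 2) (Fm T 1 2 0) b"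
    let ?\<mu> = "\<lambda>j::nat. if j = 0 then a else if j = 1 then b else Comp C Q (Fo T 0) (Fo T 2) (Fm T 0 2 0) a"
    have "Fm T i i 0 = Id C (Fo T i)" if "i \<in> Obj cospan_cat" for i
      using functorD(3)[OF T that] by (simp add: cospan_cat_def)
    then have "is_cone cospan_cat C T Q ?\<mu>"
      using Q TO Tm by (auto simp: is_cone_def cospan_cat_def)
    from limit_Ex1[OF L this]
    have ex: "\<exists>!h. h \<in> Hom C Q P \<and> (\<forall>j\<in>Obj cospan_cat. Comp C Q P (Fo T j) (\<pi> j) h = ?\<mu> j)" .
    have iff: "(\<forall>j\<in>Obj cospan_cat. Comp C Q P (Fo T j) (\<pi> j) h = ?\<mu> j) \<longleftrightarrow>
        Comp C Q P (Fo T 0) (\<pi> 0) h = a \<and> Comp C Q P (Fo T 1) (\<pi> 1) h = b" if h: "h \<in> Hom C Q P" for h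
      using Comp_assoc[OF h c(2)[OF J(1)] Tm(1) Q(1) c(1) TO(1,3)] c(3)[OF J(1,3,4)]
      by (auto simp: cospan_cat_def)
    show "\<exists>!h. h \<in> Hom C Q P \<and> Comp C Q P (Fo T 0) (\<pi> 0) h = a \<and> Comp C Q P (Fo T 1) (\<pi> 1) h = b"
      using ex iff by (simp cong: conj_cong)
  qed
qed

lemma finitely_complete_pullback:
  assumes "finitely_complete C"
    and O: "X \<in> Obj C" "Y \<in> Obj C" "Z \<in> Obj C" "f \<in> Hom C X Z" "g \<in> Hom C Y Z"
  obtains P p q where "is_pullback C X Y Z f g P p q"
proof -
  note T = is_functor_cospan[OF O]
  obtain P \<pi> where "is_limit cospan_cat C (cospan C X Y Z f g) P \<pi>"
    using assms(1) T finite_category_cospan unfolding finitely_complete_def by blast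
  from limit_pullback[OF T this] show ?thesis by (intro that) (simp add: cospan_def)
qed

lemma lex_pullback:
  assumes D: "categ D" and L: "lex_functor C D L"
    and O: "X \<in> Obj C" "Y \<in> Obj C" "Z \<in> Obj C" "f \<in> Hom C X Z" "g \<in> Hom C Y Z"
    and P: "is_pullback C X Y Z f g P p q"
  shows "is_pullback D (Fo L X) (Fo L Y) (Fo L Z) (Fm L X Z f) (Fm L Y Z g) (Fo L P) (Fm L P X p) (Fm L P Y q)"
proof -
  interpret D: categ D by fact
  let ?T = "cospan C X Y Z f g"
  let ?\<pi> = "\<lambda>i::nat. if i = 0 then p else if i = 1 then q else Comp C P X Z f p"
  have T: "is_functor cospan_cat C ?T" by (rule is_functor_cospan[OF O])
  have "is_limit cospan_cat D (functor_comp L ?T) (Fo L P) (\<lambda>j. Fm L P (Fo ?T j) (?\<pi> j))"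
    using L T finite_category_cospan pullback_limit[OF O P] unfolding lex_functor_def by blast
  moreover have "is_functor cospan_cat D (functor_comp L ?T)"
    using is_functor_comp[OF T] L unfolding lex_functor_def by blast
  ultimately show ?thesis
    using D.limit_pullback[of "functor_comp L ?T"] by (fastforce simp: functor_comp_def cospan_def)
qed

text \<open>Stability applied to the empty coproduct: there is no pullback to supply, so every
  object with an arrow to \<open>S\<close> is again an empty coproduct.\<close>

lemma initial_strict:
  assumes "coproducts_stable C" "is_initial C S" "Z \<in> Obj C" "f \<in> Hom C Z S"
  shows "is_initial C Z"
proof -
  have "is_coproduct C ({} :: nat set) undefined S undefined"
    using assms(2) by (simp add: is_coproduct_def is_initial_def)
  then have "is_coproduct C ({} :: nat set) undefined Z undefined"
    using assms(1)[unfolded coproducts_stable_def, rule_format, of "{}" undefined S undefined Z f undefined undefined undefined]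
      assms(3,4) by simp
  then show ?thesis by (simp add: is_coproduct_def is_initial_def)
qed

end

text \<open>The unique elements provided by \<open>pb\<close> assemble to a transformation, because
  restriction preserves the two equations that determine them.\<close>

lemma (in ls_categ) pointwise_pullback:
  assumes S: "S \<subseteq> Obj (psh_cat C)" and O: "F \<in> S" "G \<in> S" "H \<in> S" "P \<in> S"
    and m: "\<phi> \<in> Hom (psh_cat C) F H" "\<psi> \<in> Hom (psh_cat C) G H" "p \<in> Hom (psh_cat C) P F" "q \<in> Hom (psh_cat C) P G"
    and comm: "Comp (psh_cat C) P F H \<phi> p = Comp (psh_cat C) P G H \<psi> q"
    and pb: "\<And>X x y. X \<in> Obj C \<Longrightarrow> x \<in> Fo F X \<Longrightarrow> y \<in> Fo G X \<Longrightarrow> \<phi> X x = \<psi> X y \<Longrightarrow>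
      \<exists>!z. z \<in> Fo P X \<and> p X z = x \<and> q X z = y"
  shows "is_pullback (full_subcat (psh_cat C) S) F G H \<phi> \<psi> P p q"
  unfolding is_pullback_def Obj_full_subcat Hom_full_subcat Comp_full_subcat
proof (intro conjI ballI impI)
  have psh: "psh F" "psh G" "psh H" "psh P" using S O by auto
  fix Q a b assume Q: "Q \<in> S" and a: "a \<in> Hom (psh_cat C) Q F" and b: "b \<in> Hom (psh_cat C) Q G"
    and eq: "Comp (psh_cat C) Q F H \<phi> a = Comp (psh_cat C) Q G H \<psi> b"
  have Qp: "psh Q" using Q S by auto
  have ex: "\<exists>!z. z \<in> Fo P X \<and> p X z = a X w \<and> q X z = b X w" if "X \<in> Obj C" "w \<in> Fo Q X" for X w
  proof (rule pb[OF that(1) nat_in[OF a that(2,1)] nat_in[OF b that(2,1)]])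
    show "\<phi> X (a X w) = \<psi> X (b X w)"
      using fun_cong[OF fun_cong[OF eq, of X], of w] that by simp
  qed
  define h where "h = mk_nat Q (\<lambda>X w. THE z. z \<in> Fo P X \<and> p X z = a X w \<and> q X z = b X w)"
  have h: "h X w \<in> Fo P X" "p X (h X w) = a X w" "q X (h X w) = b X w" if "X \<in> Obj C" "w \<in> Fo Q X" for X w
    using theI'[OF ex[OF that]] that by (simp_all add: h_def)
  have hin: "h \<in> Hom (psh_cat C) Q P"
    unfolding h_def
  proof (rule mk_nat_in[OF Qp])
    fix X w assume X: "X \<in> Obj C" "w \<in> Fo Q X"
    show "(THE z. z \<in> Fo P X \<and> p X z = a X w \<and> q X z = b X w) \<in> Fo P X"
      using theI'[OF ex[OF X]] by blast
    fix Y f assume Y: "Y \<in> Obj C" "f \<in> Hom C Y X"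
    have w': "Fm Q X Y f w \<in> Fo Q Y" by (rule act_in[OF Qp X(2) Y(2) X(1) Y(1)])
    have "Fm P X Y f (h X w) \<in> Fo P Y \<and> p Y (Fm P X Y f (h X w)) = a Y (Fm Q X Y f w) \<and> q Y (Fm P X Y f (h X w)) = b Y (Fm Q X Y f w)"
      using h[OF X] nat_act[OF m(3) psh(4) _ Y(2) X(1) Y(1)] nat_act[OF m(4) psh(4) _ Y(2) X(1) Y(1)]
        nat_act[OF a Qp X(2) Y(2) X(1) Y(1)] nat_act[OF b Qp X(2) Y(2) X(1) Y(1)] psh(4) X Y by simp
    then have "h Y (Fm Q X Y f w) = Fm P X Y f (h X w)"
      using Ex1_unique[OF ex[OF Y(1) w'], of "h Y (Fm Q X Y f w)"] h[OF Y(1) w'] by simp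
    then show "(THE z. z \<in> Fo P Y \<and> p Y z = a Y (Fm Q X Y f w) \<and> q Y z = b Y (Fm Q X Y f w)) =
      Fm P X Y f (THE z. z \<in> Fo P X \<and> p X z = a X w \<and> q X z = b X w)"
      using X Y w' by (simp add: h_def)
  qed
  show "\<exists>!h. h \<in> Hom (psh_cat C) Q P \<and> Comp (psh_cat C) Q P F p h = a \<and> Comp (psh_cat C) Q P G q h = b"
  proof (rule ex1I[of _ h], intro conjI)
    show "h \<in> Hom (psh_cat C) Q P" by (rule hin)
    show "Comp (psh_cat C) Q P F p h = a"
      by (rule nat_eqI[OF Comp_psh_in[OF Qp psh(4) hin m(3)] a]) (simp add: h)
    show "Comp (psh_cat C) Q P G q h = b"
      by (rule nat_eqI[OF Comp_psh_in[OF Qp psh(4) hin m(4)] b]) (simp add: h)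
    fix k assume k: "k \<in> Hom (psh_cat C) Q P \<and> Comp (psh_cat C) Q P F p k = a \<and> Comp (psh_cat C) Q P G q k = b"
    then have kin: "k \<in> Hom (psh_cat C) Q P" by blast
    show "k = h"
    proof (rule nat_eqI[OF kin hin])
      fix X w assume X: "X \<in> Obj C" "w \<in> Fo Q X"
      have "Comp (psh_cat C) Q P F p k X w = a X w" "Comp (psh_cat C) Q P G q k X w = b X w" using k by simp_all
      then have "k X w \<in> Fo P X \<and> p X (k X w) = a X w \<and> q X (k X w) = b X w"
        using X nat_in[OF kin X(2,1)] by simp
      then show "k X w = h X w"
        using Ex1_unique[OF ex[OF X], of "k X w" "h X w"] h[OF X] by simp
    qed
  qed
qed (use O m comm in auto)


section \<open>Exactness implies lextensivity\<close>

text \<open>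
  A lex left adjoint \<open>L\<close> of the restricted Yoneda embedding, with its unit
  \<open>\<eta> F : F \<rightarrow> C(-, L F)\<close>.
\<close>

locale lex_reflection = ls_categ C for C :: "('o, 'u::set_universe) cat" +
  fixes L :: "(('o, 'u) psh, 'o \<Rightarrow> 'u \<Rightarrow> 'u, 'o, 'u) functr" and \<eta> :: "('o, 'u) psh \<Rightarrow> 'o \<Rightarrow> 'u \<Rightarrow> 'u"
  assumes lex: "lex_functor (full_subcat (psh_cat C) fams) C L"
    and unit_in: "\<And>F. F \<in> fams \<Longrightarrow> \<eta> F \<in> Hom (psh_cat C) F (representable C (Fo L F))"
    and unit_nat: "\<And>F G p X x. F \<in> fams \<Longrightarrow> G \<in> fams \<Longrightarrow> p \<in> Hom (psh_cat C) F G \<Longrightarrow> X \<in> Obj C \<Longrightarrow> x \<in> Fo F X \<Longrightarrow>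
      Comp C X (Fo L F) (Fo L G) (Fm L F G p) (\<eta> F X x) = \<eta> G X (p X x)"
    and unit_univ: "\<And>F Z \<alpha>. F \<in> fams \<Longrightarrow> Z \<in> Obj C \<Longrightarrow> \<alpha> \<in> Hom (psh_cat C) F (representable C Z) \<Longrightarrow>
      \<exists>!h. h \<in> Hom C (Fo L F) Z \<and> (\<forall>X\<in>Obj C. \<forall>x\<in>Fo F X. Comp C X (Fo L F) Z h (\<eta> F X x) = \<alpha> X x)"
begin

lemma fams_psh: "F \<in> fams \<Longrightarrow> psh F"
  by (simp add: fams_def)

lemma L_functor: "is_functor (full_subcat (psh_cat C) fams) C L"
  using lex by (simp add: lex_functor_def)

lemma L_Obj: "F \<in> fams \<Longrightarrow> Fo L F \<in> Obj C"
  using functorD(1)[OF L_functor] by simp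

lemma L_Hom: "F \<in> fams \<Longrightarrow> G \<in> fams \<Longrightarrow> p \<in> Hom (psh_cat C) F G \<Longrightarrow> Fm L F G p \<in> Hom C (Fo L F) (Fo L G)"
  using functorD(2)[OF L_functor] by simp

lemma unit_Hom: "F \<in> fams \<Longrightarrow> X \<in> Obj C \<Longrightarrow> x \<in> Fo F X \<Longrightarrow> \<eta> F X x \<in> Hom C X (Fo L F)"
  using nat_in[OF unit_in] by simp

lemma unit_act:
  assumes "F \<in> fams" "X \<in> Obj C" "Y \<in> Obj C" "f \<in> Hom C Y X" "x \<in> Fo F X"
  shows "\<eta> F Y (Fm F X Y f x) = Comp C Y X (Fo L F) (\<eta> F X x) f"
  using nat_act[OF unit_in[OF assms(1)] fams_psh[OF assms(1)] assms(5,4,2,3)] unit_Hom[OF assms(1,2,5)] by simp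

text \<open>A left adjoint preserves coproducts: by the Yoneda lemma, maps from \<open>F\<close> to
  the representable at \<open>Z\<close> are families of arrows from the \<open>A i\<close> to
  \<open>Z\<close>.\<close>

lemma L_coproduct:
  assumes F: "F \<in> fams" "ufam F I A e"
  shows "is_coproduct C I A (Fo L F) (\<lambda>i. \<eta> F (A i) (e i))"
  unfolding is_coproduct_def
proof (intro conjI ballI allI impI)
  note D = ufamD[OF F(2)] note Fp = fams_psh[OF F(1)]
  show "Fo L F \<in> Obj C" by (rule L_Obj[OF F(1)])
  show "\<eta> F (A i) (e i) \<in> Hom C (A i) (Fo L F)" if "i \<in> I" for i
    by (rule unit_Hom[OF F(1) D[OF that]])
  fix Z \<mu> assume Z: "Z \<in> Obj C" and \<mu>: "\<forall>i\<in>I. \<mu> i \<in> Hom C (A i) Z"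
  obtain \<alpha> where \<alpha>: "\<alpha> \<in> Hom (psh_cat C) F (representable C Z)" "\<And>i. i \<in> I \<Longrightarrow> \<alpha> (A i) (e i) = \<mu> i"
    by (rule ufam_nat_ex[OF Fp F(2) psh_representable[OF Z], of \<mu>]) (use \<mu> in auto)
  have iff: "(\<forall>X\<in>Obj C. \<forall>x\<in>Fo F X. Comp C X (Fo L F) Z h (\<eta> F X x) = \<alpha> X x) \<longleftrightarrow>
      (\<forall>i\<in>I. Comp C (A i) (Fo L F) Z h (\<eta> F (A i) (e i)) = \<mu> i)" (is "?l \<longleftrightarrow> ?r")
    if h: "h \<in> Hom C (Fo L F) Z" for h
  proof
    assume ?l then show ?r using \<alpha>(2) D by simp
  next
    assume r: ?r
    show ?l
    proof (intro ballI)
      fix X x assume X: "X \<in> Obj C" "x \<in> Fo F X"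
      obtain i f where i: "i \<in> I" "f \<in> Hom C X (A i)" "Fm F (A i) X f (e i) = x" by (rule ufam_cases[OF F(2) X])
      note Di = D[OF i(1)]
      have "Comp C X (Fo L F) Z h (\<eta> F X x) = Comp C X (Fo L F) Z h (Comp C X (A i) (Fo L F) (\<eta> F (A i) (e i)) f)"
        using unit_act[OF F(1) Di(1) X(1) i(2) Di(2)] i(3) by simp
      also have "\<dots> = Comp C X (A i) Z (\<mu> i) f"
        using Comp_assoc[OF i(2) unit_Hom[OF F(1) Di] h X(1) Di(1) L_Obj[OF F(1)] Z] r i(1) by simp
      also have "\<dots> = \<alpha> X x"
        using nat_act[OF \<alpha>(1) Fp Di(2) i(2) Di(1) X(1)] \<alpha>(2)[OF i(1)] \<mu> i(1,3) by simp
      finally show "Comp C X (Fo L F) Z h (\<eta> F X x) = \<alpha> X x" .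
    qed
  qed
  show "\<exists>!h. h \<in> Hom C (Fo L F) Z \<and> (\<forall>i\<in>I. Comp C (A i) (Fo L F) Z h (\<eta> F (A i) (e i)) = \<mu> i)"
    using unit_univ[OF F(1) Z \<alpha>(1)] iff by (simp cong: conj_cong)
qed

section \<open>The unit at representables\<close>

definition u :: "'o \<Rightarrow> 'u" where
  "u A = \<eta> (representable C A) A (Id C A)"

lemma u_in: "A \<in> Obj C \<Longrightarrow> u A \<in> Hom C A (Fo L (representable C A))"
  unfolding u_def by (rule unit_Hom) auto

lemma unit_representable:
  assumes "A \<in> Obj C" "X \<in> Obj C" "g \<in> Hom C X A"
  shows "\<eta> (representable C A) X g = Comp C X A (Fo L (representable C A)) (u A) g"
  using unit_act[OF representable_fams[OF assms(1)] assms(1,2,3), of "Id C A"] assms by (simp add: u_def)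

text \<open>The representable at \<open>A\<close> is a sum with a single summand, so its reflection
  is a coproduct of \<open>A\<close> alone.\<close>

lemma u_iso:
  assumes A: "A \<in> Obj C"
  obtains r where "r \<in> Hom C (Fo L (representable C A)) A"
    "Comp C A (Fo L (representable C A)) A r (u A) = Id C A"
    "Comp C (Fo L (representable C A)) A (Fo L (representable C A)) (u A) r = Id C (Fo L (representable C A))"
proof -
  let ?LA = "Fo L (representable C A)"
  have LA: "?LA \<in> Obj C" by (rule L_Obj[OF representable_fams[OF A]])
  have co: "is_coproduct C {0::nat} (\<lambda>_. A) ?LA (\<lambda>_. u A)"
    using L_coproduct[OF representable_fams[OF A] ufam_representable[OF A]] by (simp add: u_def)
  obtain r where r: "r \<in> Hom C ?LA A" "Comp C A ?LA A r (u A) = Id C A"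
    using coproduct_desc[OF co A, of "\<lambda>_. Id C A"] A by auto
  have "Comp C ?LA A ?LA (u A) r = Id C ?LA"
    by (rule coproduct_hom_eq[OF co LA])
      (use r A LA u_in[OF A] Comp_assoc[OF u_in[OF A] r(1) u_in[OF A]] in auto)
  with r show ?thesis by (rule that)
qed

lemma L_has_coproducts: "has_finite_coproducts C"
  unfolding has_finite_coproducts_def
proof (intro allI impI)
  fix I :: "nat set" and A assume I: "finite I \<and> A \<in> I \<rightarrow> Obj C"
  obtain F e where "F \<in> fams" "ufam F I A e"
    by (rule ufam_exists[where I=I and A=A]) (use I in auto)
  from L_coproduct[OF this] show "\<exists>S \<iota>. is_coproduct C I A S \<iota>" by blast
qed

text \<open>Pullbacks of presheaves are computed elementwise, and there the sum \<open>F\<close> of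
  the \<open>A i\<close>, pulled back along the image of \<open>f\<close>, is the sum
  \<open>Q\<close> of the \<open>P i\<close>. \<open>L\<close> keeps this square a pullback and
  turns the map from \<open>F\<close> to the representable at \<open>S\<close> into an isomorphism.
  So its pullback is one too, which identifies \<open>L Q\<close>, the coproduct of the
  \<open>P i\<close>, with \<open>Z\<close>.\<close>

lemma L_stable: "coproducts_stable C"
  unfolding coproducts_stable_def
proof (intro allI impI, elim conjE)
  fix I :: "nat set" and A S \<iota> Z f P p q
  assume I: "finite I" "A \<in> I \<rightarrow> Obj C" and S: "is_coproduct C I A S \<iota>" and Z: "Z \<in> Obj C" and f: "f \<in> Hom C Z S"
    and pb: "\<forall>i\<in>I. is_pullback C Z (A i) S f (\<iota> i) (P i) (p i) (q i)"
  have A: "A i \<in> Obj C" if "i \<in> I" for i using I that by auto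
  have SO: "S \<in> Obj C" "\<And>i. i \<in> I \<Longrightarrow> \<iota> i \<in> Hom C (A i) S" using S by (auto simp: is_coproduct_def)
  note pD = is_pullbackD[OF bspec[OF pb]]
  obtain F e where F: "psh F" "F \<in> fams" "ufam F I A e"
    by (rule ufam_exists[where I=I and A=A]) (use I in auto)
  obtain Q e' where Q: "psh Q" "Q \<in> fams" "ufam Q I P e'"
    by (rule ufam_exists[where I=I and A=P]) (use I pD in auto)
  note eD = ufamD[OF F(3)] and e'D = ufamD[OF Q(3)]
  let ?y = "representable C"
  note yS = psh_representable[OF SO(1)] representable_fams[OF SO(1)]
    and yZ = psh_representable[OF Z] representable_fams[OF Z]
  obtain \<sigma> where \<sigma>: "\<sigma> \<in> Hom (psh_cat C) F (?y S)" "\<And>i. i \<in> I \<Longrightarrow> \<sigma> (A i) (e i) = \<iota> i"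
    "\<And>X i g. X \<in> Obj C \<Longrightarrow> i \<in> I \<Longrightarrow> g \<in> Hom C X (A i) \<Longrightarrow> \<sigma> X (Fm F (A i) X g (e i)) = Fm (?y S) (A i) X g (\<iota> i)"
    by (rule ufam_nat_ex[OF F(1,3) yS(1), of \<iota>]) (use SO in auto)
  obtain a where a: "a \<in> Hom (psh_cat C) Q (?y Z)" "\<And>i. i \<in> I \<Longrightarrow> a (P i) (e' i) = p i"
    "\<And>X i g. X \<in> Obj C \<Longrightarrow> i \<in> I \<Longrightarrow> g \<in> Hom C X (P i) \<Longrightarrow> a X (Fm Q (P i) X g (e' i)) = Fm (?y Z) (P i) X g (p i)"
    by (rule ufam_nat_ex[OF Q(1,3) yZ(1), of p]) (use pD in auto)
  have qe: "Fm F (A i) (P i) (q i) (e i) \<in> Fo F (P i)" if "i \<in> I" for i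
    using F(1) eD pD that by blast
  obtain b where b: "b \<in> Hom (psh_cat C) Q F" "\<And>i. i \<in> I \<Longrightarrow> b (P i) (e' i) = Fm F (A i) (P i) (q i) (e i)"
    "\<And>X i g. X \<in> Obj C \<Longrightarrow> i \<in> I \<Longrightarrow> g \<in> Hom C X (P i) \<Longrightarrow> b X (Fm Q (P i) X g (e' i)) = Fm F (P i) X g (Fm F (A i) (P i) (q i) (e i))"
    by (rule ufam_nat_ex[OF Q(1,3) F(1), of "\<lambda>i. Fm F (A i) (P i) (q i) (e i)"]) (use qe in auto)
  have b': "b X (Fm Q (P i) X g (e' i)) = Fm F (A i) X (Comp C X (P i) (A i) (q i) g) (e i)"
    if "X \<in> Obj C" "i \<in> I" "g \<in> Hom C X (P i)" for X i g
    using b(3)[OF that] act_Comp[OF F(1) eD(2)[OF that(2)] pD(3)[OF that(2)] that(3) eD(1)[OF that(2)] pD(1)[OF that(2)] that(1)] by simp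
  have a': "a X (Fm Q (P i) X g (e' i)) = Comp C X (P i) Z (p i) g"
    if "X \<in> Obj C" "i \<in> I" "g \<in> Hom C X (P i)" for X i g
    using a(3)[OF that] pD(2)[OF that(2)] by simp
  have \<sigma>': "\<sigma> X (Fm F (A i) X g (e i)) = Comp C X (A i) S (\<iota> i) g"
    if "X \<in> Obj C" "i \<in> I" "g \<in> Hom C X (A i)" for X i g
    using \<sigma>(3)[OF that] SO(2)[OF that(2)] by simp
  let ?yf = "Fm (yoneda C) Z S f"
  have yf: "?yf \<in> Hom (psh_cat C) (?y Z) (?y S)" by (rule yoneda_map_in[OF Z SO(1) f])
  have sq: "is_pullback (full_subcat (psh_cat C) fams) (?y Z) F (?y S) ?yf \<sigma> Q a b"
  proof (rule pointwise_pullback[OF _ yZ(2) F(2) yS(2) Q(2) yf \<sigma>(1) a(1) b(1)])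
    show "fams \<subseteq> Obj (psh_cat C)" by (auto simp: fams_def)
    show "Comp (psh_cat C) Q (?y Z) (?y S) ?yf a = Comp (psh_cat C) Q F (?y S) \<sigma> b"
    proof (rule ufam_nat_unique[OF Q(1,3) Comp_psh_in[OF Q(1) yZ(1) a(1) yf] Comp_psh_in[OF Q(1) F(1) b(1) \<sigma>(1)]])
      fix i assume i: "i \<in> I"
      show "Comp (psh_cat C) Q (?y Z) (?y S) ?yf a (P i) (e' i) = Comp (psh_cat C) Q F (?y S) \<sigma> b (P i) (e' i)"
        using e'D[OF i] a(2)[OF i] b(2)[OF i] \<sigma>'[OF pD(1)[OF i] i pD(3)[OF i]] pD(2,4)[OF i] by simp
    qed
    fix X x y assume X: "X \<in> Obj C" and x: "x \<in> Fo (?y Z) X" and y: "y \<in> Fo F X" and eq: "?yf X x = \<sigma> X y"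
    obtain i g where i: "i \<in> I" "g \<in> Hom C X (A i)" "Fm F (A i) X g (e i) = y" by (rule ufam_cases[OF F(3) X y])
    have "Comp C X Z S f x = Comp C X (A i) S (\<iota> i) g"
      using eq \<sigma>'[OF X i(1,2)] i(3) x X by simp
    then have Ex1: "\<exists>!h. h \<in> Hom C X (P i) \<and> Comp C X (P i) Z (p i) h = x \<and> Comp C X (P i) (A i) (q i) h = g"
      using pullback_Ex1[OF bspec[OF pb i(1)] X _ i(2)] x by simp
    then obtain h where h: "h \<in> Hom C X (P i)" "Comp C X (P i) Z (p i) h = x" "Comp C X (P i) (A i) (q i) h = g" by blast
    show "\<exists>!z. z \<in> Fo Q X \<and> a X z = x \<and> b X z = y"
    proof (rule ex1I[of _ "Fm Q (P i) X h (e' i)"])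
      show "Fm Q (P i) X h (e' i) \<in> Fo Q X \<and> a X (Fm Q (P i) X h (e' i)) = x \<and> b X (Fm Q (P i) X h (e' i)) = y"
        using a'[OF X i(1) h(1)] b'[OF X i(1) h(1)] h i(3) Q(1) e'D[OF i(1)] X by auto
      fix z assume z: "z \<in> Fo Q X \<and> a X z = x \<and> b X z = y"
      then have "z \<in> Fo Q X" by blast
      then obtain j h' where j: "j \<in> I" "h' \<in> Hom C X (P j)" "Fm Q (P j) X h' (e' j) = z" by (rule ufam_cases[OF Q(3) X])
      have "Fm F (A j) X (Comp C X (P j) (A j) (q j) h') (e j) = Fm F (A i) X g (e i)"
        using b'[OF X j(1,2)] j(3) z i(3) by simp
      from ufam_inj[OF F(3) X this j(1) i(1) Comp_in[OF j(2) pD(3)[OF j(1)] X pD(1)[OF j(1)] A[OF j(1)]] i(2)]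
      have ji: "j = i" "Comp C X (P j) (A j) (q j) h' = g" by blast+
      have "h' = h"
        using Ex1_unique[OF Ex1, of h' h] j(2) ji a'[OF X j(1,2)] j(3) z h by simp
      then show "z = Fm Q (P i) X h (e' i)" using j(3) ji(1) by simp
    qed
  qed
  have LO: "Fo L F \<in> Obj C" "Fo L Q \<in> Obj C" "Fo L (?y Z) \<in> Obj C" "Fo L (?y S) \<in> Obj C"
    using L_Obj F Q yZ yS by auto
  note La = L_Hom[OF Q(2) yZ(2) a(1)] and Lb = L_Hom[OF Q(2) F(2) b(1)]
    and Lyf = L_Hom[OF yZ(2) yS(2) yf] and L\<sigma> = L_Hom[OF F(2) yS(2) \<sigma>(1)]
  have Lpb: "is_pullback C (Fo L (?y Z)) (Fo L F) (Fo L (?y S)) (Fm L (?y Z) (?y S) ?yf) (Fm L F (?y S) \<sigma>)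
      (Fo L Q) (Fm L Q (?y Z) a) (Fm L Q F b)"
  proof (rule categ.lex_pullback[OF categ_psh_sub categ_axioms lex _ _ _ _ _ sq])
    show "fams \<subseteq> Obj (psh_cat C)" by (auto simp: fams_def)
  qed (use yZ F yS yf \<sigma> in auto)
  note coF = L_coproduct[OF F(2,3)] and coQ = L_coproduct[OF Q(2,3)]
  obtain c d where cd: "c \<in> Hom C (Fo L F) S" "d \<in> Hom C S (Fo L F)"
    "Comp C S (Fo L F) S c d = Id C S" "Comp C (Fo L F) S (Fo L F) d c = Id C (Fo L F)"
    "\<And>i. i \<in> I \<Longrightarrow> Comp C (A i) (Fo L F) S c (\<eta> F (A i) (e i)) = \<iota> i"
    "\<And>i. i \<in> I \<Longrightarrow> Comp C (A i) S (Fo L F) d (\<iota> i) = \<eta> F (A i) (e i)"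
    by (rule coproduct_compare[OF coF S]) (use A in auto)
  have \<eta>e: "\<eta> F (A i) (e i) \<in> Hom C (A i) (Fo L F)" if "i \<in> I" for i by (rule unit_Hom[OF F(2) eD[OF that]])
  \<comment> \<open>Up to the isomorphisms \<open>u S\<close> and \<open>c\<close> the image of
    \<open>\<sigma>\<close> is an identity.\<close>
  have L\<sigma>c: "Fm L F (?y S) \<sigma> = Comp C (Fo L F) S (Fo L (?y S)) (u S) c"
  proof (rule coproduct_hom_eq[OF coF LO(4) L\<sigma>])
    show "Comp C (Fo L F) S (Fo L (?y S)) (u S) c \<in> Hom C (Fo L F) (Fo L (?y S))"
      by (rule Comp_in[OF cd(1) u_in[OF SO(1)] LO(1) SO(1) LO(4)])
    fix i assume i: "i \<in> I"
    have "Comp C (A i) (Fo L F) (Fo L (?y S)) (Fm L F (?y S) \<sigma>) (\<eta> F (A i) (e i)) = \<eta> (?y S) (A i) (\<iota> i)"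
      using unit_nat[OF F(2) yS(2) \<sigma>(1) eD[OF i]] \<sigma>(2)[OF i] by simp
    also have "\<dots> = Comp C (A i) S (Fo L (?y S)) (u S) (\<iota> i)"
      by (rule unit_representable[OF SO(1) A[OF i] SO(2)[OF i]])
    also have "\<dots> = Comp C (A i) (Fo L F) (Fo L (?y S)) (Comp C (Fo L F) S (Fo L (?y S)) (u S) c) (\<eta> F (A i) (e i))"
      using Comp_assoc[OF \<eta>e[OF i] cd(1) u_in[OF SO(1)] A[OF i] LO(1) SO(1) LO(4)] cd(5)[OF i] by simp
    finally show "Comp C (A i) (Fo L F) (Fo L (?y S)) (Fm L F (?y S) \<sigma>) (\<eta> F (A i) (e i)) =
      Comp C (A i) (Fo L F) (Fo L (?y S)) (Comp C (Fo L F) S (Fo L (?y S)) (u S) c) (\<eta> F (A i) (e i))" .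
  qed (use A in auto)
  have df: "Comp C Z S (Fo L F) d f \<in> Hom C Z (Fo L F)" by (rule Comp_in[OF f cd(2) Z SO(1) LO(1)])
  have "Comp C Z (Fo L (?y Z)) (Fo L (?y S)) (Fm L (?y Z) (?y S) ?yf) (u Z) = \<eta> (?y S) Z (?yf Z (Id C Z))"
    unfolding u_def by (rule unit_nat[OF yZ(2) yS(2) yf Z]) (use Z in simp)
  also have "\<dots> = Comp C Z S (Fo L (?y S)) (u S) f"
    using unit_representable[OF SO(1) Z f] Z f SO(1) by simp
  also have "\<dots> = Comp C Z (Fo L F) (Fo L (?y S)) (Fm L F (?y S) \<sigma>) (Comp C Z S (Fo L F) d f)"
    using Comp_assoc[OF df cd(1) u_in[OF SO(1)] Z LO(1) SO(1) LO(4)] Comp_assoc[OF f cd(2,1) Z SO(1) LO(1) SO(1)] cd(3) f Z SO(1)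
    unfolding L\<sigma>c by simp
  \<comment> \<open>The inverse of the comparison from \<open>L Q\<close> to \<open>Z\<close>: the
    pullback property yields it from \<open>u Z\<close> and from \<open>f\<close> followed by the
    inverse \<open>d\<close> of \<open>c\<close>.\<close>
  finally obtain d' where d': "d' \<in> Hom C Z (Fo L Q)" "Comp C Z (Fo L Q) (Fo L (?y Z)) (Fm L Q (?y Z) a) d' = u Z"
    "Comp C Z (Fo L Q) (Fo L F) (Fm L Q F b) d' = Comp C Z S (Fo L F) d f"
    using pullback_Ex1[OF Lpb Z u_in[OF Z] df] by blast
  obtain r where r: "r \<in> Hom C (Fo L (?y Z)) Z" "Comp C Z (Fo L (?y Z)) Z r (u Z) = Id C Z"
    "Comp C (Fo L (?y Z)) Z (Fo L (?y Z)) (u Z) r = Id C (Fo L (?y Z))" by (rule u_iso[OF Z])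
  let ?c = "Comp C (Fo L Q) (Fo L (?y Z)) Z r (Fm L Q (?y Z) a)"
  have c: "?c \<in> Hom C (Fo L Q) Z" by (rule Comp_in[OF La r(1) LO(2,3) Z])
  have \<eta>e': "\<eta> Q (P i) (e' i) \<in> Hom C (P i) (Fo L Q)" if "i \<in> I" for i by (rule unit_Hom[OF Q(2) e'D[OF that]])
  have La\<eta>: "Comp C (P i) (Fo L Q) (Fo L (?y Z)) (Fm L Q (?y Z) a) (\<eta> Q (P i) (e' i)) = Comp C (P i) Z (Fo L (?y Z)) (u Z) (p i)"
    if i: "i \<in> I" for i
    using unit_nat[OF Q(2) yZ(2) a(1) e'D[OF i]] a(2)[OF i] unit_representable[OF Z pD(1,2)[OF i]] by simp
  have c\<eta>: "Comp C (P i) (Fo L Q) Z ?c (\<eta> Q (P i) (e' i)) = p i" if i: "i \<in> I" for i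
    using Comp_assoc[OF \<eta>e'[OF i] La r(1) pD(1)[OF i] LO(2,3) Z] La\<eta>[OF i]
      Comp_assoc[OF pD(2)[OF i] u_in[OF Z] r(1) pD(1)[OF i] Z LO(3) Z] r(2) pD(1,2)[OF i] Z by simp
  \<comment> \<open>Checked after both projections of the pullback, which together detect
    equality.\<close>
  have d'p: "Comp C (P i) Z (Fo L Q) d' (p i) = \<eta> Q (P i) (e' i)" if i: "i \<in> I" for i
  proof -
    note Pi = pD(1)[OF i] and pi = pD(2)[OF i] and qi = pD(3)[OF i] and Ai = A[OF i]
    have 1: "Comp C (P i) (Fo L Q) (Fo L (?y Z)) (Fm L Q (?y Z) a) (Comp C (P i) Z (Fo L Q) d' (p i)) = Comp C (P i) Z (Fo L (?y Z)) (u Z) (p i)"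
      using Comp_assoc[OF pi d'(1) La Pi Z LO(2,3)] d'(2) by simp
    have "Comp C (P i) (Fo L Q) (Fo L F) (Fm L Q F b) (Comp C (P i) Z (Fo L Q) d' (p i)) = Comp C (P i) S (Fo L F) d (Comp C (P i) Z S f (p i))"
      using Comp_assoc[OF pi d'(1) Lb Pi Z LO(2,1)] d'(3) Comp_assoc[OF pi f cd(2) Pi Z SO(1) LO(1)] by simp
    also have "\<dots> = Comp C (P i) (A i) (Fo L F) (\<eta> F (A i) (e i)) (q i)"
      using Comp_assoc[OF qi SO(2)[OF i] cd(2) Pi Ai SO(1) LO(1)] cd(6)[OF i] pD(4)[OF i] by simp
    also have "\<dots> = \<eta> F (P i) (b (P i) (e' i))"
      using unit_act[OF F(2) Ai Pi qi eD(2)[OF i]] b(2)[OF i] by simp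
    also have "\<dots> = Comp C (P i) (Fo L Q) (Fo L F) (Fm L Q F b) (\<eta> Q (P i) (e' i))"
      using unit_nat[OF Q(2) F(2) b(1) e'D[OF i]] by simp
    finally have 2: "Comp C (P i) (Fo L Q) (Fo L F) (Fm L Q F b) (Comp C (P i) Z (Fo L Q) d' (p i)) =
      Comp C (P i) (Fo L Q) (Fo L F) (Fm L Q F b) (\<eta> Q (P i) (e' i))" .
    have sq': "Comp C (P i) (Fo L (?y Z)) (Fo L (?y S)) (Fm L (?y Z) (?y S) ?yf) (Comp C (P i) (Fo L Q) (Fo L (?y Z)) (Fm L Q (?y Z) a) (\<eta> Q (P i) (e' i)))
      = Comp C (P i) (Fo L F) (Fo L (?y S)) (Fm L F (?y S) \<sigma>) (Comp C (P i) (Fo L Q) (Fo L F) (Fm L Q F b) (\<eta> Q (P i) (e' i)))"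
      by (rule Comp_extend[OF is_pullbackD(4)[OF Lpb] \<eta>e'[OF i] La Lyf Lb L\<sigma> Pi LO(2,3,1,4)])
    show ?thesis
      by (rule Ex1_unique[OF pullback_Ex1[OF Lpb Pi Comp_in[OF \<eta>e'[OF i] La Pi LO(2,3)] Comp_in[OF \<eta>e'[OF i] Lb Pi LO(2,1)] sq']])
        (use 1 2 La\<eta>[OF i] \<eta>e'[OF i] Comp_in[OF pi d'(1) Pi Z LO(2)] in auto)
  qed
  show "is_coproduct C I P Z p"
  proof (rule coproduct_transfer_iso[OF coQ Z pD(1) c d'(1) _ _ c\<eta>])
    show "Comp C Z (Fo L Q) Z ?c d' = Id C Z"
      using Comp_assoc[OF d'(1) La r(1) Z LO(2,3) Z] d'(2) r(2) by simp
    show "Comp C (Fo L Q) Z (Fo L Q) d' ?c = Id C (Fo L Q)"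
    proof (rule coproduct_hom_eq[OF coQ LO(2)])
      fix i assume i: "i \<in> I"
      show "Comp C (P i) (Fo L Q) (Fo L Q) (Comp C (Fo L Q) Z (Fo L Q) d' ?c) (\<eta> Q (P i) (e' i)) =
          Comp C (P i) (Fo L Q) (Fo L Q) (Id C (Fo L Q)) (\<eta> Q (P i) (e' i))"
        using Comp_assoc[OF \<eta>e'[OF i] c d'(1) pD(1)[OF i] LO(2) Z LO(2)] c\<eta>[OF i] d'p[OF i] \<eta>e'[OF i] pD(1)[OF i] LO(2) by simp
    qed (use Comp_in[OF c d'(1) LO(2) Z LO(2)] LO(2) pD(1) in auto)
  qed
qed

text \<open>Among presheaves an injection into the sum has a trivial kernel pair, and two different
  injections have an empty pullback; \<open>L\<close> carries both squares to pullbacks in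
  \<open>C\<close>.\<close>

lemma L_disjoint: "coproducts_disjoint C"
  unfolding coproducts_disjoint_def
proof (intro allI impI, elim conjE)
  fix I :: "nat set" and A S \<iota>
  assume I: "finite I" "A \<in> I \<rightarrow> Obj C" and S: "is_coproduct C I A S \<iota>"
  have A: "A i \<in> Obj C" if "i \<in> I" for i using I that by auto
  have SO: "S \<in> Obj C" "\<And>i. i \<in> I \<Longrightarrow> \<iota> i \<in> Hom C (A i) S" using S by (auto simp: is_coproduct_def)
  obtain F e where F: "psh F" "F \<in> fams" "ufam F I A e"
    by (rule ufam_exists[where I=I and A=A]) (use I in auto)
  note eD = ufamD[OF F(3)] and coF = L_coproduct[OF F(2,3)] and LF = L_Obj[OF F(2)]
  let ?y = "representable C" let ?m = "\<lambda>i. yon F (A i) (e i)"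
  have famsP: "fams \<subseteq> Obj (psh_cat C)" by (auto simp: fams_def)
  have y: "psh (?y (A i))" "?y (A i) \<in> fams" "Fo L (?y (A i)) \<in> Obj C" if "i \<in> I" for i
    using A[OF that] L_Obj by auto
  have m: "?m i \<in> Hom (psh_cat C) (?y (A i)) F" if "i \<in> I" for i using F(1) eD that by blast
  obtain c d where cd: "c \<in> Hom C (Fo L F) S" "d \<in> Hom C S (Fo L F)"
    "Comp C S (Fo L F) S c d = Id C S" "Comp C (Fo L F) S (Fo L F) d c = Id C (Fo L F)"
    "\<And>i. i \<in> I \<Longrightarrow> Comp C (A i) (Fo L F) S c (\<eta> F (A i) (e i)) = \<iota> i"
    "\<And>i. i \<in> I \<Longrightarrow> Comp C (A i) S (Fo L F) d (\<iota> i) = \<eta> F (A i) (e i)"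
    by (rule coproduct_compare[OF coF S]) (use A in auto)
  have Lm: "Fm L (?y (A i)) F (?m i) \<in> Hom C (Fo L (?y (A i))) (Fo L F)" if "i \<in> I" for i
    by (rule L_Hom[OF y(2)[OF that] F(2) m[OF that]])
  have Lmu: "Comp C X (Fo L (?y (A i))) (Fo L F) (Fm L (?y (A i)) F (?m i)) (Comp C X (A i) (Fo L (?y (A i))) (u (A i)) g)
      = Comp C X S (Fo L F) d (Comp C X (A i) S (\<iota> i) g)"
    if i: "i \<in> I" and X: "X \<in> Obj C" and g: "g \<in> Hom C X (A i)" for X g i
  proof -
    have "Comp C (A i) (Fo L (?y (A i))) (Fo L F) (Fm L (?y (A i)) F (?m i)) (u (A i)) = \<eta> F (A i) (e i)"
      unfolding u_def using unit_nat[OF y(2)[OF i] F(2) m[OF i] A[OF i], of "Id C (A i)"] A[OF i] F(1) eD[OF i] by simp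
    then show ?thesis
      using Comp_assoc[OF g u_in[OF A[OF i]] Lm[OF i] X A[OF i] y(3)[OF i] LF]
        Comp_assoc[OF g SO(2)[OF i] cd(2) X A[OF i] SO(1) LF] cd(6)[OF i] by simp
  qed
  \<comment> \<open>The arrows \<open>u\<close> and \<open>d\<close> replace \<open>A i\<close>,
    \<open>A j\<close> and \<open>S\<close> by isomorphic reflections, so a commuting pair over
    \<open>S\<close> becomes one to which the transported pullback applies.\<close>
  have fact: "\<exists>!h. h \<in> Hom C X (Fo L P) \<and>
      Comp C X (Fo L P) (Fo L (?y (A i))) (Fm L P (?y (A i)) p) h = Comp C X (A i) (Fo L (?y (A i))) (u (A i)) g \<and>
      Comp C X (Fo L P) (Fo L (?y (A j))) (Fm L P (?y (A j)) q) h = Comp C X (A j) (Fo L (?y (A j))) (u (A j)) g'"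
    if ij: "i \<in> I" "j \<in> I" and X: "X \<in> Obj C" "g \<in> Hom C X (A i)" "g' \<in> Hom C X (A j)"
      and eq: "Comp C X (A i) S (\<iota> i) g = Comp C X (A j) S (\<iota> j) g'"
      and P: "is_pullback (full_subcat (psh_cat C) fams) (?y (A i)) (?y (A j)) F (?m i) (?m j) P p q"
    for X g g' i j P p q
  proof (rule pullback_Ex1)
    show "is_pullback C (Fo L (?y (A i))) (Fo L (?y (A j))) (Fo L F) (Fm L (?y (A i)) F (?m i)) (Fm L (?y (A j)) F (?m j))
        (Fo L P) (Fm L P (?y (A i)) p) (Fm L P (?y (A j)) q)"
      by (rule categ.lex_pullback[OF categ_psh_sub[OF famsP] categ_axioms lex _ _ _ _ _ P])
        (use y ij F m in auto)
  qed (use X ij A y u_in Lmu[OF ij(1) X(1,2)] Lmu[OF ij(2) X(1,3)] eq in auto)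
  show "(\<forall>i\<in>I. is_mono C (A i) S (\<iota> i)) \<and>
    (\<forall>i\<in>I. \<forall>j\<in>I. \<forall>P p q. i \<noteq> j \<and> is_pullback C (A i) (A j) S (\<iota> i) (\<iota> j) P p q \<longrightarrow> is_initial C P)"
  proof (intro conjI ballI allI impI)
    fix i assume i: "i \<in> I"
    let ?id = "Id (psh_cat C) (?y (A i))"
    have P: "is_pullback (full_subcat (psh_cat C) fams) (?y (A i)) (?y (A i)) F (?m i) (?m i) (?y (A i)) ?id ?id"
    proof (rule pointwise_pullback[OF famsP y(2)[OF i] y(2)[OF i] F(2) y(2)[OF i] m[OF i] m[OF i]])
      fix X x x' assume X: "X \<in> Obj C" "x \<in> Fo (?y (A i)) X" "x' \<in> Fo (?y (A i)) X" "?m i X x = ?m i X x'"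
      have "x = x'" using ufam_inj(2)[OF F(3) X(1) _ i i, of x x'] X by simp
      then show "\<exists>!z. z \<in> Fo (?y (A i)) X \<and> ?id X z = x \<and> ?id X z = x'" using X by auto
    qed (use y[OF i] in auto)
    show "is_mono C (A i) S (\<iota> i)"
      unfolding is_mono_def
    proof (intro conjI ballI impI)
      show "\<iota> i \<in> Hom C (A i) S" by (rule SO(2)[OF i])
      fix X g h assume X: "X \<in> Obj C" "g \<in> Hom C X (A i)" "h \<in> Hom C X (A i)"
        and eq: "Comp C X (A i) S (\<iota> i) g = Comp C X (A i) S (\<iota> i) h"
      \<comment> \<open>Both projections of the transported kernel pair are the same arrow, so the
        two composites with \<open>u\<close> coincide.\<close>
      have ug: "Comp C X (A i) (Fo L (?y (A i))) (u (A i)) g = Comp C X (A i) (Fo L (?y (A i))) (u (A i)) h"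
        using fact[OF i i X eq P] by metis
      obtain r where r: "r \<in> Hom C (Fo L (?y (A i))) (A i)" "Comp C (A i) (Fo L (?y (A i))) (A i) r (u (A i)) = Id C (A i)"
        by (rule u_iso[OF A[OF i]])
      have "Comp C X (Fo L (?y (A i))) (A i) r (Comp C X (A i) (Fo L (?y (A i))) (u (A i)) g') = g'" if "g' \<in> Hom C X (A i)" for g'
        using Comp_assoc[OF that u_in[OF A[OF i]] r(1) X(1) A[OF i] y(3)[OF i] A[OF i]] r(2) that X(1) A[OF i] by simp
      from this[OF X(2)] this[OF X(3)] show "g = h" unfolding ug by (rule trans[OF sym])
    qed
  next
    fix i j P p q
    assume i: "i \<in> I" and j: "j \<in> I" and P: "i \<noteq> j \<and> is_pullback C (A i) (A j) S (\<iota> i) (\<iota> j) P p q"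
    note pD = is_pullbackD[OF conjunct2[OF P]]
    obtain O' eO where O': "psh O'" "O' \<in> fams" "ufam O' ({} :: nat set) undefined eO"
      by (rule ufam_exists[where I="{}" and A=undefined]) auto
    have empty: "Fo O' X = {}" if "X \<in> Obj C" for X using ufam_cases[OF O'(3) that] by blast
    obtain a where a: "a \<in> Hom (psh_cat C) O' (?y (A i))" by (rule ufam_nat_ex[OF O'(1,3) y(1)[OF i]]) auto
    obtain b where b: "b \<in> Hom (psh_cat C) O' (?y (A j))" by (rule ufam_nat_ex[OF O'(1,3) y(1)[OF j]]) auto
    have sq: "is_pullback (full_subcat (psh_cat C) fams) (?y (A i)) (?y (A j)) F (?m i) (?m j) O' a b"
    proof (rule pointwise_pullback[OF famsP y(2)[OF i] y(2)[OF j] F(2) O'(2) m[OF i] m[OF j] a b])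
      show "Comp (psh_cat C) O' (?y (A i)) F (?m i) a = Comp (psh_cat C) O' (?y (A j)) F (?m j) b"
        by (rule nat_eqI[OF Comp_psh_in[OF O'(1) y(1)[OF i] a m[OF i]] Comp_psh_in[OF O'(1) y(1)[OF j] b m[OF j]]])
          (simp add: empty)
      fix X x x' assume X: "X \<in> Obj C" "x \<in> Fo (?y (A i)) X" "x' \<in> Fo (?y (A j)) X" "?m i X x = ?m j X x'"
      have "i = j" using ufam_inj(1)[OF F(3) X(1) _ i j, of x x'] X by simp
      then show "\<exists>!z. z \<in> Fo O' X \<and> a X z = x \<and> b X z = x'" using P by blast
    qed
    \<comment> \<open>\<open>P\<close> thus maps to the reflection of the empty sum, which is
      initial; strictness, available from the stability just proved, makes \<open>P\<close> initial
      as well.\<close>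
    obtain h where h: "h \<in> Hom C P (Fo L O')"
      using fact[OF i j pD sq] by blast
    have "is_coproduct C ({} :: nat set) undefined (Fo L O') (\<lambda>i. \<eta> O' (undefined i) (eO i))"
      by (rule L_coproduct[OF O'(2,3)])
    then have "is_initial C (Fo L O')" by (simp add: is_coproduct_def is_initial_def)
    from initial_strict[OF L_stable this pD(1) h] show "is_initial C P" .
  qed
qed

end

theorem (in ls_categ) exact_imp_lextensive:
  assumes \<Phi>: "is_lext_class \<Phi>" and ex: "Phi_exact \<Phi> C"
  shows "lextensive C"
proof -
  have fc: "finitely_complete C" using ex by (simp add: Phi_exact_def)
  let ?E = "full_subcat (psh_cat C) fams"
  obtain L where lex: "lex_functor ?E C L" and adj: "left_adjoint C ?E L (yoneda C)"
    using ex unfolding Phi_exact_def Phi_l_eq_fams[OF fc \<Phi>] by blast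
  have L: "is_functor ?E C L" using lex by (simp add: lex_functor_def)
  have fp: "psh F" if "F \<in> fams" for F using that by (simp add: fams_def)
  have LO: "Fo L F \<in> Obj C" if "F \<in> fams" for F using functorD(1)[OF L, of F] that by simp
  have Lm: "Fm L F G p \<in> Hom C (Fo L F) (Fo L G)" if "F \<in> fams" "G \<in> fams" "p \<in> Hom (psh_cat C) F G" for F G p
    using functorD(2)[OF L, of F G p] that by simp
  obtain \<theta> where \<theta>:
    "(\<forall>F\<in>fams. \<forall>Z\<in>Obj C. bij_betw (\<theta> F Z) (Hom C (Fo L F) Z) (Hom (psh_cat C) F (representable C Z))) \<and>
     (\<forall>F\<in>fams. \<forall>X\<in>Obj C. \<forall>Y\<in>Obj C. \<forall>h\<in>Hom C (Fo L F) X. \<forall>k\<in>Hom C X Y.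
       \<theta> F Y (Comp C (Fo L F) X Y k h) = Comp (psh_cat C) F (representable C X) (representable C Y) (Fm (yoneda C) X Y k) (\<theta> F X h)) \<and>
     (\<forall>F\<in>fams. \<forall>G\<in>fams. \<forall>X\<in>Obj C. \<forall>h\<in>Hom C (Fo L F) X. \<forall>p\<in>Hom (psh_cat C) G F.
       \<theta> G X (Comp C (Fo L G) (Fo L F) X h (Fm L G F p)) = Comp (psh_cat C) G F (representable C X) (\<theta> F X h) p)"
    by (rule exE[OF conjunct2[OF conjunct2[OF adj[unfolded left_adjoint_def Obj_full_subcat Hom_full_subcat Comp_full_subcat Fo_yoneda]]]])
  note bij = conjunct1[OF \<theta>, rule_format] and nat1 = conjunct1[OF conjunct2[OF \<theta>], rule_format]
    and nat2 = conjunct2[OF conjunct2[OF \<theta>], rule_format]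
  \<comment> \<open>The unit is the transpose of the identity; naturality of \<open>\<theta>\<close>
    then expresses every transpose as a composite with it.\<close>
  define \<eta> where "\<eta> F = \<theta> F (Fo L F) (Id C (Fo L F))" for F
  have \<eta>: "\<eta> F \<in> Hom (psh_cat C) F (representable C (Fo L F))" if "F \<in> fams" for F
    unfolding \<eta>_def using bij_betwE[OF bij[OF that LO[OF that]]] LO[OF that] by blast
  have \<theta>\<eta>: "\<theta> F Z h X x = Comp C X (Fo L F) Z h (\<eta> F X x)"
    if "F \<in> fams" "Z \<in> Obj C" "h \<in> Hom C (Fo L F) Z" "X \<in> Obj C" "x \<in> Fo F X" for F Z h X x
    using nat1[OF that(1) LO[OF that(1)] that(2) Id_in[OF LO[OF that(1)]] that(3)] that LO[OF that(1)]
      nat_in[OF \<eta>[OF that(1)] that(5,4)]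
    by (simp add: \<eta>_def)
  interpret R: lex_reflection C L \<eta>
  proof
    show "lex_functor ?E C L" by (rule lex)
    show "\<eta> F \<in> Hom (psh_cat C) F (representable C (Fo L F))" if "F \<in> fams" for F by (rule \<eta>[OF that])
    show "Comp C X (Fo L F) (Fo L G) (Fm L F G p) (\<eta> F X x) = \<eta> G X (p X x)"
      if *: "F \<in> fams" "G \<in> fams" "p \<in> Hom (psh_cat C) F G" "X \<in> Obj C" "x \<in> Fo F X" for F G p X x
    proof -
      have "\<theta> F (Fo L G) (Fm L F G p) = Comp (psh_cat C) F G (representable C (Fo L G)) (\<eta> G) p"
        using nat2[OF *(2,1) LO[OF *(2)] Id_in[OF LO[OF *(2)]] *(3)] Lm[OF *(1-3)] LO *(1,2) by (simp add: \<eta>_def)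
      then show ?thesis
        using \<theta>\<eta>[OF *(1) LO[OF *(2)] Lm[OF *(1-3)] *(4,5)] *(4,5) by simp
    qed
    fix F Z \<alpha> assume F: "F \<in> fams" and Z: "Z \<in> Obj C" and \<alpha>: "\<alpha> \<in> Hom (psh_cat C) F (representable C Z)"
    have iff: "(\<forall>X\<in>Obj C. \<forall>x\<in>Fo F X. Comp C X (Fo L F) Z h (\<eta> F X x) = \<alpha> X x) \<longleftrightarrow> \<theta> F Z h = \<alpha>"
      if h: "h \<in> Hom C (Fo L F) Z" for h
    proof -
      have "\<theta> F Z h \<in> Hom (psh_cat C) F (representable C Z)" using bij_betwE[OF bij[OF F Z]] h by blast
      from nat_eqI[OF this \<alpha>] have "(\<forall>X\<in>Obj C. \<forall>x\<in>Fo F X. \<theta> F Z h X x = \<alpha> X x) \<longleftrightarrow> \<theta> F Z h = \<alpha>" by blast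
      then show ?thesis by (simp add: \<theta>\<eta>[OF F Z h] cong: ball_cong)
    qed
    obtain h where h: "h \<in> Hom C (Fo L F) Z" "\<theta> F Z h = \<alpha>"
      using \<alpha> unfolding bij_betw_imp_surj_on[OF bij[OF F Z], symmetric] by blast
    show "\<exists>!h. h \<in> Hom C (Fo L F) Z \<and> (\<forall>X\<in>Obj C. \<forall>x\<in>Fo F X. Comp C X (Fo L F) Z h (\<eta> F X x) = \<alpha> X x)"
    proof (rule ex1I[of _ h])
      fix k assume k: "k \<in> Hom C (Fo L F) Z \<and> (\<forall>X\<in>Obj C. \<forall>x\<in>Fo F X. Comp C X (Fo L F) Z k (\<eta> F X x) = \<alpha> X x)"
      then have kin: "k \<in> Hom C (Fo L F) Z" by simp
      then have "\<theta> F Z k = \<theta> F Z h" using k iff[OF kin] h(2) by simp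
      then show "k = h" by (rule inj_onD[OF bij_betw_imp_inj_on[OF bij[OF F Z]] _ kin h(1)])
    qed (use h iff[OF h(1)] in simp)
  qed
  show ?thesis
    using fc R.L_has_coproducts R.L_stable R.L_disjoint by (simp add: lextensive_def)
qed


section \<open>Finite covers in an extensive category\<close>

context categ
begin

lemma coproduct_reindex:
  assumes r: "bij_betw r J I" and S: "is_coproduct C I A S \<iota>"
  shows "is_coproduct C J (\<lambda>j. A (r j)) S (\<lambda>j. \<iota> (r j))"
  unfolding is_coproduct_def
proof (intro conjI ballI allI impI)
  have rI: "r j \<in> I" if "j \<in> J" for j using bij_betwE[OF r] that by blast
  show "S \<in> Obj C" "\<And>j. j \<in> J \<Longrightarrow> \<iota> (r j) \<in> Hom C (A (r j)) S"
    using S rI by (auto simp: is_coproduct_def)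
  fix Z \<mu> assume Z: "Z \<in> Obj C" and \<mu>: "\<forall>j\<in>J. \<mu> j \<in> Hom C (A (r j)) Z"
  let ?s = "inv_into J r"
  have s: "?s i \<in> J" "r (?s i) = i" if "i \<in> I" for i
    using bij_betw_inv_into_right[OF r that] bij_betwE[OF bij_betw_inv_into[OF r]] that by auto
  have sr: "?s (r j) = j" if "j \<in> J" for j using bij_betw_inv_into_left[OF r that] .
  have "\<mu> (?s i) \<in> Hom C (A i) Z" if "i \<in> I" for i
    using bspec[OF \<mu> s(1)[OF that]] s(2)[OF that] by simp
  then have "\<exists>!h. h \<in> Hom C S Z \<and> (\<forall>i\<in>I. Comp C (A i) S Z h (\<iota> i) = \<mu> (?s i))"
    by (rule coproduct_Ex1[OF S Z])
  moreover have "(\<forall>i\<in>I. Comp C (A i) S Z h (\<iota> i) = \<mu> (?s i)) \<longleftrightarrow> (\<forall>j\<in>J. Comp C (A (r j)) S Z h (\<iota> (r j)) = \<mu> j)" for h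
    using s sr rI by metis
  ultimately show "\<exists>!h. h \<in> Hom C S Z \<and> (\<forall>j\<in>J. Comp C (A (r j)) S Z h (\<iota> (r j)) = \<mu> j)" by simp
qed

text \<open>A map out of iterated coproducts is a family of maps indexed by pairs; this is what
  makes the covers below transitive.\<close>

lemma coproduct_Sigma:
  assumes M: "is_coproduct C I N M n" and N: "\<And>i. i \<in> I \<Longrightarrow> N i \<in> Obj C"
    and K: "\<And>i. i \<in> I \<Longrightarrow> is_coproduct C (J i) (K i) (N i) (k i)"
    and KO: "\<And>i j. i \<in> I \<Longrightarrow> j \<in> J i \<Longrightarrow> K i j \<in> Obj C"
  shows "is_coproduct C (SIGMA i:I. J i) (\<lambda>p. K (fst p) (snd p)) M
    (\<lambda>p. Comp C (K (fst p) (snd p)) (N (fst p)) M (n (fst p)) (k (fst p) (snd p)))"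
  unfolding is_coproduct_def
proof (intro conjI ballI allI impI)
  have MO: "M \<in> Obj C" "\<And>i. i \<in> I \<Longrightarrow> n i \<in> Hom C (N i) M" using M by (auto simp: is_coproduct_def)
  have k: "k i j \<in> Hom C (K i j) (N i)" if "i \<in> I" "j \<in> J i" for i j
    using K[OF that(1)] that(2) by (auto simp: is_coproduct_def)
  show "M \<in> Obj C" by (rule MO)
  show "Comp C (K (fst p) (snd p)) (N (fst p)) M (n (fst p)) (k (fst p) (snd p)) \<in> Hom C (K (fst p) (snd p)) M"
    if "p \<in> (SIGMA i:I. J i)" for p
    using that k MO N KO by auto
  fix Z \<mu> assume Z: "Z \<in> Obj C" and \<mu>: "\<forall>p\<in>(SIGMA i:I. J i). \<mu> p \<in> Hom C (K (fst p) (snd p)) Z"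
  have "\<exists>h. h \<in> Hom C (N i) Z \<and> (\<forall>j\<in>J i. Comp C (K i j) (N i) Z h (k i j) = \<mu> (i, j))" if i: "i \<in> I" for i
    by (rule coproduct_desc[OF K[OF i] Z, of "\<lambda>j. \<mu> (i, j)"]) (use \<mu> i in auto)
  then obtain h where h: "\<And>i. i \<in> I \<Longrightarrow> h i \<in> Hom C (N i) Z"
    "\<And>i j. i \<in> I \<Longrightarrow> j \<in> J i \<Longrightarrow> Comp C (K i j) (N i) Z (h i) (k i j) = \<mu> (i, j)" by metis
  have iff: "(\<forall>p\<in>(SIGMA i:I. J i). Comp C (K (fst p) (snd p)) M Z g
      (Comp C (K (fst p) (snd p)) (N (fst p)) M (n (fst p)) (k (fst p) (snd p))) = \<mu> p) \<longleftrightarrow>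
      (\<forall>i\<in>I. Comp C (N i) M Z g (n i) = h i)" (is "?l \<longleftrightarrow> ?r") if g: "g \<in> Hom C M Z" for g
  proof -
    have as: "Comp C (K i j) M Z g (Comp C (K i j) (N i) M (n i) (k i j)) = Comp C (K i j) (N i) Z (Comp C (N i) M Z g (n i)) (k i j)"
      if "i \<in> I" "j \<in> J i" for i j
      using Comp_assoc[OF k[OF that] MO(2)[OF that(1)] g KO[OF that] N[OF that(1)] MO(1) Z] by simp
    show ?thesis
    proof
      assume l: ?l
      show ?r
      proof
        fix i assume i: "i \<in> I"
        show "Comp C (N i) M Z g (n i) = h i"
        proof (rule coproduct_hom_eq[OF K[OF i] Z Comp_in[OF MO(2)[OF i] g N[OF i] MO(1) Z] h(1)[OF i] KO[OF i]])
          fix j assume j: "j \<in> J i"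
          show "Comp C (K i j) (N i) Z (Comp C (N i) M Z g (n i)) (k i j) = Comp C (K i j) (N i) Z (h i) (k i j)"
            using bspec[OF l, of "(i, j)"] i j as[OF i j] h(2)[OF i j] by simp
        qed
      qed
    next
      assume ?r
      then show ?l using as h(2) by auto
    qed
  qed
  show "\<exists>!g. g \<in> Hom C M Z \<and> (\<forall>p\<in>(SIGMA i:I. J i). Comp C (K (fst p) (snd p)) M Z g
      (Comp C (K (fst p) (snd p)) (N (fst p)) M (n (fst p)) (k (fst p) (snd p))) = \<mu> p)"
    using coproduct_Ex1[OF M Z h(1)] iff by (simp cong: conj_cong)
qed

text \<open>Covering for the extensive topology.\<close>

definition covers :: "'o \<Rightarrow> ('o \<Rightarrow> 'm \<Rightarrow> bool) \<Rightarrow> bool" where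
  "covers M R \<longleftrightarrow> (\<exists>(I :: nat set) N n. finite I \<and> (\<forall>i\<in>I. N i \<in> Obj C) \<and> is_coproduct C I N M n \<and>
     (\<forall>i\<in>I. R (N i) (n i)))"

lemma coversE:
  assumes "covers M R"
  obtains I :: "nat set" and N n where "finite I" "\<And>i. i \<in> I \<Longrightarrow> N i \<in> Obj C" "is_coproduct C I N M n"
    "\<And>i. i \<in> I \<Longrightarrow> n i \<in> Hom C (N i) M" "\<And>i. i \<in> I \<Longrightarrow> R (N i) (n i)"
proof -
  obtain I :: "nat set" and N n where I: "finite I" "\<forall>i\<in>I. N i \<in> Obj C" "is_coproduct C I N M n"
    "\<forall>i\<in>I. R (N i) (n i)"
    using assms unfolding covers_def by (elim exE conjE)
  have "n i \<in> Hom C (N i) M" if "i \<in> I" for i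
    using I(3) that by (simp add: is_coproduct_def)
  with I show ?thesis by (intro that[of I N n]) simp_all
qed

lemma covers_mono:
  assumes "covers M R" "\<And>N n. N \<in> Obj C \<Longrightarrow> n \<in> Hom C N M \<Longrightarrow> R N n \<Longrightarrow> R' N n"
  shows "covers M R'"
proof -
  obtain I :: "nat set" and N n where "finite I" "\<And>i. i \<in> I \<Longrightarrow> N i \<in> Obj C" "is_coproduct C I N M n"
    "\<And>i. i \<in> I \<Longrightarrow> n i \<in> Hom C (N i) M" "\<And>i. i \<in> I \<Longrightarrow> R (N i) (n i)"
    by (rule coversE[OF assms(1)]) blast
  then show ?thesis
    unfolding covers_def using assms(2) by (intro exI[of _ I] exI[of _ N] exI[of _ n]) simp
qed

lemma covers_trivial: "M \<in> Obj C \<Longrightarrow> covers M (\<lambda>_ _. True)"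
  unfolding covers_def
  by (intro exI[of _ "{0 :: nat}"] exI[of _ "\<lambda>_. M"] exI[of _ "\<lambda>_. Id C M"]) (auto simp: is_coproduct_def)

lemma covers_trans:
  assumes M: "M \<in> Obj C" and R: "covers M R"
    and R': "\<And>N n. N \<in> Obj C \<Longrightarrow> n \<in> Hom C N M \<Longrightarrow> R N n \<Longrightarrow> covers N (\<lambda>N' n'. R' N' (Comp C N' N M n n'))"
  shows "covers M R'"
proof -
  obtain I :: "nat set" and N n where I: "finite I" "\<And>i. i \<in> I \<Longrightarrow> N i \<in> Obj C" "is_coproduct C I N M n"
    "\<And>i. i \<in> I \<Longrightarrow> n i \<in> Hom C (N i) M" "\<And>i. i \<in> I \<Longrightarrow> R (N i) (n i)"
    by (rule coversE[OF R]) blast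
  have "\<forall>i\<in>I. \<exists>J K k. finite (J :: nat set) \<and> (\<forall>j\<in>J. K j \<in> Obj C) \<and> is_coproduct C J K (N i) k \<and>
      (\<forall>j\<in>J. R' (K j) (Comp C (K j) (N i) M (n i) (k j)))"
  proof
    fix i assume i: "i \<in> I"
    show "\<exists>J K k. finite (J :: nat set) \<and> (\<forall>j\<in>J. K j \<in> Obj C) \<and> is_coproduct C J K (N i) k \<and>
      (\<forall>j\<in>J. R' (K j) (Comp C (K j) (N i) M (n i) (k j)))"
      using R'[OF I(2)[OF i] I(4)[OF i] I(5)[OF i]] unfolding covers_def .
  qed
  then obtain J :: "nat \<Rightarrow> nat set" and K k where JKk:
    "\<forall>i\<in>I. finite (J i) \<and> (\<forall>j\<in>J i. K i j \<in> Obj C) \<and> is_coproduct C (J i) (K i) (N i) (k i) \<and>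
      (\<forall>j\<in>J i. R' (K i j) (Comp C (K i j) (N i) M (n i) (k i j)))"
    unfolding bchoice_iff by (elim exE)
  have J: "\<And>i. i \<in> I \<Longrightarrow> finite (J i)" "\<And>i j. i \<in> I \<Longrightarrow> j \<in> J i \<Longrightarrow> K i j \<in> Obj C"
    "\<And>i. i \<in> I \<Longrightarrow> is_coproduct C (J i) (K i) (N i) (k i)"
    "\<And>i j. i \<in> I \<Longrightarrow> j \<in> J i \<Longrightarrow> R' (K i j) (Comp C (K i j) (N i) M (n i) (k i j))"
    using JKk by simp_all
  let ?I = "SIGMA i:I. J i"
  have fin: "finite ?I" using I(1) J(1) by blast
  obtain r where r: "bij_betw r {0..<card ?I} ?I" using ex_bij_betw_nat_finite[OF fin] by blast
  have rI: "r m \<in> ?I" if "m \<in> {0..<card ?I}" for m using bij_betwE[OF r] that by blast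
  show ?thesis
    unfolding covers_def
  proof (intro exI conjI ballI)
    show "is_coproduct C {0..<card ?I} (\<lambda>m. K (fst (r m)) (snd (r m))) M
        (\<lambda>m. Comp C (K (fst (r m)) (snd (r m))) (N (fst (r m))) M (n (fst (r m))) (k (fst (r m)) (snd (r m))))"
      by (rule coproduct_reindex[OF r coproduct_Sigma[OF I(3,2) J(3,2)]])
    fix m assume "m \<in> {0..<card ?I}"
    then have m: "fst (r m) \<in> I" "snd (r m) \<in> J (fst (r m))" using rI[of m] by auto
    show "K (fst (r m)) (snd (r m)) \<in> Obj C" by (rule J(2)[OF m])
    show "R' (K (fst (r m)) (snd (r m))) (Comp C (K (fst (r m)) (snd (r m))) (N (fst (r m))) M (n (fst (r m))) (k (fst (r m)) (snd (r m))))"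
      by (rule J(4)[OF m])
  qed simp
qed

lemma covers_hom_eq:
  assumes "covers M R" "Z \<in> Obj C" "h \<in> Hom C M Z" "h' \<in> Hom C M Z"
    and "\<And>N n. N \<in> Obj C \<Longrightarrow> n \<in> Hom C N M \<Longrightarrow> R N n \<Longrightarrow> Comp C N M Z h n = Comp C N M Z h' n"
  shows "h = h'"
proof -
  obtain I :: "nat set" and N n where I: "finite I" "\<And>i. i \<in> I \<Longrightarrow> N i \<in> Obj C" "is_coproduct C I N M n"
    "\<And>i. i \<in> I \<Longrightarrow> n i \<in> Hom C (N i) M" "\<And>i. i \<in> I \<Longrightarrow> R (N i) (n i)"
    by (rule coversE[OF assms(1)]) blast
  show ?thesis
    by (rule coproduct_hom_eq[OF I(3) assms(2-4) I(2)]) (use I assms(5) in auto)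
qed

text \<open>The cover is refined for one \<open>j\<close> after another; \<open>stable\<close> keeps
  the conditions already reached valid on the finer pieces.\<close>

lemma covers_finite_inter:
  assumes "finite Js" and M: "M \<in> Obj C"
    and Q: "\<And>j N n. j \<in> Js \<Longrightarrow> N \<in> Obj C \<Longrightarrow> n \<in> Hom C N M \<Longrightarrow> covers N (\<lambda>N' n'. Q j N' (Comp C N' N M n n'))"
    and stable: "\<And>j N n N' n'. j \<in> Js \<Longrightarrow> N \<in> Obj C \<Longrightarrow> n \<in> Hom C N M \<Longrightarrow> N' \<in> Obj C \<Longrightarrow> n' \<in> Hom C N' N \<Longrightarrow>
      Q j N n \<Longrightarrow> Q j N' (Comp C N' N M n n')"
  shows "covers M (\<lambda>N n. \<forall>j\<in>Js. Q j N n)"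
  using assms(1) Q stable
proof (induction Js rule: finite_induct)
  case empty
  then show ?case using covers_trivial[OF M] by simp
next
  case (insert j Js)
  have IH: "covers M (\<lambda>N n. \<forall>j\<in>Js. Q j N n)"
    by (rule insert.IH) (use insert.prems in blast)+
  show ?case
  proof (rule covers_trans[OF M IH])
    fix N n assume N: "N \<in> Obj C" "n \<in> Hom C N M" "\<forall>j\<in>Js. Q j N n"
    have "covers N (\<lambda>N' n'. Q j N' (Comp C N' N M n n'))"
      by (rule insert.prems(1)) (use N in simp_all)
    then show "covers N (\<lambda>N' n'. \<forall>j\<in>insert j Js. Q j N' (Comp C N' N M n n'))"
      by (rule covers_mono) (use N insert.prems(2) in blast)
  qed
qed

text \<open>The pieces are the pullbacks of the injections along \<open>g\<close>; stability of
  coproducts says that they cover \<open>M\<close>.\<close>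

lemma covers_pullback:
  assumes fc: "finitely_complete C" and st: "coproducts_stable C"
    and I: "finite (I :: nat set)" "\<And>i. i \<in> I \<Longrightarrow> A i \<in> Obj C" and S: "is_coproduct C I A S \<iota>"
    and g: "M \<in> Obj C" "g \<in> Hom C M S"
  shows "covers M (\<lambda>N n. \<exists>i\<in>I. \<exists>k\<in>Hom C N (A i). Comp C N M S g n = Comp C N (A i) S (\<iota> i) k)"
proof -
  have SO: "S \<in> Obj C" "\<And>i. i \<in> I \<Longrightarrow> \<iota> i \<in> Hom C (A i) S" using S by (auto simp: is_coproduct_def)
  have "\<forall>i\<in>I. \<exists>P p q. is_pullback C M (A i) S g (\<iota> i) P p q"
    using finitely_complete_pullback[OF fc g(1) I(2) SO(1) g(2) SO(2)] by blast
  then obtain P p q where P: "\<And>i. i \<in> I \<Longrightarrow> is_pullback C M (A i) S g (\<iota> i) (P i) (p i) (q i)"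
    by metis
  have "is_coproduct C I P M p"
    by (rule st[unfolded coproducts_stable_def, rule_format, of I A S \<iota> M g]) (use I S g P in auto)
  then show ?thesis
    unfolding covers_def using I(1) is_pullbackD[OF P]
    by (intro exI[of _ I] exI[of _ P] exI[of _ p]) blast
qed

text \<open>For equal indices the injection is mono. Otherwise \<open>N\<close> maps to the pullback
  of two different injections, which is initial, and initial objects are strict.\<close>

lemma coproduct_injections_eq:
  assumes fc: "finitely_complete C" and st: "coproducts_stable C" and dj: "coproducts_disjoint C"
    and I: "finite (I :: nat set)" "\<And>i. i \<in> I \<Longrightarrow> A i \<in> Obj C" and S: "is_coproduct C I A S \<iota>"
    and ij: "i \<in> I" "j \<in> I" and f: "N \<in> Obj C" "f \<in> Hom C N (A i)" "g \<in> Hom C N (A j)"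
    and eq: "Comp C N (A i) S (\<iota> i) f = Comp C N (A j) S (\<iota> j) g"
  shows "i = j \<and> f = g \<or> is_initial C N"
proof -
  have SO: "S \<in> Obj C" "\<And>i. i \<in> I \<Longrightarrow> \<iota> i \<in> Hom C (A i) S" using S by (auto simp: is_coproduct_def)
  have AI: "A \<in> I \<rightarrow> Obj C" using I(2) by blast
  note d = dj[unfolded coproducts_disjoint_def, rule_format, of I A S \<iota>, OF conjI[OF I(1) conjI[OF AI S]]]
  show ?thesis
  proof (cases "i = j")
    case True
    then have "f = g" using conjunct1[OF d] ij f eq unfolding is_mono_def by blast
    with True show ?thesis by blast
  next
    case False
    obtain P p q where P: "is_pullback C (A i) (A j) S (\<iota> i) (\<iota> j) P p q"
      using finitely_complete_pullback[OF fc I(2)[OF ij(1)] I(2)[OF ij(2)] SO(1) SO(2)[OF ij(1)] SO(2)[OF ij(2)]] by blast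
    have "is_initial C P" using conjunct2[OF d] ij False P by blast
    moreover obtain h where "h \<in> Hom C N P" using pullback_Ex1[OF P f eq] by blast
    ultimately show ?thesis using initial_strict[OF st _ f(1)] by blast
  qed
qed

lemma initial_eq: "is_initial C N \<Longrightarrow> Z \<in> Obj C \<Longrightarrow> f \<in> Hom C N Z \<Longrightarrow> g \<in> Hom C N Z \<Longrightarrow> f = g"
  unfolding is_initial_def by blast

end


section \<open>Lextensivity implies exactness\<close>

text \<open>
  The reflection sends \<open>F\<close> with universal elements \<open>e F i \<in> F (A F i)\<close> to the coproduct \<open>S F\<close> of
  the \<open>A F i\<close>. The unit \<open>\<eta> F : F \<rightarrow> C(-, S F)\<close> is locally bijective for the extensive topology,
  so that the reflection is lex like any sheafification.
\<close>

locale sum_reflection = ls_categ C for C :: "('o, 'u::set_universe) cat" +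
  fixes I :: "('o, 'u) psh \<Rightarrow> nat set" and A :: "('o, 'u) psh \<Rightarrow> nat \<Rightarrow> 'o" and e :: "('o, 'u) psh \<Rightarrow> nat \<Rightarrow> 'u"
    and S :: "('o, 'u) psh \<Rightarrow> 'o" and \<iota> :: "('o, 'u) psh \<Rightarrow> nat \<Rightarrow> 'u"
    and \<eta> :: "('o, 'u) psh \<Rightarrow> 'o \<Rightarrow> 'u \<Rightarrow> 'u"
  assumes lextensive: "lextensive C"
    and I: "\<And>F. F \<in> fams \<Longrightarrow> finite (I F)" and u: "\<And>F. F \<in> fams \<Longrightarrow> ufam F (I F) (A F) (e F)"
    and S: "\<And>F. F \<in> fams \<Longrightarrow> is_coproduct C (I F) (A F) (S F) (\<iota> F)"
    and \<eta>: "\<And>F. F \<in> fams \<Longrightarrow> \<eta> F \<in> Hom (psh_cat C) F (representable C (S F))"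
    and \<eta>_e: "\<And>F i. F \<in> fams \<Longrightarrow> i \<in> I F \<Longrightarrow> \<eta> F (A F i) (e F i) = \<iota> F i"
begin

lemma fc: "finitely_complete C" and stable: "coproducts_stable C" and disjoint: "coproducts_disjoint C"
  using lextensive by (simp_all add: lextensive_def)

lemma fams_pshD: "F \<in> fams \<Longrightarrow> psh F"
  by (simp add: fams_def)

lemma S_Obj: "F \<in> fams \<Longrightarrow> S F \<in> Obj C" and \<iota>_in: "F \<in> fams \<Longrightarrow> i \<in> I F \<Longrightarrow> \<iota> F i \<in> Hom C (A F i) (S F)"
  using S by (auto simp: is_coproduct_def)

lemma A_Obj: "F \<in> fams \<Longrightarrow> i \<in> I F \<Longrightarrow> A F i \<in> Obj C"
  and e_in: "F \<in> fams \<Longrightarrow> i \<in> I F \<Longrightarrow> e F i \<in> Fo F (A F i)"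
  using ufamD[OF u] by auto

lemma \<eta>_in: "F \<in> fams \<Longrightarrow> X \<in> Obj C \<Longrightarrow> x \<in> Fo F X \<Longrightarrow> \<eta> F X x \<in> Hom C X (S F)"
  using nat_in[OF \<eta>] by simp

lemma \<eta>_nat:
  assumes "F \<in> fams" "X \<in> Obj C" "Y \<in> Obj C" "f \<in> Hom C Y X" "x \<in> Fo F X"
  shows "\<eta> F Y (Fm F X Y f x) = Comp C Y X (S F) (\<eta> F X x) f"
  using nat_act[OF \<eta>[OF assms(1)] fams_pshD[OF assms(1)] assms(5,4,2,3)] \<eta>_in[OF assms(1,2,5)] by simp

lemma \<eta>_act: "F \<in> fams \<Longrightarrow> X \<in> Obj C \<Longrightarrow> i \<in> I F \<Longrightarrow> f \<in> Hom C X (A F i) \<Longrightarrow>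
  \<eta> F X (Fm F (A F i) X f (e F i)) = Comp C X (A F i) (S F) (\<iota> F i) f"
  using \<eta>_nat[of F "A F i" X f "e F i"] A_Obj e_in \<eta>_e by simp

lemma \<eta>_univ:
  assumes F: "F \<in> fams" and Z: "Z \<in> Obj C" and \<alpha>: "\<alpha> \<in> Hom (psh_cat C) F (representable C Z)"
  shows "\<exists>!h. h \<in> Hom C (S F) Z \<and> (\<forall>X\<in>Obj C. \<forall>x\<in>Fo F X. Comp C X (S F) Z h (\<eta> F X x) = \<alpha> X x)"
proof -
  note Fp = fams_pshD[OF F]
  have \<alpha>e: "\<alpha> (A F i) (e F i) \<in> Hom C (A F i) Z" if "i \<in> I F" for i
    using nat_in[OF \<alpha> e_in[OF F that] A_Obj[OF F that]] by simp
  have iff: "(\<forall>X\<in>Obj C. \<forall>x\<in>Fo F X. Comp C X (S F) Z h (\<eta> F X x) = \<alpha> X x) \<longleftrightarrow>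
      (\<forall>i\<in>I F. Comp C (A F i) (S F) Z h (\<iota> F i) = \<alpha> (A F i) (e F i))" (is "?l \<longleftrightarrow> ?r")
    if h: "h \<in> Hom C (S F) Z" for h
  proof
    assume ?l then show ?r using \<eta>_e[OF F] A_Obj[OF F] e_in[OF F] by metis
  next
    assume r: ?r
    show ?l
    proof (intro ballI)
      fix X x assume X: "X \<in> Obj C" "x \<in> Fo F X"
      obtain i f where i: "i \<in> I F" "f \<in> Hom C X (A F i)" "Fm F (A F i) X f (e F i) = x" by (rule ufam_cases[OF u[OF F] X])
      have "Comp C X (S F) Z h (\<eta> F X x) = Comp C X (S F) Z h (Comp C X (A F i) (S F) (\<iota> F i) f)"
        using \<eta>_act[OF F X(1) i(1,2)] i(3) by simp
      also have "\<dots> = Comp C X (A F i) Z (\<alpha> (A F i) (e F i)) f"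
        using Comp_assoc[OF i(2) \<iota>_in[OF F i(1)] h X(1) A_Obj[OF F i(1)] S_Obj[OF F] Z] r i(1) by simp
      also have "\<dots> = \<alpha> X x"
        using nat_act[OF \<alpha> Fp e_in[OF F i(1)] i(2) A_Obj[OF F i(1)] X(1)] \<alpha>e[OF i(1)] i(3) by simp
      finally show "Comp C X (S F) Z h (\<eta> F X x) = \<alpha> X x" .
    qed
  qed
  show ?thesis
    using coproduct_Ex1[OF S[OF F] Z \<alpha>e] iff by (simp cong: conj_cong)
qed

text \<open>On each piece of the cover obtained by pulling back the injections, \<open>g\<close>
  factors through one summand, and the factor names an element of \<open>F\<close>.\<close>

lemma \<eta>_locally_surjective:
  assumes F: "F \<in> fams" and M: "M \<in> Obj C" "g \<in> Hom C M (S F)"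
  shows "covers M (\<lambda>N n. \<exists>x\<in>Fo F N. \<eta> F N x = Comp C N M (S F) g n)"
proof (rule covers_mono[OF covers_pullback[OF fc stable I[OF F] A_Obj[OF F] S[OF F] M]])
  fix N n assume N: "N \<in> Obj C" "n \<in> Hom C N M"
    and "\<exists>i\<in>I F. \<exists>k\<in>Hom C N (A F i). Comp C N M (S F) g n = Comp C N (A F i) (S F) (\<iota> F i) k"
  then obtain i k where i: "i \<in> I F" "k \<in> Hom C N (A F i)" "Comp C N M (S F) g n = Comp C N (A F i) (S F) (\<iota> F i) k"
    by blast
  show "\<exists>x\<in>Fo F N. \<eta> F N x = Comp C N M (S F) g n"
    using \<eta>_act[OF F N(1) i(1,2)] i(3) act_in[OF fams_pshD[OF F] e_in[OF F i(1)] i(2) A_Obj[OF F i(1)] N(1)] by auto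
qed

text \<open>The exception is genuine: an initial \<open>N\<close> has one arrow to
  \<open>S F\<close>, but \<open>F\<close> has one element over it for every summand.\<close>

lemma \<eta>_locally_injective:
  assumes F: "F \<in> fams" and N: "N \<in> Obj C" "x \<in> Fo F N" "y \<in> Fo F N" and eq: "\<eta> F N x = \<eta> F N y"
  shows "x = y \<or> is_initial C N"
proof -
  obtain i f where i: "i \<in> I F" "f \<in> Hom C N (A F i)" "Fm F (A F i) N f (e F i) = x" by (rule ufam_cases[OF u[OF F] N(1,2)])
  obtain j g where j: "j \<in> I F" "g \<in> Hom C N (A F j)" "Fm F (A F j) N g (e F j) = y" by (rule ufam_cases[OF u[OF F] N(1,3)])
  have "Comp C N (A F i) (S F) (\<iota> F i) f = Comp C N (A F j) (S F) (\<iota> F j) g"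
    using eq \<eta>_act[OF F N(1) i(1,2)] \<eta>_act[OF F N(1) j(1,2)] i(3) j(3) by simp
  from coproduct_injections_eq[OF fc stable disjoint I[OF F] A_Obj[OF F] S[OF F] i(1) j(1) N(1) i(2) j(2) this]
  show ?thesis using i(3) j(3) by blast
qed

definition L :: "(('o, 'u) psh, 'o \<Rightarrow> 'u \<Rightarrow> 'u, 'o, 'u) functr" where
  "L = \<lparr>Fo = S, Fm = (\<lambda>F G p. THE h. h \<in> Hom C (S F) (S G) \<and>
     (\<forall>X\<in>Obj C. \<forall>x\<in>Fo F X. Comp C X (S F) (S G) h (\<eta> F X x) = \<eta> G X (p X x)))\<rparr>"

lemma Fo_L [simp]: "Fo L = S"
  by (simp add: L_def)

lemma hom_eq:
  assumes F: "F \<in> fams" and Z: "Z \<in> Obj C" and h: "h \<in> Hom C (S F) Z" "h' \<in> Hom C (S F) Z"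
    and eq: "\<And>X x. X \<in> Obj C \<Longrightarrow> x \<in> Fo F X \<Longrightarrow> Comp C X (S F) Z h (\<eta> F X x) = Comp C X (S F) Z h' (\<eta> F X x)"
  shows "h = h'"
proof (rule coproduct_hom_eq[OF S[OF F] Z h A_Obj[OF F]])
  fix i assume i: "i \<in> I F"
  show "Comp C (A F i) (S F) Z h (\<iota> F i) = Comp C (A F i) (S F) Z h' (\<iota> F i)"
    using eq[OF A_Obj[OF F i] e_in[OF F i]] \<eta>_e[OF F i] by simp
qed

lemma L_map:
  assumes F: "F \<in> fams" and G: "G \<in> fams" and p: "p \<in> Hom (psh_cat C) F G"
  shows "Fm L F G p \<in> Hom C (S F) (S G)"
    and "X \<in> Obj C \<Longrightarrow> x \<in> Fo F X \<Longrightarrow> Comp C X (S F) (S G) (Fm L F G p) (\<eta> F X x) = \<eta> G X (p X x)"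
proof -
  have c: "Comp (psh_cat C) F G (representable C (S G)) (\<eta> G) p \<in> Hom (psh_cat C) F (representable C (S G))"
    by (rule Comp_psh_in[OF fams_pshD[OF F] fams_pshD[OF G] p \<eta>[OF G]])
  have "\<exists>!h. h \<in> Hom C (S F) (S G) \<and> (\<forall>X\<in>Obj C. \<forall>x\<in>Fo F X. Comp C X (S F) (S G) h (\<eta> F X x) = \<eta> G X (p X x))"
    using \<eta>_univ[OF F S_Obj[OF G] c] by (simp cong: ball_cong)
  from theI'[OF this]
  show "Fm L F G p \<in> Hom C (S F) (S G)"
    "X \<in> Obj C \<Longrightarrow> x \<in> Fo F X \<Longrightarrow> Comp C X (S F) (S G) (Fm L F G p) (\<eta> F X x) = \<eta> G X (p X x)"
    by (simp_all add: L_def)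
qed

section \<open>The reflection is left adjoint to the Yoneda embedding and lex\<close>

abbreviation E :: "(('o, 'u) psh, 'o \<Rightarrow> 'u \<Rightarrow> 'u) cat" where
  "E \<equiv> full_subcat (psh_cat C) fams"

lemma fams_sub: "fams \<subseteq> Obj (psh_cat C)"
  by (auto simp: fams_def)

lemma L_is_functor: "is_functor E C L"
  unfolding is_functor_def Obj_full_subcat Hom_full_subcat Comp_full_subcat Id_full_subcat Fo_L
proof (intro conjI ballI)
  fix F assume F: "F \<in> fams"
  show "S F \<in> Obj C" by (rule S_Obj[OF F])
  have id: "Id (psh_cat C) F \<in> Hom (psh_cat C) F F" by (rule Id_psh_in[OF fams_pshD[OF F]])
  show "Fm L F F (Id (psh_cat C) F) = Id C (S F)"
    by (rule hom_eq[OF F S_Obj[OF F] L_map(1)[OF F F id] Id_in[OF S_Obj[OF F]]])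
      (use L_map(2)[OF F F id] \<eta>_in[OF F] S_Obj[OF F] in simp)
next
  fix F G p assume "F \<in> fams" "G \<in> fams" "p \<in> Hom (psh_cat C) F G"
  then show "Fm L F G p \<in> Hom C (S F) (S G)" by (rule L_map(1))
next
  fix F G H p q
  assume F: "F \<in> fams" and G: "G \<in> fams" and H: "H \<in> fams"
    and p: "p \<in> Hom (psh_cat C) F G" and q: "q \<in> Hom (psh_cat C) G H"
  have qp: "Comp (psh_cat C) F G H q p \<in> Hom (psh_cat C) F H"
    by (rule Comp_psh_in[OF fams_pshD[OF F] fams_pshD[OF G] p q])
  show "Fm L F H (Comp (psh_cat C) F G H q p) = Comp C (S F) (S G) (S H) (Fm L G H q) (Fm L F G p)"
  proof (rule hom_eq[OF F S_Obj[OF H] L_map(1)[OF F H qp] Comp_in[OF L_map(1)[OF F G p] L_map(1)[OF G H q] S_Obj[OF F] S_Obj[OF G] S_Obj[OF H]]])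
    fix X x assume X: "X \<in> Obj C" "x \<in> Fo F X"
    show "Comp C X (S F) (S H) (Fm L F H (Comp (psh_cat C) F G H q p)) (\<eta> F X x) =
        Comp C X (S F) (S H) (Comp C (S F) (S G) (S H) (Fm L G H q) (Fm L F G p)) (\<eta> F X x)"
      using Comp_assoc[OF \<eta>_in[OF F X] L_map(1)[OF F G p] L_map(1)[OF G H q] X(1) S_Obj[OF F] S_Obj[OF G] S_Obj[OF H]]
        L_map(2)[OF F H qp X] L_map(2)[OF F G p X] L_map(2)[OF G H q X(1) nat_in[OF p X(2,1)]] X by simp
  qed
qed

lemma yoneda_functor: "is_functor C E (yoneda C)"
  unfolding is_functor_def Obj_full_subcat Hom_full_subcat Comp_full_subcat Id_full_subcat Fo_yoneda
proof (intro conjI ballI)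
  show "representable C X \<in> fams" if "X \<in> Obj C" for X by (rule representable_fams[OF that])
  show "Fm (yoneda C) X Y f \<in> Hom (psh_cat C) (representable C X) (representable C Y)"
    if "X \<in> Obj C" "Y \<in> Obj C" "f \<in> Hom C X Y" for X Y f by (rule yoneda_map_in[OF that])
  show "Fm (yoneda C) X X (Id C X) = Id (psh_cat C) (representable C X)" if X: "X \<in> Obj C" for X
    by (rule nat_eqI[OF yoneda_map_in[OF X X Id_in[OF X]] Id_psh_in[OF psh_representable[OF X]]]) (use X in simp)
  fix X Y Z f g
  assume X: "X \<in> Obj C" and Y: "Y \<in> Obj C" and Z: "Z \<in> Obj C" and f: "f \<in> Hom C X Y" and g: "g \<in> Hom C Y Z"
  show "Fm (yoneda C) X Z (Comp C X Y Z g f) =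
    Comp (psh_cat C) (representable C X) (representable C Y) (representable C Z) (Fm (yoneda C) Y Z g) (Fm (yoneda C) X Y f)"
    by (rule nat_eqI[OF yoneda_map_in[OF X Z Comp_in[OF f g X Y Z]]
        Comp_psh_in[OF psh_representable[OF X] psh_representable[OF Y] yoneda_map_in[OF X Y f] yoneda_map_in[OF Y Z g]]])
      (use X Y Z f g in simp)
qed

lemma L_left_adjoint: "left_adjoint C E L (yoneda C)"
proof -
  define \<theta> where "\<theta> F Z h = mk_nat F (\<lambda>X x. Comp C X (S F) Z h (\<eta> F X x))" for F Z h
  have \<theta>: "\<theta> F Z h \<in> Hom (psh_cat C) F (representable C Z)" if F: "F \<in> fams" and Z: "Z \<in> Obj C" and h: "h \<in> Hom C (S F) Z" for F Z h
    unfolding \<theta>_def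
  proof (rule mk_nat_in[OF fams_pshD[OF F]])
    fix X x assume X: "X \<in> Obj C" "x \<in> Fo F X"
    show in_rep: "Comp C X (S F) Z h (\<eta> F X x) \<in> Fo (representable C Z) X"
      using Comp_in[OF \<eta>_in[OF F X] h X(1) S_Obj[OF F] Z] by simp
    fix Y f assume Y: "Y \<in> Obj C" "f \<in> Hom C Y X"
    show "Comp C Y (S F) Z h (\<eta> F Y (Fm F X Y f x)) = Fm (representable C Z) X Y f (Comp C X (S F) Z h (\<eta> F X x))"
      using Comp_assoc[OF Y(2) \<eta>_in[OF F X] h Y(1) X(1) S_Obj[OF F] Z] \<eta>_nat[OF F X(1) Y X(2)] in_rep by simp
  qed
  have \<theta>_apply: "\<theta> F Z h X x = Comp C X (S F) Z h (\<eta> F X x)" if "X \<in> Obj C" "x \<in> Fo F X" for F Z h X x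
    using that by (simp add: \<theta>_def)
  show ?thesis
    unfolding left_adjoint_def Obj_full_subcat Hom_full_subcat Comp_full_subcat Fo_yoneda Fo_L
  proof (intro conjI exI[of _ \<theta>] ballI)
    show "is_functor E C L" by (rule L_is_functor)
    show "is_functor C E (yoneda C)" by (rule yoneda_functor)
    show "bij_betw (\<theta> F Z) (Hom C (S F) Z) (Hom (psh_cat C) F (representable C Z))" if F: "F \<in> fams" and Z: "Z \<in> Obj C" for F Z
      unfolding bij_betw_def
    proof (intro conjI inj_onI equalityI subsetI)
      fix h h' assume h: "h \<in> Hom C (S F) Z" "h' \<in> Hom C (S F) Z" and eq: "\<theta> F Z h = \<theta> F Z h'"
      show "h = h'"
        by (rule hom_eq[OF F Z h]) (use \<theta>_apply eq in metis)
    next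
      fix \<alpha> assume "\<alpha> \<in> \<theta> F Z ` Hom C (S F) Z"
      then show "\<alpha> \<in> Hom (psh_cat C) F (representable C Z)" using \<theta>[OF F Z] by blast
    next
      fix \<alpha> assume \<alpha>: "\<alpha> \<in> Hom (psh_cat C) F (representable C Z)"
      obtain h where h: "h \<in> Hom C (S F) Z" "\<forall>X\<in>Obj C. \<forall>x\<in>Fo F X. Comp C X (S F) Z h (\<eta> F X x) = \<alpha> X x"
        using \<eta>_univ[OF F Z \<alpha>] by blast
      have "\<alpha> = \<theta> F Z h"
        by (rule nat_eqI[OF \<alpha> \<theta>[OF F Z h(1)]]) (use h(2) \<theta>_apply in simp)
      then show "\<alpha> \<in> \<theta> F Z ` Hom C (S F) Z" using h(1) by (rule image_eqI)
    qed
  next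
    fix F X Y h k
    assume F: "F \<in> fams" and X: "X \<in> Obj C" and Y: "Y \<in> Obj C" and h: "h \<in> Hom C (S F) X" and k: "k \<in> Hom C X Y"
    show "\<theta> F Y (Comp C (S F) X Y k h) = Comp (psh_cat C) F (representable C X) (representable C Y) (Fm (yoneda C) X Y k) (\<theta> F X h)"
    proof (rule nat_eqI[OF \<theta>[OF F Y Comp_in[OF h k S_Obj[OF F] X Y]]
          Comp_psh_in[OF fams_pshD[OF F] psh_representable[OF X] \<theta>[OF F X h] yoneda_map_in[OF X Y k]]])
      fix W w assume W: "W \<in> Obj C" "w \<in> Fo F W"
      show "\<theta> F Y (Comp C (S F) X Y k h) W w =
        Comp (psh_cat C) F (representable C X) (representable C Y) (Fm (yoneda C) X Y k) (\<theta> F X h) W w"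
        using Comp_assoc[OF \<eta>_in[OF F W] h k W(1) S_Obj[OF F] X Y] Comp_in[OF \<eta>_in[OF F W] h W(1) S_Obj[OF F] X] W
        by (simp add: \<theta>_apply)
    qed
  next
    fix F G X h p
    assume F: "F \<in> fams" and G: "G \<in> fams" and X: "X \<in> Obj C" and h: "h \<in> Hom C (S F) X" and p: "p \<in> Hom (psh_cat C) G F"
    note Lp = L_map(1)[OF G F p]
    show "\<theta> G X (Comp C (S G) (S F) X h (Fm L G F p)) = Comp (psh_cat C) G F (representable C X) (\<theta> F X h) p"
    proof (rule nat_eqI[OF \<theta>[OF G X Comp_in[OF Lp h S_Obj[OF G] S_Obj[OF F] X]]
          Comp_psh_in[OF fams_pshD[OF G] fams_pshD[OF F] p \<theta>[OF F X h]]])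
      fix W w assume W: "W \<in> Obj C" "w \<in> Fo G W"
      show "\<theta> G X (Comp C (S G) (S F) X h (Fm L G F p)) W w = Comp (psh_cat C) G F (representable C X) (\<theta> F X h) p W w"
        using Comp_assoc[OF \<eta>_in[OF G W] Lp h W(1) S_Obj[OF G] S_Obj[OF F] X] L_map(2)[OF G F p W] nat_in[OF p W(2,1)] W
        by (simp add: \<theta>_apply)
    qed
  qed
qed

text \<open>The argument for sheafification. Locally, a cone on \<open>M\<close> lifts through the
  units to elements of the presheaves in the diagram; by local injectivity these are compatible and
  so give elements of the limit presheaf, and the resulting arrows glue because a cover is a
  coproduct.\<close>

lemma L_lex: "lex_functor E C L"
  unfolding lex_functor_def
proof (intro conjI allI impI)
  show "is_functor E C L" by (rule L_is_functor)
  fix J :: "(nat, nat) cat" and T Lim \<pi>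
  assume "finite_category J \<and> is_functor J E T \<and> is_limit J E T Lim \<pi>"
  then have J: "finite_category J" and T: "is_functor J E T" and Lim: "is_limit J E T Lim \<pi>" by blast+
  note c = coneD[OF limit_cone[OF Lim], unfolded Obj_full_subcat Hom_full_subcat Comp_full_subcat]
  have Tj: "Fo T j \<in> fams" if "j \<in> Obj J" for j using functorD(1)[OF T that] by simp
  have Tk: "Fm T i j k \<in> Hom (psh_cat C) (Fo T i) (Fo T j)" if "i \<in> Obj J" "j \<in> Obj J" "k \<in> Hom J i j" for i j k
    using functorD(2)[OF T that] by simp
  have bij: "bij_betw (\<lambda>x. \<lambda>j\<in>Obj J. \<pi> j X x) (Fo Lim X) (Fo (tup J T) X)" if "X \<in> Obj C" for X
    by (rule limit_pointwise[OF fams_sub representable_fams T Lim that])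
  let ?\<pi> = "\<lambda>j. Fm L Lim (Fo T j) (\<pi> j)"
  note L\<pi> = L_map[OF c(1) Tj c(2)]
  have FoT: "Fo (functor_comp L T) j = S (Fo T j)" for j by (simp add: functor_comp_def)
  have FmT: "Fm (functor_comp L T) i j k = Fm L (Fo T i) (Fo T j) (Fm T i j k)" for i j k by (simp add: functor_comp_def)
  show "is_limit J C (functor_comp L T) (Fo L Lim) ?\<pi>"
    unfolding is_limit_def FoT Fo_L
  proof (intro conjI allI impI)
    show "is_cone J C (functor_comp L T) (S Lim) ?\<pi>"
      unfolding is_cone_def FoT FmT
    proof (intro conjI ballI)
      show "S Lim \<in> Obj C" by (rule S_Obj[OF c(1)])
      show "?\<pi> j \<in> Hom C (S Lim) (S (Fo T j))" if "j \<in> Obj J" for j by (rule L\<pi>(1)[OF that that])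
      show "Comp C (S Lim) (S (Fo T i)) (S (Fo T j)) (Fm L (Fo T i) (Fo T j) (Fm T i j k)) (?\<pi> i) = ?\<pi> j"
        if *: "i \<in> Obj J" "j \<in> Obj J" "k \<in> Hom J i j" for i j k
        using functorD(4)[OF L_is_functor, of Lim "Fo T i" "Fo T j" "\<pi> i" "Fm T i j k"] c(1) c(2)[OF *(1)] c(3)[OF *] Tj * Tk[OF *] by simp
    qed
    fix M \<mu> assume cone: "is_cone J C (functor_comp L T) M \<mu>"
    note m = coneD[OF cone, unfolded FoT FmT]
    \<comment> \<open>A common cover on which all the \<open>\<mu> j\<close> lift; finiteness of the
      diagram is what provides it.\<close>
    have Q: "covers M (\<lambda>N n. \<forall>j\<in>Obj J. \<exists>x\<in>Fo (Fo T j) N. \<eta> (Fo T j) N x = Comp C N M (S (Fo T j)) (\<mu> j) n)"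
    proof (rule covers_finite_inter[OF _ m(1)])
      show "finite (Obj J)" using J by (simp add: finite_category_def)
      fix j N n assume j: "j \<in> Obj J" and N: "N \<in> Obj C" "n \<in> Hom C N M"
      have "covers N (\<lambda>N' n'. \<exists>x\<in>Fo (Fo T j) N'. \<eta> (Fo T j) N' x = Comp C N' N (S (Fo T j)) (Comp C N M (S (Fo T j)) (\<mu> j) n) n')"
        by (rule \<eta>_locally_surjective[OF Tj[OF j] N(1) Comp_in[OF N(2) m(2)[OF j] N(1) m(1) S_Obj[OF Tj[OF j]]]])
      then show "covers N (\<lambda>N' n'. \<exists>x\<in>Fo (Fo T j) N'. \<eta> (Fo T j) N' x = Comp C N' M (S (Fo T j)) (\<mu> j) (Comp C N' N M n n'))"
        by (rule covers_mono) (use Comp_assoc[OF _ N(2) m(2)[OF j] _ N(1) m(1) S_Obj[OF Tj[OF j]]] in simp)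
      fix N' n' assume N': "N' \<in> Obj C" "n' \<in> Hom C N' N"
        and "\<exists>x\<in>Fo (Fo T j) N. \<eta> (Fo T j) N x = Comp C N M (S (Fo T j)) (\<mu> j) n"
      then obtain x where x: "x \<in> Fo (Fo T j) N" "\<eta> (Fo T j) N x = Comp C N M (S (Fo T j)) (\<mu> j) n" by blast
      show "\<exists>x\<in>Fo (Fo T j) N'. \<eta> (Fo T j) N' x = Comp C N' M (S (Fo T j)) (\<mu> j) (Comp C N' N M n n')"
        using \<eta>_nat[OF Tj[OF j] N(1) N' x(1)] x(2) act_in[OF fams_pshD[OF Tj[OF j]] x(1) N'(2) N(1) N'(1)]
          Comp_assoc[OF N'(2) N(2) m(2)[OF j] N'(1) N(1) m(1) S_Obj[OF Tj[OF j]]] by auto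
    qed
    \<comment> \<open>On an initial piece the lifts may fail to be compatible, so such pieces form a
      case of their own; they map uniquely to every object.\<close>
    let ?R = "\<lambda>N n. is_initial C N \<or> (\<exists>x\<in>Fo Lim N. \<forall>j\<in>Obj J. \<eta> (Fo T j) N (\<pi> j N x) = Comp C N M (S (Fo T j)) (\<mu> j) n)"
    have R: "covers M ?R"
    proof (rule covers_mono[OF Q], rule disjCI)
      fix N n assume N: "N \<in> Obj C" "n \<in> Hom C N M"
        and "\<forall>j\<in>Obj J. \<exists>x\<in>Fo (Fo T j) N. \<eta> (Fo T j) N x = Comp C N M (S (Fo T j)) (\<mu> j) n"
        and none: "\<not> (\<exists>x\<in>Fo Lim N. \<forall>j\<in>Obj J. \<eta> (Fo T j) N (\<pi> j N x) = Comp C N M (S (Fo T j)) (\<mu> j) n)"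
      then obtain t where t: "\<And>j. j \<in> Obj J \<Longrightarrow> t j \<in> Fo (Fo T j) N"
        "\<And>j. j \<in> Obj J \<Longrightarrow> \<eta> (Fo T j) N (t j) = Comp C N M (S (Fo T j)) (\<mu> j) n" by metis
      show "is_initial C N"
      proof (rule ccontr)
        assume nI: "\<not> is_initial C N"
        have "restrict t (Obj J) \<in> Fo (tup J T) N"
        proof (rule tupI)
          fix i j k assume *: "i \<in> Obj J" "j \<in> Obj J" "k \<in> Hom J i j"
          have "\<eta> (Fo T j) N (Fm T i j k N (t i)) = Comp C N (S (Fo T i)) (S (Fo T j)) (Fm L (Fo T i) (Fo T j) (Fm T i j k)) (\<eta> (Fo T i) N (t i))"
            using L_map(2)[OF Tj[OF *(1)] Tj[OF *(2)] Tk[OF *] N(1) t(1)[OF *(1)]] by simp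
          also have "\<dots> = Comp C N M (S (Fo T j)) (\<mu> j) n"
            using t(2)[OF *(1)] m(3)[OF *] Comp_assoc[OF N(2) m(2)[OF *(1)] L_map(1)[OF Tj[OF *(1)] Tj[OF *(2)] Tk[OF *]]
                N(1) m(1) S_Obj[OF Tj[OF *(1)]] S_Obj[OF Tj[OF *(2)]]] by simp
          also have "\<dots> = \<eta> (Fo T j) N (t j)" using t(2)[OF *(2)] by simp
          finally have "Fm T i j k N (t i) = t j"
            using \<eta>_locally_injective[OF Tj[OF *(2)] N(1) nat_in[OF Tk[OF *] t(1)[OF *(1)] N(1)] t(1)[OF *(2)]] nI by blast
          then show "Fm T i j k N (restrict t (Obj J) i) = restrict t (Obj J) j" using * by simp
        qed (use t(1) in auto)
        then obtain x where x: "x \<in> Fo Lim N" "restrict t (Obj J) = (\<lambda>j\<in>Obj J. \<pi> j N x)"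
          using bij[OF N(1)] unfolding bij_betw_def by blast
        have "\<pi> j N x = t j" if "j \<in> Obj J" for j using fun_cong[OF x(2), of j] that by simp
        then show False using none x(1) t(2) by auto
      qed
    qed
    have L\<pi>\<eta>: "Comp C N (S Lim) (S (Fo T j)) (?\<pi> j) (\<eta> Lim N x) = \<eta> (Fo T j) N (\<pi> j N x)"
      if "j \<in> Obj J" "N \<in> Obj C" "x \<in> Fo Lim N" for j N x
      by (rule L\<pi>(2)[OF that(1,1,2,3)])
    have SL: "S Lim \<in> Obj C" by (rule S_Obj[OF c(1)])
    have STj: "S (Fo T j) \<in> Obj C" if "j \<in> Obj J" for j by (rule S_Obj[OF Tj[OF that]])
    \<comment> \<open>Both arrows lift to elements of the limit presheaf over one cover. Away from
      initial pieces these elements have the same projections by local injectivity, and projections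
      determine them.\<close>
    have unique: "h = h'" if h: "h \<in> Hom C M (S Lim)" "h' \<in> Hom C M (S Lim)"
      and eq: "\<And>j. j \<in> Obj J \<Longrightarrow> Comp C M (S Lim) (S (Fo T j)) (?\<pi> j) h = Comp C M (S Lim) (S (Fo T j)) (?\<pi> j) h'" for h h'
    proof (rule covers_hom_eq[OF _ SL h])
      let ?P = "\<lambda>g N n. \<exists>x\<in>Fo Lim N. \<eta> Lim N x = Comp C N M (S Lim) g n"
      show "covers M (\<lambda>N n. \<forall>g\<in>{h, h'}. ?P g N n)"
      proof (rule covers_finite_inter[OF _ m(1)])
        fix g N n assume "g \<in> {h, h'}" and N: "N \<in> Obj C" "n \<in> Hom C N M"
        then have g: "g \<in> Hom C M (S Lim)" using h by blast
        show "covers N (\<lambda>N' n'. ?P g N' (Comp C N' N M n n'))"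
          by (rule covers_mono[OF \<eta>_locally_surjective[OF c(1) N(1) Comp_in[OF N(2) g N(1) m(1) SL]]])
            (use Comp_assoc[OF _ N(2) g _ N(1) m(1) SL] in simp)
        fix N' n' assume N': "N' \<in> Obj C" "n' \<in> Hom C N' N" and "?P g N n"
        then obtain x where x: "x \<in> Fo Lim N" "\<eta> Lim N x = Comp C N M (S Lim) g n" by blast
        show "?P g N' (Comp C N' N M n n')"
          using \<eta>_nat[OF c(1) N(1) N' x(1)] x(2) act_in[OF fams_pshD[OF c(1)] x(1) N'(2) N(1) N'(1)]
            Comp_assoc[OF N'(2) N(2) g N'(1) N(1) m(1) SL] by auto
      qed simp
      fix N n assume N: "N \<in> Obj C" "n \<in> Hom C N M" and "\<forall>g\<in>{h, h'}. ?P g N n"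
      then obtain x x' where x: "x \<in> Fo Lim N" "\<eta> Lim N x = Comp C N M (S Lim) h n"
        and x': "x' \<in> Fo Lim N" "\<eta> Lim N x' = Comp C N M (S Lim) h' n" by blast
      have \<pi>x: "\<pi> j N x = \<pi> j N x' \<or> is_initial C N" if j: "j \<in> Obj J" for j
      proof -
        have "\<eta> (Fo T j) N (\<pi> j N x) = \<eta> (Fo T j) N (\<pi> j N x')"
          using L\<pi>\<eta>[OF j N(1) x(1)] L\<pi>\<eta>[OF j N(1) x'(1)] x(2) x'(2) eq[OF j]
            Comp_assoc[OF N(2) h(1) L\<pi>(1)[OF j j] N(1) m(1) SL STj[OF j]]
            Comp_assoc[OF N(2) h(2) L\<pi>(1)[OF j j] N(1) m(1) SL STj[OF j]] by simp
        then show ?thesis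
          using \<eta>_locally_injective[OF Tj[OF j] N(1) nat_in[OF c(2)[OF j] x(1) N(1)] nat_in[OF c(2)[OF j] x'(1) N(1)]] by blast
      qed
      show "Comp C N M (S Lim) h n = Comp C N M (S Lim) h' n"
      proof (cases "is_initial C N")
        case True
        then show ?thesis
          by (rule initial_eq[OF _ SL Comp_in[OF N(2) h(1) N(1) m(1) SL] Comp_in[OF N(2) h(2) N(1) m(1) SL]])
      next
        case False
        then have "(\<lambda>j\<in>Obj J. \<pi> j N x) = (\<lambda>j\<in>Obj J. \<pi> j N x')" using \<pi>x by (intro restrict_ext) blast
        from inj_onD[OF bij_betw_imp_inj_on[OF bij[OF N(1)]] this x(1) x'(1)] show ?thesis using x(2) x'(2) by simp
      qed
    qed
    obtain K :: "nat set" and N n where K: "finite K" "\<And>i. i \<in> K \<Longrightarrow> N i \<in> Obj C" "is_coproduct C K N M n"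
      "\<And>i. i \<in> K \<Longrightarrow> n i \<in> Hom C (N i) M" "\<And>i. i \<in> K \<Longrightarrow> ?R (N i) (n i)"
      by (rule coversE[OF R]) blast
    have "\<exists>h. h \<in> Hom C (N i) (S Lim) \<and> (\<forall>j\<in>Obj J. Comp C (N i) (S Lim) (S (Fo T j)) (?\<pi> j) h = Comp C (N i) M (S (Fo T j)) (\<mu> j) (n i))"
      if i: "i \<in> K" for i
    proof (cases "is_initial C (N i)")
      case True
      then obtain h where h: "h \<in> Hom C (N i) (S Lim)" using SL unfolding is_initial_def by blast
      show ?thesis
        using h initial_eq[OF True STj Comp_in[OF h L\<pi>(1) K(2)[OF i] SL STj] Comp_in[OF K(4)[OF i] m(2) K(2)[OF i] m(1) STj]] by blast
    next
      case False
      then obtain x where x: "x \<in> Fo Lim (N i)" "\<forall>j\<in>Obj J. \<eta> (Fo T j) (N i) (\<pi> j (N i) x) = Comp C (N i) M (S (Fo T j)) (\<mu> j) (n i)"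
        using K(5)[OF i] by blast
      then show ?thesis
        using \<eta>_in[OF c(1) K(2)[OF i] x(1)] L\<pi>\<eta>[OF _ K(2)[OF i] x(1)] by auto
    qed
    then obtain g where g: "\<And>i. i \<in> K \<Longrightarrow> g i \<in> Hom C (N i) (S Lim)"
      "\<And>i j. i \<in> K \<Longrightarrow> j \<in> Obj J \<Longrightarrow> Comp C (N i) (S Lim) (S (Fo T j)) (?\<pi> j) (g i) = Comp C (N i) M (S (Fo T j)) (\<mu> j) (n i)"
      by metis
    obtain h where h: "h \<in> Hom C M (S Lim)" "\<And>i. i \<in> K \<Longrightarrow> Comp C (N i) M (S Lim) h (n i) = g i"
      using coproduct_desc[OF K(3) SL g(1)] by blast
    have h\<mu>: "Comp C M (S Lim) (S (Fo T j)) (?\<pi> j) h = \<mu> j" if j: "j \<in> Obj J" for j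
    proof (rule coproduct_hom_eq[OF K(3) STj[OF j] Comp_in[OF h(1) L\<pi>(1)[OF j j] m(1) SL STj[OF j]] m(2)[OF j] K(2)])
      fix i assume i: "i \<in> K"
      show "Comp C (N i) M (S (Fo T j)) (Comp C M (S Lim) (S (Fo T j)) (?\<pi> j) h) (n i) = Comp C (N i) M (S (Fo T j)) (\<mu> j) (n i)"
        using Comp_assoc[OF K(4)[OF i] h(1) L\<pi>(1)[OF j j] K(2)[OF i] m(1) SL STj[OF j]] h(2)[OF i] g(2)[OF i j] by simp
    qed
    show "\<exists>!h. h \<in> Hom C M (S Lim) \<and> (\<forall>j\<in>Obj J. Comp C M (S Lim) (S (Fo T j)) (?\<pi> j) h = \<mu> j)"
      by (rule ex1I[of _ h]) (use h(1) h\<mu> unique in auto)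
  qed
qed

end

theorem (in ls_categ) lextensive_imp_exact:
  assumes \<Phi>: "is_lext_class \<Phi>" and lext: "lextensive C"
  shows "Phi_exact \<Phi> C"
proof -
  have fc: "finitely_complete C" and hc: "has_finite_coproducts C" using lext by (simp_all add: lextensive_def)
  \<comment> \<open>One presentation and one coproduct are fixed for each presheaf, so that the
    reflection becomes a function of the presheaf.\<close>
  have "\<forall>F\<in>fams. \<exists>I A e S \<iota> \<eta>. finite (I :: nat set) \<and> ufam F I A e \<and> is_coproduct C I A S \<iota> \<and>
      \<eta> \<in> Hom (psh_cat C) F (representable C S) \<and> (\<forall>i\<in>I. \<eta> (A i) (e i) = \<iota> i)"
  proof
    fix F assume "F \<in> fams"
    then obtain I :: "nat set" and A e where F: "psh F" "finite I" "ufam F I A e" by (rule famsE)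
    have "A \<in> I \<rightarrow> Obj C" using ufamD(1)[OF F(3)] by blast
    then obtain S \<iota> where S: "is_coproduct C I A S \<iota>"
      using hc F(2) unfolding has_finite_coproducts_def by blast
    then have SO: "S \<in> Obj C" "\<And>i. i \<in> I \<Longrightarrow> \<iota> i \<in> Hom C (A i) S" by (auto simp: is_coproduct_def)
    obtain \<eta> where "\<eta> \<in> Hom (psh_cat C) F (representable C S)" "\<And>i. i \<in> I \<Longrightarrow> \<eta> (A i) (e i) = \<iota> i"
      by (rule ufam_nat_ex[OF F(1,3) psh_representable[OF SO(1)], of \<iota>]) (use SO in auto)
    with F S show "\<exists>I A e S \<iota> \<eta>. finite (I :: nat set) \<and> ufam F I A e \<and> is_coproduct C I A S \<iota> \<and>
      \<eta> \<in> Hom (psh_cat C) F (representable C S) \<and> (\<forall>i\<in>I. \<eta> (A i) (e i) = \<iota> i)" by blast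
  qed
  then obtain I :: "('o, 'u) psh \<Rightarrow> nat set" and A e S \<iota> \<eta> where *:
    "\<forall>F\<in>fams. finite (I F) \<and> ufam F (I F) (A F) (e F) \<and> is_coproduct C (I F) (A F) (S F) (\<iota> F) \<and>
      \<eta> F \<in> Hom (psh_cat C) F (representable C (S F)) \<and> (\<forall>i\<in>I F. \<eta> F (A F i) (e F i) = \<iota> F i)"
    unfolding bchoice_iff by blast
  interpret R: sum_reflection C I A e S \<iota> \<eta>
    by unfold_locales (use * lext in auto)
  show ?thesis
    unfolding Phi_exact_def Phi_l_eq_fams[OF fc \<Phi>]
    using fc R.L_lex R.L_left_adjoint by blast
qed

theorem mainTheorem7:
  fixes C :: "('o, 'u::set_universe) cat" and \<Phi>\<^sub>l\<^sub>e\<^sub>x\<^sub>t :: "'u weight set"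
  assumes "category C" and "locally_small C"
    and "is_lext_class \<Phi>\<^sub>l\<^sub>e\<^sub>x\<^sub>t"
  shows "Phi_exact \<Phi>\<^sub>l\<^sub>e\<^sub>x\<^sub>t C \<longleftrightarrow> lextensive C"
proof -
  interpret ls_categ C
    using assms(1,2) by unfold_locales
  show ?thesis
    using exact_imp_lextensive[OF assms(3)] lextensive_imp_exact[OF assms(3)] by blast
qed

end
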